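(* Let $m$ be a positive integer, let $\mu\subseteq\lambda$ be partitions with $\ell(\lambda)\le m$, and suppose $|\lambda/\mu|=n$ where $n$ is odd. Suppose that $\gcd(m,p)=1$ for every odd prime $p$ with $p\le n$. Let $X(q)=\sum_{T\in SP(\lambda/\mu,2m)}q^{\mathrm{pwr}(T)}$. Then $$X(q)\equiv\frac{|SP(\lambda/\mu,2m)|}{2m}\sum_{k=0}^{2m-1}q^k \pmod{q^{2m}-1}.$$
   Context: A partition $\lambda=(\lambda_1\ge\lambda_2\ge\cdots)$ has length $\ell(\lambda)$ (number of nonzero parts) and size $|\lambda|=\sum\lambda_i$. Write $\mu\subseteq\lambda$ if $\mu_i\le\lambda_i$ for all $i$ ($\mu=\emptyset$ allowed); $\lambda/\mu$ is the skew shape obtained by removing the boxes of the Young diagram of $\mu$ from that of $\lambda$ (English convention, left-justified rows), and $|\lambda/\mu|=|\lambda|-|\mu|$. Alphabet: $\mathcal M=\{1<2<\cdots<m<\overline m<\cdots<\overline 2<\overline 1\}$. A filling of a skew shape with letters of $\mathcal M$ is semistandard if entries weakly increase along rows from left to right and strictly increase down columns. Admissible columns and splitting: a column $C$ is a strictly increasing (top to bottom) sequence of letters of $\mathcal M$. Let $z_1>\cdots>z_r$ be the unbarred letters $z$ such that both $z$ and $\overline z$ occur in $C$. $C$ is admissible if there exist unbarred letters $t_1>\cdots>t_r$ in $\{1,\ldots,m\}$ such that $t_1$ is the greatest unbarred letter with $t_1<z_1$ and $t_1,\overline{t_1}\notin C$, and for $i=2,\ldots,r$, $t_i$ is the greatest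 unbarred letter with $t_i<\min(t_{i-1},z_i)$ and $t_i,\overline{t_i}\notin C$. In that case $rC$ is the column obtained from $C$ by replacing each $\overline{z_i}$ by $\overline{t_i}$ and reordering increasingly, and $\ell C$ is the column obtained from $C$ by replacing each $z_i$ by $t_i$ and reordering increasingly. A Kashiwara–Nakashima (KN) skew symplectic tableau of shape $\lambda/\mu$ is a semistandard filling $T$ of $\lambda/\mu$ with letters of $\mathcal M$, all of whose columns are admissible, such that the split form (the filling with twice as many columns obtained by replacing each column $C$ of $T$ by the two adjacent columns $\ell C, rC$, placed in the same rows) is again semistandard. $SP(\lambda/\mu,2m)$ denotes the set of these tableaux. For $T\in SP(\lambda/\mu,2m)$, let $a_i$ (resp. $a_{\overline i}$) be the number of entries of $T$ equal to $i$ (resp. $\overline i$), and define $\mathrm{pwr}(T)=\sum_{i=1}^m\big((i-1)a_i+(2m-i)a_{\overline i}\big)$. *)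

theory Defs
  imports
    "HOL-Library.FuncSet"
    "HOL-Computational_Algebra.Polynomial"
    "HOL-Number_Theory.Cong"
begin

section \<open>Partitions and skew shapes\<close>

text \<open>
  A partition is an eventually zero weakly decreasing function. Parts are numbered from 0, so the
  i-th part in the usual 1-based numbering is the value at i - 1; rows and columns of diagrams are
  numbered from 0 accordingly, from top to bottom and from left to right.
\<close>

definition is_partition :: "(nat \<Rightarrow> nat) \<Rightarrow> bool" where
  "is_partition lam \<longleftrightarrow> antimono lam \<and> finite {i. lam i \<noteq> 0}"

definition partition_length :: "(nat \<Rightarrow> nat) \<Rightarrow> nat" where
  "partition_length lam = card {i. lam i \<noteq> 0}"

definition partition_size :: "(nat \<Rightarrow> nat) \<Rightarrow> nat" where
  "partition_size lam = (\<Sum>i | lam i \<noteq> 0. lam i)"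

definition contained_in :: "(nat \<Rightarrow> nat) \<Rightarrow> (nat \<Rightarrow> nat) \<Rightarrow> bool" where
  "contained_in mu lam \<longleftrightarrow> (\<forall>i. mu i \<le> lam i)"

definition diagram :: "(nat \<Rightarrow> nat) \<Rightarrow> (nat \<times> nat) set" where
  "diagram lam = {(i, j). j < lam i}"

definition skew_shape :: "(nat \<Rightarrow> nat) \<Rightarrow> (nat \<Rightarrow> nat) \<Rightarrow> (nat \<times> nat) set" where
  "skew_shape lam mu = diagram lam - diagram mu"

definition skew_size :: "(nat \<Rightarrow> nat) \<Rightarrow> (nat \<Rightarrow> nat) \<Rightarrow> nat" where
  "skew_size lam mu = partition_size lam - partition_size mu"


section \<open>The alphabet\<close>

datatype letter = Unb nat | Bar nat

instantiation letter :: linorder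
begin

fun less_letter :: "letter \<Rightarrow> letter \<Rightarrow> bool" where
  "Unb i < Unb j \<longleftrightarrow> i < j"
| "Unb i < Bar j \<longleftrightarrow> True"
| "Bar i < Unb j \<longleftrightarrow> False"
| "Bar i < Bar j \<longleftrightarrow> j < i"

definition less_eq_letter :: "letter \<Rightarrow> letter \<Rightarrow> bool" where
  "x \<le> y \<longleftrightarrow> x < y \<or> x = (y :: letter)"

instance
proof
  fix x y z :: letter
  show "x < y \<longleftrightarrow> x \<le> y \<and> \<not> y \<le> x"
    by (cases x; cases y) (auto simp: less_eq_letter_def)
  show "x \<le> x"
    by (simp add: less_eq_letter_def)
  show "x \<le> y \<Longrightarrow> y \<le> z \<Longrightarrow> x \<le> z"
    by (cases x; cases y; cases z) (auto simp: less_eq_letter_def)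
  show "x \<le> y \<Longrightarrow> y \<le> x \<Longrightarrow> x = y"
    by (cases x; cases y) (auto simp: less_eq_letter_def)
  show "x \<le> y \<or> y \<le> x"
    by (cases x; cases y) (auto simp: less_eq_letter_def)
qed

end

definition alphabet :: "nat \<Rightarrow> letter set" where
  "alphabet m = Unb ` {1..m} \<union> Bar ` {1..m}"


section \<open>Admissible columns and splitting\<close>

text \<open>Columns are lists, read from top to bottom.\<close>

definition is_column :: "nat \<Rightarrow> letter list \<Rightarrow> bool" where
  "is_column m C \<longleftrightarrow> set C \<subseteq> alphabet m \<and> sorted_wrt (<) C"

text \<open>The list \<open>z\<^sub>1 > \<dots> > z\<^sub>r\<close>; in the code \<open>z\<^sub>i\<close> and \<open>t\<^sub>i\<close> are the list entries at index \<open>i - 1\<close>.\<close>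

definition paired_letters :: "letter list \<Rightarrow> nat list" where
  "paired_letters C = rev (sorted_list_of_set {z. Unb z \<in> set C \<and> Bar z \<in> set C})"

definition unused_below :: "nat \<Rightarrow> letter list \<Rightarrow> nat \<Rightarrow> nat set" where
  "unused_below m C b = {t \<in> {1..m}. t < b \<and> Unb t \<notin> set C \<and> Bar t \<notin> set C}"

definition is_greatest_in :: "nat \<Rightarrow> nat set \<Rightarrow> bool" where
  "is_greatest_in t A \<longleftrightarrow> t \<in> A \<and> (\<forall>s\<in>A. s \<le> t)"

definition is_splitting :: "nat \<Rightarrow> letter list \<Rightarrow> nat list \<Rightarrow> bool" where
  "is_splitting m C ts \<longleftrightarrow>
     (let zs = paired_letters C in
        length ts = length zs \<and>
        (\<forall>i < length zs.
           is_greatest_in (ts ! i)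
             (unused_below m C (if i = 0 then zs ! 0 else min (ts ! (i - 1)) (zs ! i)))))"

definition admissible :: "nat \<Rightarrow> letter list \<Rightarrow> bool" where
  "admissible m C \<longleftrightarrow> is_column m C \<and> (\<exists>ts. is_splitting m C ts)"

text \<open>
  The splitting list of an admissible column is unique, its entries being determined one after
  another. The two functions below are only meaningful on admissible columns.
\<close>

definition splitting :: "nat \<Rightarrow> letter list \<Rightarrow> nat list" where
  "splitting m C = (THE ts. is_splitting m C ts)"

definition replacement :: "nat \<Rightarrow> letter list \<Rightarrow> nat \<Rightarrow> nat" where
  "replacement m C x =
     (case map_of (zip (paired_letters C) (splitting m C)) x of None \<Rightarrow> x | Some t \<Rightarrow> t)"

definition right_column :: "nat \<Rightarrow> letter list \<Rightarrow> letter list" where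
  "right_column m C =
     sort (map (\<lambda>a. case a of Unb x \<Rightarrow> Unb x | Bar x \<Rightarrow> Bar (replacement m C x)) C)"

definition left_column :: "nat \<Rightarrow> letter list \<Rightarrow> letter list" where
  "left_column m C =
     sort (map (\<lambda>a. case a of Unb x \<Rightarrow> Unb (replacement m C x) | Bar x \<Rightarrow> Bar x) C)"


section \<open>Kashiwara--Nakashima skew symplectic tableaux\<close>

definition semistandard :: "(nat \<times> nat) set \<Rightarrow> (nat \<times> nat \<Rightarrow> letter) \<Rightarrow> bool" where
  "semistandard D T \<longleftrightarrow>
     (\<forall>i j j'. (i, j) \<in> D \<and> (i, j') \<in> D \<and> j < j' \<longrightarrow> T (i, j) \<le> T (i, j')) \<and>
     (\<forall>i i' j. (i, j) \<in> D \<and> (i', j) \<in> D \<and> i < i' \<longrightarrow> T (i, j) < T (i', j))"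

definition column_of :: "(nat \<times> nat) set \<Rightarrow> (nat \<times> nat \<Rightarrow> letter) \<Rightarrow> nat \<Rightarrow> letter list" where
  "column_of D T j = map (\<lambda>i. T (i, j)) (sorted_list_of_set {i. (i, j) \<in> D})"

text \<open>
  Column \<open>j\<close> of the original filling gives rise to the columns \<open>2 * j\<close> (its left column) and
  \<open>2 * j + 1\<close> (its right column) of the split form. The entry in row \<open>i\<close> is found at the list index
  that counts the boxes above row \<open>i\<close> in column \<open>j\<close>.
\<close>

definition split_shape :: "(nat \<times> nat) set \<Rightarrow> (nat \<times> nat) set" where
  "split_shape D = {(i, j). (i, j div 2) \<in> D}"

definition split_form ::
    "nat \<Rightarrow> (nat \<times> nat) set \<Rightarrow> (nat \<times> nat \<Rightarrow> letter) \<Rightarrow> nat \<times> nat \<Rightarrow> letter" where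
  "split_form m D T = (\<lambda>(i, j).
     (if even j then left_column m (column_of D T (j div 2))
      else right_column m (column_of D T (j div 2)))
     ! card {i'. i' < i \<and> (i', j div 2) \<in> D})"

text \<open>
  Fillings are extensional functions (with a fixed dummy value outside the shape), so that distinct
  elements of the following set are distinct tableaux.
\<close>

definition SP :: "(nat \<Rightarrow> nat) \<Rightarrow> (nat \<Rightarrow> nat) \<Rightarrow> nat \<Rightarrow> (nat \<times> nat \<Rightarrow> letter) set" where
  "SP lam mu m =
     {T \<in> skew_shape lam mu \<rightarrow>\<^sub>E alphabet m.
        semistandard (skew_shape lam mu) T \<and>
        (\<forall>j. admissible m (column_of (skew_shape lam mu) T j)) \<and>
        semistandard (split_shape (skew_shape lam mu)) (split_form m (skew_shape lam mu) T)}"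

definition letter_count :: "(nat \<times> nat) set \<Rightarrow> (nat \<times> nat \<Rightarrow> letter) \<Rightarrow> letter \<Rightarrow> nat" where
  "letter_count D T a = card {c \<in> D. T c = a}"

definition pwr :: "nat \<Rightarrow> (nat \<times> nat) set \<Rightarrow> (nat \<times> nat \<Rightarrow> letter) \<Rightarrow> nat" where
  "pwr m D T =
     (\<Sum>i = 1..m. (i - 1) * letter_count D T (Unb i) + (2 * m - i) * letter_count D T (Bar i))"

text \<open>
  Rational coefficients are used because the congruence of interest involves the fraction
  \<open>|SP(\<lambda>/\<mu>, 2m)| / 2m\<close>. As \<open>q\<^bsup>2m\<^esup> - 1\<close> is monic, division with remainder does not leave the
  integer polynomials, so the congruence over the rationals forces this fraction to be an integer
  and is equivalent to the congruence over the integers.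
\<close>

definition SP_poly :: "(nat \<Rightarrow> nat) \<Rightarrow> (nat \<Rightarrow> nat) \<Rightarrow> nat \<Rightarrow> rat poly" where
  "SP_poly lam mu m = (\<Sum>T \<in> SP lam mu m. monom 1 (pwr m (skew_shape lam mu) T))"

end

theory Submission
  imports Defs Complex_Main "HOL-Combinatorics.Permutations"
begin

text \<open>
  It suffices that \<open>X\<close> vanishes at every \<open>\<zeta> \<noteq> 1\<close> with \<open>\<zeta>\<^sup>2\<^sup>m = 1\<close>; by Fourier inversion the values
  of \<open>pwr\<close> are then equidistributed modulo \<open>2m\<close> (\<open>equidistribution\<close>).

  Let \<open>v\<^sub>x\<close> be the number of entries \<open>x\<close> minus the number of entries \<open>Bar x\<close> in a tableau, choose
  \<open>\<eta>\<close> with \<open>\<eta>\<^sup>2 = \<zeta>\<close>, and put \<open>y\<^sub>x = \<eta>\<^sup>2\<^sup>x\<^sup>-\<^sup>1\<close>. Up to the constant factor \<open>\<eta>\<^sup>n\<close>, the tableau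
  contributes the monomial with exponent vector \<open>v\<close> in the \<open>y\<^sub>x\<close> (\<open>pwr_monomial\<close>). Suppose that
  the multiset of the weights \<open>v\<close> is invariant under all permutations and sign changes of the
  coordinates. Then \<open>X(\<zeta>)\<close> is a combination of sums of monomials over orbits of signed
  permutations. Such a sum is a polynomial in the power sums \<open>p\<^sub>k = \<Sum>\<^sub>x (y\<^sub>x\<^sup>k + y\<^sub>x\<^sup>-\<^sup>k)\<close>, and
  since the sum of the \<open>v\<^sub>x\<close> is odd and the sum of their absolute values is at most \<open>n\<close>, each of
  its terms has a factor \<open>p\<^sub>k\<close> with \<open>k\<close> odd and \<open>\<bar>k\<bar> \<le> n\<close> (\<open>injective_sum_zero\<close>). The \<open>y\<^sub>x\<close> and
  their inverses are the numbers \<open>\<eta> * \<zeta>\<^sup>j\<close> with \<open>0 \<le> j < 2m\<close>, and \<open>k\<close> is prime to \<open>2m\<close> by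
  hypothesis, so \<open>p\<^sub>k\<close> is a vanishing geometric sum (\<open>roots_of_unity_power_sum_zero\<close>).

  The symmetry of the weights is proved for the simple reflections. The split form is regarded as
  a sequence of columns without pairs \<open>z\<close>, \<open>Bar z\<close>, that is, of sign vectors, subject to two sets
  of conditions: inequalities between neighbouring columns, one for each letter of the alphabet,
  which express semistandardness (\<open>rowwise_le_iff\<close>), and a condition on the pairs \<open>\<ell>C\<close>, \<open>rC\<close>
  (\<open>split_pair\<close>). A simple reflection affects only the inequalities at one or two letters. Fixing
  all data up to the reflection of single columns, one is left with a sequence of signs in which
  certain neighbours must not be \<open>-\<close>, \<open>+\<close>. The signs therefore decompose into chains, each of
  which carries an arbitrary sequence of the form \<open>+ \<dots> + - \<dots> -\<close>, and so the two signs play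
  symmetric roles (\<open>sum_closed_subsets_flip\<close>, \<open>sum_flip_class\<close>).
\<close>

section \<open>Subsets closed under a partial injection\<close>

text \<open>
  A pair \<open>(q, q')\<close> in \<open>E\<close> demands that \<open>q\<close> belongs to a closed set as soon as \<open>q'\<close> does.
\<close>

definition closed_subsets :: "'a set \<Rightarrow> ('a \<times> 'a) set \<Rightarrow> 'a set set" where
  "closed_subsets Q E = {P. P \<subseteq> Q \<and> (\<forall>(q, q') \<in> E. q' \<in> P \<longrightarrow> q \<in> P)}"

text \<open>
  The closed subsets of \<open>Q\<close> are distributed symmetrically by cardinality. Without links,
  complementation shows this. A link \<open>(a, b)\<close> excludes the sets with \<open>b\<close> but without \<open>a\<close>; as no
  other link starts at \<open>a\<close> or ends at \<open>b\<close>, these correspond to the closed subsets of \<open>Q - {a, b}\<close>,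
  and the claim follows by induction on the number of links.
\<close>

lemma sum_closed_subsets_flip:
  fixes F :: "nat \<Rightarrow> complex"
  assumes "finite Q" "finite E" "E \<subseteq> Q \<times> Q" "single_valued E" "single_valued (E\<inverse>)"
  shows "(\<Sum>P\<in>closed_subsets Q E. F (card P)) = (\<Sum>P\<in>closed_subsets Q E. F (card Q - card P))"
  using assms
proof (induction "card E" arbitrary: E Q F rule: less_induct)
  case less
  show ?case
  proof (cases "E = {}")
    case True
    have bij: "bij_betw (\<lambda>P. Q - P) (Pow Q) (Pow Q)"
      by (rule bij_betw_byWitness[where f' = "\<lambda>P. Q - P"]) auto
    have "(\<Sum>P\<in>Pow Q. F (card P)) = (\<Sum>P\<in>Pow Q. F (card (Q - P)))"
      using sum.reindex_bij_betw[OF bij, of "\<lambda>P. F (card P)"] by simp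
    also have "\<dots> = (\<Sum>P\<in>Pow Q. F (card Q - card P))"
      using less.prems(1) by (intro sum.cong refl) (auto simp: card_Diff_subset finite_subset)
    finally show ?thesis using True by (simp add: closed_subsets_def Pow_def)
  next
    case False
    then obtain a b where ab: "(a, b) \<in> E" by auto
    have aQ: "a \<in> Q" "b \<in> Q" using ab less.prems(3) by auto
    define E1 where "E1 = E - {(a, b)}"
    have finE1: "finite E1" and cardE1: "card E1 < card E"
      using less.prems(2) ab unfolding E1_def by (auto simp only: finite_Diff card_Diff1_less)
    have sv1: "single_valued E1" "single_valued (E1\<inverse>)" "E1 \<subseteq> Q \<times> Q"
      using less.prems(3-5) unfolding E1_def single_valued_def by blast+
    note IH1 = less.hyps[OF cardE1 less.prems(1) finE1 sv1(3) sv1(1,2)]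
    show ?thesis
    proof (cases "a = b")
      case True
      then have "closed_subsets Q E = closed_subsets Q E1"
        unfolding closed_subsets_def E1_def by auto
      then show ?thesis using IH1 by simp
    next
      case neq: False
      define Q2 where "Q2 = Q - {a, b}"
      define E2 where "E2 = E \<inter> Q2 \<times> Q2"
      have fin2: "finite Q2" "finite E2" "E2 \<subseteq> Q2 \<times> Q2" "card E2 < card E"
        using less.prems(1,2) ab unfolding Q2_def E2_def by (auto intro!: psubset_card_mono)
      have sv2: "single_valued E2" "single_valued (E2\<inverse>)"
        using less.prems(4,5) unfolding E2_def single_valued_def by blast+
      define Bad where "Bad = {P \<in> closed_subsets Q E1. a \<notin> P \<and> b \<in> P}"
      have finC: "finite (closed_subsets Q E1)" "finite (closed_subsets Q2 E2)"
        unfolding closed_subsets_def using less.prems(1) fin2(1) by auto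
      have CE: "closed_subsets Q E = closed_subsets Q E1 - Bad"
        unfolding Bad_def closed_subsets_def E1_def using ab by auto
      have Badsub: "Bad \<subseteq> closed_subsets Q E1" unfolding Bad_def by auto
      have out: "q' = b" if "(a, q') \<in> E" for q'
        using that ab less.prems(4) unfolding single_valued_def by blast
      have inn: "q = a" if "(q, b) \<in> E" for q
        using that ab less.prems(5) unfolding single_valued_def by blast
      have bij: "bij_betw (insert b) (closed_subsets Q2 E2) Bad"
      proof (rule bij_betw_byWitness[where f' = "\<lambda>P. P - {b}"])
        show "\<forall>P\<in>closed_subsets Q2 E2. insert b P - {b} = P"
          unfolding closed_subsets_def Q2_def by auto
        show "\<forall>P\<in>Bad. insert b (P - {b}) = P" unfolding Bad_def by auto
        show "insert b ` closed_subsets Q2 E2 \<subseteq> Bad"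
        proof
          fix P' assume "P' \<in> insert b ` closed_subsets Q2 E2"
          then obtain P where P: "P \<in> closed_subsets Q2 E2" "P' = insert b P" by auto
          have PQ: "P \<subseteq> Q2" using P(1) unfolding closed_subsets_def by auto
          have "q \<in> insert b P" if "(q, q') \<in> E1" "q' \<in> insert b P" for q q'
          proof -
            have qE: "(q, q') \<in> E" "(q, q') \<noteq> (a, b)" using that(1) unfolding E1_def by auto
            have "q' \<noteq> b" using qE inn by auto
            then have q'P: "q' \<in> P" using that(2) by auto
            have "q \<noteq> a" using qE out by auto
            show ?thesis
            proof (cases "q = b")
              case False
              then have "(q, q') \<in> E2"
                using qE \<open>q \<noteq> a\<close> q'P PQ less.prems(3) unfolding E2_def Q2_def by auto
              then show ?thesis using P(1) q'P unfolding closed_subsets_def by auto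
            qed auto
          qed
          then show "P' \<in> Bad"
            unfolding Bad_def closed_subsets_def using P(2) PQ aQ neq unfolding Q2_def by auto
        qed
        show "(\<lambda>P. P - {b}) ` Bad \<subseteq> closed_subsets Q2 E2"
          unfolding Bad_def closed_subsets_def E2_def Q2_def E1_def by fastforce
      qed
      have cardQ: "card Q = card Q2 + 2"
        using aQ neq less.prems(1) unfolding Q2_def
        by (metis Diff_insert2 One_nat_def Suc_1 add_2_eq_Suc' card_Suc_Diff1 finite_Diff insert_Diff insertE)
      have inB: "card (insert b P) = card P + 1 \<and> card P \<le> card Q2" if "P \<in> closed_subsets Q2 E2" for P
      proof -
        have "P \<subseteq> Q2" using that unfolding closed_subsets_def by auto
        then have "finite P" "b \<notin> P" "card P \<le> card Q2"
          using fin2(1) unfolding Q2_def by (auto intro: finite_subset card_mono)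
        then show ?thesis by simp
      qed
      have "(\<Sum>P\<in>Bad. F (card P)) = (\<Sum>P\<in>closed_subsets Q2 E2. F (card (insert b P)))"
        using sum.reindex_bij_betw[OF bij, of "\<lambda>P. F (card P)"] by simp
      also have "\<dots> = (\<Sum>P\<in>closed_subsets Q2 E2. (\<lambda>x. F (x + 1)) (card P))"
        using inB by (intro sum.cong) auto
      also have "\<dots> = (\<Sum>P\<in>closed_subsets Q2 E2. (\<lambda>x. F (x + 1)) (card Q2 - card P))"
        using less.hyps[OF fin2(4,1,2,3) sv2] .
      also have "\<dots> = (\<Sum>P\<in>closed_subsets Q2 E2. F (card Q - card (insert b P)))"
      proof (intro sum.cong refl)
        fix P assume "P \<in> closed_subsets Q2 E2"
        then have "card Q2 - card P + 1 = card Q - card (insert b P)"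
          using inB[of P] cardQ by auto
        then show "F (card Q2 - card P + 1) = F (card Q - card (insert b P))" by (simp only:)
      qed
      also have "\<dots> = (\<Sum>P\<in>Bad. F (card Q - card P))"
        using sum.reindex_bij_betw[OF bij, of "\<lambda>P. F (card Q - card P)"] by simp
      finally have "(\<Sum>P\<in>Bad. F (card P)) = (\<Sum>P\<in>Bad. F (card Q - card P))" .
      then show ?thesis
        unfolding CE using sum_diff[OF finC(1) Badsub] IH1 by metis
    qed
  qed
qed

section \<open>Reflecting chains of linked columns\<close>

lemma sum_lessThan_double:
  fixes f :: "nat \<Rightarrow> 'a::comm_monoid_add"
  shows "(\<Sum>k<2 * W. f k) = (\<Sum>j<W. f (2 * j) + f (2 * j + 1))"
  by (induction W) (simp_all add: ac_simps)

text \<open>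
  An abstract form of the action of one simple reflection. The elements of \<open>V\<close> are configurations
  of column states; the positions \<open>2 * j\<close> and \<open>2 * j + 1\<close> form a pair (the left and the right half
  of a column). The reflection acts on states by \<open>fl\<close>, and \<open>w\<close> is the pairing of the weight of a
  state with the simple coroot. A pair is tied when its states have \<open>w\<close>-value \<open>1\<close> or \<open>-1\<close>; it then
  either has equal values, which can only be changed together, or the values \<open>-1\<close> and \<open>1\<close>, which
  cannot be changed at all. Apart from this, reflecting some of the states of a configuration can
  only fail to give a configuration at neighbouring positions where a negative state is followed
  by a positive one; \<open>ok\<close> is the condition to be checked there.
\<close>

locale flip_system =
  fixes W :: nat and V :: "(nat \<Rightarrow> 'e) set" and w :: "'e \<Rightarrow> int" and fl :: "'e \<Rightarrow> 'e"
    and ok :: "nat \<Rightarrow> 'e \<Rightarrow> 'e \<Rightarrow> bool"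
  assumes finV: "finite V"
    and w_range: "c \<in> V \<Longrightarrow> \<bar>w (c k)\<bar> \<le> 2"
    and w_support: "c \<in> V \<Longrightarrow> 2 * W \<le> k \<Longrightarrow> w (c k) = 0"
    and fl_fl: "fl (fl e) = e"
    and w_fl: "w (fl e) = - w e"
    and fl_id: "w e = 0 \<Longrightarrow> fl e = e"
    and tied_pair: "c \<in> V \<Longrightarrow> \<bar>w (c (2 * j))\<bar> = 1 \<longleftrightarrow> \<bar>w (c (2 * j + 1))\<bar> = 1"
    and tied_cases: "c \<in> V \<Longrightarrow> \<bar>w (c (2 * j))\<bar> = 1 \<Longrightarrow>
           w (c (2 * j)) = w (c (2 * j + 1)) \<or> w (c (2 * j)) = -1 \<and> w (c (2 * j + 1)) = 1"
    and tied_inv: "c \<in> V \<Longrightarrow> c' \<in> V \<Longrightarrow> (\<And>k. c' k = c k \<or> c' k = fl (c k)) \<Longrightarrow>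
           \<bar>w (c (2 * j))\<bar> = 1 \<Longrightarrow>
           w (c (2 * j)) = w (c (2 * j + 1)) \<longleftrightarrow> w (c' (2 * j)) = w (c' (2 * j + 1))"
    and ok: "c \<in> V \<Longrightarrow> ok k (c k) (c (Suc k))"
    and flip_valid: "c \<in> V \<Longrightarrow> (\<And>k. c' k = c k \<or> c' k = fl (c k)) \<Longrightarrow>
           (\<And>j. \<bar>w (c (2 * j))\<bar> = 1 \<Longrightarrow>
              if w (c (2 * j)) = w (c (2 * j + 1)) then w (c' (2 * j)) = w (c' (2 * j + 1))
              else c' (2 * j) = c (2 * j) \<and> c' (2 * j + 1) = c (2 * j + 1)) \<Longrightarrow>
           (\<And>k. w (c' k) < 0 \<Longrightarrow> w (c' (Suc k)) > 0 \<Longrightarrow> ok k (c' k) (c' (Suc k))) \<Longrightarrow>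
           c' \<in> V"
begin

text \<open>
  The pairing of the coroot with the sum of all states; this sum is twice the weight of a tableau.
\<close>

definition total :: "(nat \<Rightarrow> 'e) \<Rightarrow> int" where
  "total c = (\<Sum>j<W. w (c (2 * j)) + w (c (2 * j + 1)))"

text \<open>
  The configurations that arise from a given one by reflecting some of its states.
\<close>

definition flip_class :: "(nat \<Rightarrow> 'e) \<Rightarrow> (nat \<Rightarrow> 'e) set" where
  "flip_class c0 = {c \<in> V. \<forall>k. c k = c0 k \<or> c k = fl (c0 k)}"

lemma flip_class_sym: "c \<in> flip_class c0 \<Longrightarrow> c0 \<in> V \<Longrightarrow> c0 \<in> flip_class c"
  unfolding flip_class_def mem_Collect_eq by (metis fl_fl)

lemma flip_class_trans:
  "c \<in> flip_class c0 \<Longrightarrow> d \<in> flip_class c \<Longrightarrow> d \<in> flip_class c0"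
  unfolding flip_class_def mem_Collect_eq by (metis fl_fl)

text \<open>
  The two orientations of a state. They are only used for states with nonzero \<open>w\<close>-value.
\<close>

definition pos where "pos e = (if w e > 0 then e else fl e)"
definition neg where "neg e = (if w e > 0 then fl e else e)"

lemma w_pos [simp]: "w (pos e) = \<bar>w e\<bar>" and w_neg [simp]: "w (neg e) = - \<bar>w e\<bar>"
  unfolding pos_def neg_def by (auto simp: w_fl)

definition tied where "tied c0 k \<longleftrightarrow> \<bar>w (c0 k)\<bar> = 1"

text \<open>
  A position is free if the sign of its state can vary within the class.
\<close>

definition free where
  "free c0 k \<longleftrightarrow> w (c0 k) \<noteq> 0 \<and>
     (tied c0 k \<longrightarrow> w (c0 (2 * (k div 2))) = w (c0 (2 * (k div 2) + 1)))"

text \<open>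
  The two positions of a tied pair vary together, so they are represented by the even one.
\<close>

definition item where "item c0 k = (if tied c0 k then 2 * (k div 2) else k)"

definition items where "items c0 = item c0 ` {k. free c0 k}"

text \<open>
  The configuration of the class in which exactly the items of \<open>P\<close> are oriented positively.
\<close>

definition conf where
  "conf c0 P k = (if free c0 k then (if item c0 k \<in> P then pos (c0 k) else neg (c0 k)) else c0 k)"

text \<open>
  A link records that a negative item must not be followed by a positive one. The resulting
  relation on items is a partial injection, because a link joins neighbouring positions.
\<close>

definition links where
  "links c0 = {(item c0 k, item c0 (Suc k)) | k. free c0 k \<and> free c0 (Suc k) \<and>
       item c0 k \<noteq> item c0 (Suc k) \<and> \<not> ok k (neg (c0 k)) (pos (c0 (Suc k)))}"

context
  fixes c0 assumes c0: "c0 \<in> V"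
begin

lemma tied_partner: "k div 2 = k' div 2 \<Longrightarrow> tied c0 k \<longleftrightarrow> tied c0 k'"
proof -
  have *: "tied c0 k \<longleftrightarrow> tied c0 (2 * (k div 2))" for k
    unfolding tied_def using tied_pair[OF c0, of "k div 2"]
    by (cases "even k") (auto elim!: evenE oddE)
  show "k div 2 = k' div 2 \<Longrightarrow> ?thesis" using *[of k] *[of k'] by simp
qed

lemma free_partner: "k div 2 = k' div 2 \<Longrightarrow> tied c0 k \<Longrightarrow> free c0 k \<longleftrightarrow> free c0 k'"
  using tied_partner[of k k'] unfolding free_def tied_def by auto

lemma item_eqD: "item c0 k = item c0 k' \<Longrightarrow> k \<noteq> k' \<Longrightarrow> tied c0 k \<and> k div 2 = k' div 2"
  unfolding item_def using tied_partner[of k k'] tied_partner[of "2 * (k div 2)" k]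
    tied_partner[of "2 * (k' div 2)" k']
  by (auto split: if_splits) 

lemma locked_values:
  assumes "\<not> free c0 k" "w (c0 k) \<noteq> 0"
  shows "tied c0 k" "w (c0 k) = (if even k then -1 else 1)"
proof -
  show t: "tied c0 k" using assms unfolding free_def by auto
  have ne: "w (c0 (2 * (k div 2))) \<noteq> w (c0 (2 * (k div 2) + 1))"
    using assms unfolding free_def by auto
  have t2: "\<bar>w (c0 (2 * (k div 2)))\<bar> = 1"
    using t tied_partner[of k "2 * (k div 2)"] unfolding tied_def by auto
  from tied_cases[OF c0 t2] ne
  have "w (c0 (2 * (k div 2))) = -1" "w (c0 (2 * (k div 2) + 1)) = 1" by auto
  then show "w (c0 k) = (if even k then -1 else 1)"
    by (cases "even k") (auto elim!: evenE oddE)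
qed

lemma finite_free: "{k. free c0 k} \<subseteq> {..<2 * W}"
  using w_support[OF c0] unfolding free_def by (force simp: not_le[symmetric])

lemma finite_items: "finite (items c0)"
  unfolding items_def using finite_free finite_subset by blast

lemma finite_links: "finite (links c0)"
proof (rule finite_subset)
  show "links c0 \<subseteq> items c0 \<times> items c0" unfolding links_def items_def by auto
  show "finite (items c0 \<times> items c0)" using finite_items by simp
qed

lemma linksE:
  assumes "(x, y) \<in> links c0"
  obtains k where "x = item c0 k" "y = item c0 (Suc k)" "x \<noteq> y" "free c0 k" "free c0 (Suc k)"
    "\<not> ok k (neg (c0 k)) (pos (c0 (Suc k)))"
  using assms unfolding links_def by auto

lemma links_single_valued: "single_valued (links c0)"
proof (rule single_valuedI)
  fix x y z assume "(x, y) \<in> links c0" "(x, z) \<in> links c0"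
  then obtain k l where k: "x = item c0 k" "y = item c0 (Suc k)" "x \<noteq> y"
    and l: "x = item c0 l" "z = item c0 (Suc l)" "x \<noteq> z"
    by (elim linksE)
  have "k = l"
  proof (rule ccontr)
    assume "k \<noteq> l"
    then have "tied c0 k" "k div 2 = l div 2" using item_eqD[of k l] k(1) l(1) by auto
    moreover from this have "Suc k = l \<or> Suc l = k" using \<open>k \<noteq> l\<close> by presburger
    ultimately show False using k l by auto
  qed
  then show "y = z" using k l by simp
qed

lemma links_converse_single_valued: "single_valued ((links c0)\<inverse>)"
proof (rule single_valuedI)
  fix x y z assume "(x, y) \<in> (links c0)\<inverse>" "(x, z) \<in> (links c0)\<inverse>"
  then have "(y, x) \<in> links c0" "(z, x) \<in> links c0" by auto
  then obtain k l where k: "y = item c0 k" "x = item c0 (Suc k)" "x \<noteq> y"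
    and l: "z = item c0 l" "x = item c0 (Suc l)" "x \<noteq> z"
    by (elim linksE) auto
  have "k = l"
  proof (rule ccontr)
    assume "k \<noteq> l"
    then have "tied c0 (Suc k)" "Suc k div 2 = Suc l div 2" using item_eqD[of "Suc k" "Suc l"] k(2) l(2) by auto
    moreover from this have "Suc k = l \<or> Suc l = k" using \<open>k \<noteq> l\<close> by presburger
    ultimately show False using k l by auto
  qed
  then show "y = z" using k l by simp
qed

lemma conf_class: "conf c0 P k = c0 k \<or> conf c0 P k = fl (c0 k)"
  unfolding conf_def pos_def neg_def by auto

lemma w_conf_free:
  assumes "free c0 k"
  shows "w (conf c0 P k) = (if item c0 k \<in> P then \<bar>w (c0 k)\<bar> else - \<bar>w (c0 k)\<bar>)"
    and "w (c0 k) \<noteq> 0"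
  using assms unfolding conf_def free_def by auto

lemma conf_in_V:
  assumes P: "P \<in> closed_subsets (items c0) (links c0)"
  shows "conf c0 P \<in> V"
proof (rule flip_valid[OF c0 conf_class])
  fix j assume t: "\<bar>w (c0 (2 * j))\<bar> = 1"
  then have tt: "tied c0 (2 * j)" "tied c0 (2 * j + 1)"
    using tied_partner[of "2 * j" "2 * j + 1"] unfolding tied_def by auto
  then have ne: "w (c0 (2 * j)) \<noteq> 0" "w (c0 (2 * j + 1)) \<noteq> 0" unfolding tied_def by auto
  show "if w (c0 (2 * j)) = w (c0 (2 * j + 1))
        then w (conf c0 P (2 * j)) = w (conf c0 P (2 * j + 1))
        else conf c0 P (2 * j) = c0 (2 * j) \<and> conf c0 P (2 * j + 1) = c0 (2 * j + 1)"
    using tt ne unfolding conf_def free_def item_def by auto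
next
  fix k assume k: "w (conf c0 P k) < 0" "w (conf c0 P (Suc k)) > 0"
  show "ok k (conf c0 P k) (conf c0 P (Suc k))"
  proof (cases "free c0 k \<and> free c0 (Suc k)")
    case True
    then have it: "item c0 k \<notin> P" "item c0 (Suc k) \<in> P"
      using k w_conf_free(1)[of k P] w_conf_free(1)[of "Suc k" P] by (auto split: if_splits)
    then have "(item c0 k, item c0 (Suc k)) \<notin> links c0"
      using P unfolding closed_subsets_def by auto
    moreover have "item c0 k \<noteq> item c0 (Suc k)" using it by auto
    ultimately have "ok k (neg (c0 k)) (pos (c0 (Suc k)))"
      using True unfolding links_def by blast
    then show ?thesis using True it unfolding conf_def by simp
  next
    case False
    have e: "even k" if "\<not> free c0 k"
      using that k locked_values[of k] unfolding conf_def by (auto split: if_splits)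
    have o: "even k" if "\<not> free c0 (Suc k)"
      using that k locked_values[of "Suc k"] unfolding conf_def by (auto split: if_splits)
    have "even k" using False e o by auto
    then have d: "k div 2 = Suc k div 2" by presburger
    have "\<not> free c0 k \<and> \<not> free c0 (Suc k)"
      using False free_partner[OF d] free_partner[OF d[symmetric]] locked_values(1)[of k]
        locked_values(1)[of "Suc k"] k unfolding conf_def by (auto split: if_splits)
    then show ?thesis using ok[OF c0] unfolding conf_def by simp
  qed
qed

lemma items_from_conf:
  assumes "P \<subseteq> items c0"
  shows "P = item c0 ` {k. free c0 k \<and> w (conf c0 P k) > 0}"
  using assms w_conf_free(1)[of _ P] w_conf_free(2) unfolding items_def
  by (force split: if_splits simp: image_def)

lemma conf_surj:
  assumes c: "c \<in> flip_class c0"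
  shows "\<exists>P\<in>closed_subsets (items c0) (links c0). c = conf c0 P"
proof -
  define P where "P = item c0 ` {k. free c0 k \<and> w (c k) > 0}"
  have cV: "c \<in> V" and cc: "\<And>k. c k = c0 k \<or> c k = fl (c0 k)"
    using c unfolding flip_class_def by auto
  have abs: "\<bar>w (c k)\<bar> = \<bar>w (c0 k)\<bar>" for k using cc[of k] w_fl by auto
  have inP: "item c0 k \<in> P \<longleftrightarrow> w (c k) > 0" if k: "free c0 k" for k
  proof
    assume "item c0 k \<in> P"
    then obtain l where l: "free c0 l" "w (c l) > 0" "item c0 k = item c0 l"
      unfolding P_def by auto
    show "w (c k) > 0"
    proof (cases "k = l")
      case False
      then have t: "tied c0 k" "k div 2 = l div 2" using item_eqD l(3) by auto
      have t2: "\<bar>w (c0 (2 * (k div 2)))\<bar> = 1"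
        using t tied_partner[of k "2 * (k div 2)"] unfolding tied_def by auto
      have "w (c (2 * (k div 2))) = w (c (2 * (k div 2) + 1))"
        using tied_inv[OF c0 cV cc t2] k t unfolding free_def by auto
      then have "w (c k) = w (c l)" using t(2) False
        by (cases "even k"; cases "even l") (auto elim!: evenE oddE)
      then show ?thesis using l by simp
    qed (use l in simp)
  qed (use k in \<open>auto simp: P_def\<close>)
  have "c k = conf c0 P k" for k
  proof (cases "free c0 k")
    case True
    then have "w (c0 k) \<noteq> 0" unfolding free_def by auto
    then show ?thesis
      using True inP[OF True] cc[of k] w_fl[of "c0 k"] unfolding conf_def pos_def neg_def by auto
  next
    case False
    show ?thesis
    proof (cases "w (c0 k) = 0")
      case True
      then show ?thesis using cc[of k] fl_id False unfolding conf_def by auto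
    next
      case ne: False
      note lv = locked_values[OF False ne]
      have d: "2 * (k div 2) div 2 = k div 2" by simp
      have t2: "\<bar>w (c0 (2 * (k div 2)))\<bar> = 1"
        using lv tied_partner[OF d] unfolding tied_def by auto
      have "w (c (2 * (k div 2))) \<noteq> w (c (2 * (k div 2) + 1))"
        using tied_inv[OF c0 cV cc t2] False ne unfolding free_def by auto
      then have "w (c (2 * (k div 2))) = -1" "w (c (2 * (k div 2) + 1)) = 1"
        using tied_cases[OF cV, of "k div 2"] t2 abs by auto
      then have "w (c k) = (if even k then -1 else 1)"
        by (cases "even k") (auto elim!: evenE oddE)
      then have "c k = c0 k" using cc[of k] lv(2) w_fl[of "c0 k"] by (auto split: if_splits)
      then show ?thesis using False unfolding conf_def by simp
    qed
  qed
  then have cP: "c = conf c0 P" by auto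
  have "P \<subseteq> items c0" unfolding P_def items_def by auto
  moreover have "x \<in> P" if "(x, y) \<in> links c0" "y \<in> P" for x y
  proof -
    obtain k where k: "x = item c0 k" "y = item c0 (Suc k)" "free c0 k" "free c0 (Suc k)"
      "\<not> ok k (neg (c0 k)) (pos (c0 (Suc k)))"
      using \<open>(x, y) \<in> links c0\<close> unfolding links_def by auto
    show ?thesis
    proof (rule ccontr)
      assume "x \<notin> P"
      then have "conf c0 P k = neg (c0 k)" "conf c0 P (Suc k) = pos (c0 (Suc k))"
        using k \<open>y \<in> P\<close> unfolding conf_def by auto
      then show False using ok[OF cV, of k] k(5) cP by simp
    qed
  qed
  ultimately have "P \<in> closed_subsets (items c0) (links c0)"
    unfolding closed_subsets_def by auto
  then show ?thesis using cP by auto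
qed

lemma bij_conf:
  "bij_betw (conf c0) (closed_subsets (items c0) (links c0)) (flip_class c0)"
  unfolding bij_betw_def
proof (intro conjI equalityI subsetI)
  show "inj_on (conf c0) (closed_subsets (items c0) (links c0))"
  proof (rule inj_onI)
    fix P P' assume "P \<in> closed_subsets (items c0) (links c0)"
      "P' \<in> closed_subsets (items c0) (links c0)" and eq: "conf c0 P = conf c0 P'"
    then have "P \<subseteq> items c0" "P' \<subseteq> items c0" unfolding closed_subsets_def by auto
    from this[THEN items_from_conf] show "P = P'" using eq by simp
  qed
  fix c assume "c \<in> conf c0 ` closed_subsets (items c0) (links c0)"
  then show "c \<in> flip_class c0" unfolding flip_class_def using conf_in_V conf_class by auto
next
  fix c assume "c \<in> flip_class c0"
  then show "c \<in> conf c0 ` closed_subsets (items c0) (links c0)" using conf_surj by auto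
qed

lemma items_bound: "items c0 \<subseteq> {..<2 * W}"
proof
  fix q assume "q \<in> items c0"
  then obtain k where "q = item c0 k" "free c0 k" unfolding items_def by auto
  then have "q \<le> k" "k < 2 * W" using finite_free unfolding item_def by auto
  then show "q \<in> {..<2 * W}" by simp
qed

text \<open>
  Every item contributes \<open>2\<close> or \<open>-2\<close> to the total: a free tied pair consists of two states of
  value \<open>1\<close> or \<open>-1\<close>, all other items are single states of value \<open>2\<close> or \<open>-2\<close>, and the values of a
  tied pair that is not free cancel.
\<close>

lemma total_pair:
  assumes P: "P \<subseteq> items c0"
  shows "w (conf c0 P (2 * j)) + w (conf c0 P (2 * j + 1))
    = 4 * (of_bool (2 * j \<in> P) + of_bool (2 * j + 1 \<in> P))
      - 2 * (of_bool (2 * j \<in> items c0) + of_bool (2 * j + 1 \<in> items c0))"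
proof (cases "tied c0 (2 * j)")
  case t: True
  then have t': "tied c0 (2 * j + 1)" using tied_partner[of "2 * j" "2 * j + 1"] by simp
  have no: "2 * j + 1 \<notin> items c0"
  proof
    assume "2 * j + 1 \<in> items c0"
    then obtain k where "2 * j + 1 = item c0 k" unfolding items_def by auto
    then show False using t' unfolding item_def by (auto split: if_splits) presburger
  qed
  show ?thesis
  proof (cases "w (c0 (2 * j)) = w (c0 (2 * j + 1))")
    case True
    then have f: "free c0 (2 * j)" "free c0 (2 * j + 1)"
      using t t' unfolding free_def tied_def by auto
    have i: "item c0 (2 * j) = 2 * j" "item c0 (2 * j + 1) = 2 * j"
      using t t' unfolding item_def by auto
    then have "2 * j \<in> items c0" using f(1) unfolding items_def by (metis image_eqI mem_Collect_eq)
    then show ?thesis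
      using no P t t' i w_conf_free(1)[OF f(1)] w_conf_free(1)[OF f(2)]
      unfolding tied_def by auto
  next
    case False
    then have f: "\<not> free c0 (2 * j)" "\<not> free c0 (2 * j + 1)"
      using t t' unfolding free_def by auto
    have "2 * j \<notin> items c0"
    proof
      assume "2 * j \<in> items c0"
      then obtain k where k: "2 * j = item c0 k" "free c0 k" unfolding items_def by auto
      then have "k div 2 = j" unfolding item_def by (auto split: if_splits)
      then have "k = 2 * j \<or> k = 2 * j + 1" by presburger
      then show False using f k by auto
    qed
    moreover have "w (c0 (2 * j)) = -1 \<and> w (c0 (2 * j + 1)) = 1"
      using tied_cases[OF c0, of j] False t unfolding tied_def by auto
    ultimately show ?thesis using no P f unfolding conf_def by auto
  qed
next
  case nt: False
  have *: "w (conf c0 P k) = 4 * of_bool (k \<in> P) - 2 * of_bool (k \<in> items c0)"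
    if k: "k div 2 = j" for k
  proof -
    have ntk: "\<not> tied c0 k" using nt tied_partner[of k "2 * j"] k by auto
    have ik: "item c0 k = k" using ntk unfolding item_def by auto
    have "k \<in> items c0 \<longleftrightarrow> free c0 k"
    proof
      assume "k \<in> items c0"
      then obtain l where l: "k = item c0 l" "free c0 l" unfolding items_def by auto
      then have "l = k" using item_eqD[of l k] ik ntk tied_partner[of l k] by auto
      then show "free c0 k" using l by simp
    qed (use ik in \<open>auto simp: items_def image_def\<close>)
    moreover have "free c0 k \<longleftrightarrow> w (c0 k) \<noteq> 0" using ntk unfolding free_def by auto
    moreover have "\<bar>w (c0 k)\<bar> = 2" if "w (c0 k) \<noteq> 0"
      using that ntk w_range[OF c0, of k] unfolding tied_def by linarith
    ultimately show ?thesis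
      using ik P unfolding conf_def by (auto split: if_splits)
  qed
  show ?thesis using *[of "2 * j"] *[of "2 * j + 1"] by simp
qed

lemma total_conf:
  assumes P: "P \<subseteq> items c0"
  shows "total (conf c0 P) = 4 * int (card P) - 2 * int (card (items c0))"
proof -
  have card: "int (card A) = (\<Sum>j<W. of_bool (2 * j \<in> A) + of_bool (2 * j + 1 \<in> A))"
    if "A \<subseteq> {..<2 * W}" for A :: "nat set"
  proof -
    have "int (card A) = (\<Sum>k\<in>{..<2 * W} \<inter> A. 1)" using that by (simp add: Int_absorb1)
    also have "\<dots> = (\<Sum>k<2 * W. of_bool (k \<in> A))"
      by (simp add: of_bool_def sum.If_cases)
    finally show ?thesis by (simp add: sum_lessThan_double)
  qed
  have "P \<subseteq> {..<2 * W}" using P items_bound by auto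
  then show ?thesis
    unfolding total_def total_pair[OF P] sum_subtractf sum_distrib_left[symmetric]
      card[OF items_bound] card[OF \<open>P \<subseteq> {..<2 * W}\<close>] by simp
qed

theorem sum_flip_class:
  fixes G :: "int \<Rightarrow> complex"
  shows "(\<Sum>c\<in>flip_class c0. G (total c)) = (\<Sum>c\<in>flip_class c0. G (- total c))"
proof -
  let ?S = "closed_subsets (items c0) (links c0)" and ?q = "card (items c0)"
  have sub: "links c0 \<subseteq> items c0 \<times> items c0" unfolding links_def items_def by auto
  have PQ: "P \<subseteq> items c0" "card P \<le> ?q" if "P \<in> ?S" for P
    using that finite_items unfolding closed_subsets_def by (auto intro: card_mono)
  have "(\<Sum>c\<in>flip_class c0. G (total c)) = (\<Sum>P\<in>?S. G (total (conf c0 P)))"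
    using sum.reindex_bij_betw[OF bij_conf, of "\<lambda>c. G (total c)"] by simp
  also have "\<dots> = (\<Sum>P\<in>?S. G (4 * int (card P) - 2 * int ?q))"
    using PQ total_conf by (intro sum.cong) auto
  also have "\<dots> = (\<Sum>P\<in>?S. G (4 * int (?q - card P) - 2 * int ?q))"
    by (rule sum_closed_subsets_flip[OF finite_items finite_links sub
          links_single_valued links_converse_single_valued,
          of "\<lambda>p. G (4 * int p - 2 * int ?q)"])
  also have "\<dots> = (\<Sum>P\<in>?S. G (- total (conf c0 P)))"
  proof (intro sum.cong refl)
    fix P assume "P \<in> ?S"
    then show "G (4 * int (?q - card P) - 2 * int ?q) = G (- total (conf c0 P))"
      using PQ[of P] total_conf[of P] by (simp add: of_nat_diff)
  qed
  also have "\<dots> = (\<Sum>c\<in>flip_class c0. G (- total c))"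
    using sum.reindex_bij_betw[OF bij_conf, of "\<lambda>c. G (- total c)"] by simp
  finally show ?thesis .
qed

end

end

context flip_system
begin

lemma sum_via_classes:
  fixes h h' :: "(nat \<Rightarrow> 'e) \<Rightarrow> complex"
  assumes "\<And>c0. c0 \<in> V \<Longrightarrow> (\<Sum>c\<in>flip_class c0. h c) = (\<Sum>c\<in>flip_class c0. h' c)"
  shows "(\<Sum>c\<in>V. h c) = (\<Sum>c\<in>V. h' c)"
proof -
  have V: "V = \<Union> (flip_class ` V)" unfolding flip_class_def by auto
  have fin: "\<forall>A\<in>flip_class ` V. finite A" using finV unfolding flip_class_def by auto
  have eqc: "flip_class a = flip_class b" if "a \<in> V" "b \<in> V" "x \<in> flip_class a" "x \<in> flip_class b" for a b x
  proof -
    have "\<And>a b. a \<in> V \<Longrightarrow> b \<in> V \<Longrightarrow> x \<in> flip_class a \<Longrightarrow> x \<in> flip_class b \<Longrightarrow> flip_class a \<subseteq> flip_class b"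
      using flip_class_sym flip_class_trans by blast
    then show ?thesis using that by blast
  qed
  have disj: "\<forall>A\<in>flip_class ` V. \<forall>B\<in>flip_class ` V. A \<noteq> B \<longrightarrow> A \<inter> B = {}"
    using eqc by blast
  have *: "(\<Sum>c\<in>V. g c) = (\<Sum>A\<in>flip_class ` V. \<Sum>c\<in>A. g c)" for g :: "(nat \<Rightarrow> 'e) \<Rightarrow> complex"
    using sum.Union_disjoint[OF fin disj, of g] V by simp
  show ?thesis unfolding * by (rule sum.cong[OF refl]) (use assms in auto)
qed

end

section \<open>Sign tableaux\<close>

text \<open>
  A column that contains no letter together with its barred version is encoded by a sign vector
  \<open>e\<close>: \<open>e x\<close> is \<open>1\<close>, \<open>-1\<close> or \<open>0\<close> if the column contains the unbarred letter \<open>x\<close>, the barred letter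
  \<open>x\<close>, or neither. The functions \<open>npos\<close> and \<open>nneg\<close> count the unbarred and the barred letters with
  index at most \<open>x\<close>.
\<close>

definition npos :: "(nat \<Rightarrow> int) \<Rightarrow> nat \<Rightarrow> int" where
  "npos e x = (\<Sum>y=1..x. of_bool (e y = 1))"

definition nneg :: "(nat \<Rightarrow> int) \<Rightarrow> nat \<Rightarrow> int" where
  "nneg e x = (\<Sum>y=1..x. of_bool (e y = -1))"

lemma npos_0 [simp]: "npos e 0 = 0" and nneg_0 [simp]: "nneg e 0 = 0"
  unfolding npos_def nneg_def by auto

lemma npos_Suc: "npos e (Suc x) = npos e x + of_bool (e (Suc x) = 1)"
  and nneg_Suc: "nneg e (Suc x) = nneg e x + of_bool (e (Suc x) = -1)"
  unfolding npos_def nneg_def by auto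

text \<open>
  The pairs \<open>(e, f)\<close> of sign vectors of \<open>(\<ell>C, rC)\<close> for an admissible column \<open>C\<close>. In passing from
  \<open>e\<close> to \<open>f\<close>, the signs at the letters \<open>t\<close> turn from \<open>1\<close> into \<open>-1\<close> and those at the letters \<open>z\<close>
  from \<open>-1\<close> into \<open>1\<close>, whence \<open>npos e x - npos f x\<close> is the number of the \<open>t\<close> minus the number of
  the \<open>z\<close> that are at most \<open>x\<close>. Its nonnegativity and its vanishing at \<open>m\<close> say that the sorted
  letters satisfy \<open>t\<^sub>i < z\<^sub>i\<close>; its vanishing at the unused letters is the greedy choice of the
  \<open>t\<^sub>i\<close>.
\<close>

definition split_pair :: "nat \<Rightarrow> (nat \<Rightarrow> int) \<Rightarrow> (nat \<Rightarrow> int) \<Rightarrow> bool" where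
  "split_pair m e f \<longleftrightarrow>
     (\<forall>x\<in>{1..m}. e x = 0 \<longleftrightarrow> f x = 0) \<and>
     (\<forall>x\<le>m. npos f x \<le> npos e x) \<and>
     npos e m = npos f m \<and>
     (\<forall>x\<in>{1..m}. e x = 0 \<longrightarrow> npos e x = npos f x)"

definition is_sign_vector :: "nat \<Rightarrow> (nat \<Rightarrow> int) \<Rightarrow> bool" where
  "is_sign_vector m e \<longleftrightarrow> (\<forall>x. e x \<in> {-1, 0, 1}) \<and> (\<forall>x. x \<notin> {1..m} \<longrightarrow> e x = 0)"

text \<open>
  Positions \<open>2 * j\<close> and \<open>2 * j + 1\<close> carry the left and right half of column \<open>j\<close>, which occupies
  the rows from \<open>lo j\<close> to \<open>hi j - 1\<close>. For a letter \<open>a\<close>, the number of rows above the first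
  position that is not filled with an entry \<open>\<le> a\<close> is \<open>lo + npos e x\<close> if \<open>a\<close> is the unbarred \<open>x\<close>,
  and \<open>hi - nneg e x\<close> if \<open>a\<close> is the barred \<open>x + 1\<close>. The rows increase weakly if and only if these
  numbers decrease weakly from each position to the next.
\<close>

definition sign_tableaux ::
    "nat \<Rightarrow> (nat \<Rightarrow> int) \<Rightarrow> (nat \<Rightarrow> int) \<Rightarrow> (nat \<Rightarrow> nat \<Rightarrow> int) set" where
  "sign_tableaux m lo hi = {c.
     (\<forall>k. is_sign_vector m (c k)) \<and>
     (\<forall>k. npos (c k) m + nneg (c k) m = hi (k div 2) - lo (k div 2)) \<and>
     (\<forall>k. \<forall>x\<le>m. lo (Suc k div 2) + npos (c (Suc k)) x \<le> lo (k div 2) + npos (c k) x) \<and>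
     (\<forall>k. \<forall>x\<le>m. hi (Suc k div 2) - nneg (c (Suc k)) x \<le> hi (k div 2) - nneg (c k) x) \<and>
     (\<forall>j. split_pair m (c (2 * j)) (c (2 * j + 1)))}"

lemma sign_tableauxD:
  assumes "c \<in> sign_tableaux m lo hi"
  shows "c k x \<in> {-1, 0, 1}" "x \<notin> {1..m} \<Longrightarrow> c k x = 0"
    and "npos (c k) m + nneg (c k) m = hi (k div 2) - lo (k div 2)"
    and "x \<le> m \<Longrightarrow> lo (Suc k div 2) + npos (c (Suc k)) x \<le> lo (k div 2) + npos (c k) x"
    and "x \<le> m \<Longrightarrow> hi (Suc k div 2) - nneg (c (Suc k)) x \<le> hi (k div 2) - nneg (c k) x"
    and "split_pair m (c (2 * j)) (c (2 * j + 1))"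
  using assms unfolding sign_tableaux_def is_sign_vector_def by blast+

lemma sign_tableaux_zero:
  assumes c: "c \<in> sign_tableaux m lo hi" and h: "hi (k div 2) = lo (k div 2)"
  shows "c k x = 0"
proof (cases "x \<in> {1..m}")
  case True
  have zero: "(\<forall>y\<in>{1..m}. of_bool (Q y) = (0::int))" if "(\<Sum>y=1..m. of_bool (Q y)) = (0::int)" for Q
    using that sum_nonneg_eq_0_iff[of "{1..m}" "\<lambda>y. of_bool (Q y) :: int"] by simp
  have p: "npos (c k) m \<ge> 0" "nneg (c k) m \<ge> 0"
    unfolding npos_def nneg_def by (auto intro: sum_nonneg)
  then have "npos (c k) m = 0" and "nneg (c k) m = 0"
    using sign_tableauxD(3)[OF c, of k] h by auto
  then have "\<forall>y\<in>{1..m}. of_bool (c k y = 1) = (0::int)"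
      "\<forall>y\<in>{1..m}. of_bool (c k y = -1) = (0::int)"
    using zero[of "\<lambda>y. c k y = 1"] zero[of "\<lambda>y. c k y = -1"]
    unfolding npos_def nneg_def by simp_all
  then have "c k x \<noteq> 1" "c k x \<noteq> -1" using True by auto
  then show ?thesis using sign_tableauxD(1)[OF c, of k x] by auto
qed (use sign_tableauxD(2)[OF c] in auto)

text \<open>
  The entries of column \<open>j\<close> are the unbarred letters of its right half and the barred letters of
  its left half.
\<close>

definition sign_weight :: "nat \<Rightarrow> (nat \<Rightarrow> nat \<Rightarrow> int) \<Rightarrow> nat \<Rightarrow> int" where
  "sign_weight W c x = (\<Sum>j<W. of_bool (c (2 * j + 1) x = 1) - of_bool (c (2 * j) x = -1))"

lemma two_sign_weight:
  assumes c: "c \<in> sign_tableaux m lo hi"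
  shows "2 * sign_weight W c x = (\<Sum>j<W. c (2 * j) x + c (2 * j + 1) x)"
  unfolding sign_weight_def sum_distrib_left
proof (intro sum.cong refl)
  fix j
  have "c (2 * j) x = 0 \<longleftrightarrow> c (2 * j + 1) x = 0"
    using sign_tableauxD(2)[OF c, of x] sign_tableauxD(6)[OF c, of j]
    unfolding split_pair_def by (cases "x \<in> {1..m}") auto
  then show "2 * (of_bool (c (2 * j + 1) x = 1) - of_bool (c (2 * j) x = -1))
      = c (2 * j) x + c (2 * j + 1) x"
    using sign_tableauxD(1)[OF c, of "2 * j" x] sign_tableauxD(1)[OF c, of "2 * j + 1" x] by auto
qed

section \<open>Exchanging two neighbouring letters\<close>

text \<open>
  The reflection that exchanges \<open>i\<close> with \<open>i + 1\<close> and, simultaneously, their barred versions. It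
  changes \<open>npos\<close> and \<open>nneg\<close> at \<open>i\<close> only.
\<close>

definition swap_signs :: "nat \<Rightarrow> (nat \<Rightarrow> int) \<Rightarrow> nat \<Rightarrow> int" where
  "swap_signs i e = e(i := e (Suc i), Suc i := e i)"

lemma npos_swap: "npos (swap_signs i e) x = 
    npos e x + (if x = i \<and> i > 0 then of_bool (e (Suc i) = 1) - of_bool (e i = 1) else 0)"
  if "i > 0"
  using that by (induction x) (auto simp: npos_Suc swap_signs_def)

lemma nneg_swap: "nneg (swap_signs i e) x = 
    nneg e x + (if x = i \<and> i > 0 then of_bool (e (Suc i) = -1) - of_bool (e i = -1) else 0)"
  if "i > 0"
  using that by (induction x) (auto simp: nneg_Suc swap_signs_def)

text \<open>
  The inequalities at \<open>a + 1\<close> between two neighbouring positions follow from those at \<open>a\<close> and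
  \<open>a + 2\<close>, unless a negative state is followed by a positive one.
\<close>

lemma ineq_at_swap:
  fixes e e' :: "nat \<Rightarrow> int"
  assumes v: "\<And>x. e x \<in> {-1, 0, 1}" "\<And>x. e' x \<in> {-1, 0, 1}"
    and u: "l' + npos e' a \<le> l + npos e a" "l' + npos e' (Suc (Suc a)) \<le> l + npos e (Suc (Suc a))"
    and n: "h' - nneg e' a \<le> h - nneg e a" "h' - nneg e' (Suc (Suc a)) \<le> h - nneg e (Suc (Suc a))"
    and w: "e (Suc a) - e (Suc (Suc a)) \<ge> 0 \<or> e' (Suc a) - e' (Suc (Suc a)) \<le> 0"
  shows "l' + npos e' (Suc a) \<le> l + npos e (Suc a)" "h' - nneg e' (Suc a) \<le> h - nneg e (Suc a)"
proof -
  have le: "npos d x \<le> npos d (Suc x)" "npos d (Suc x) \<le> npos d x + 1"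
    "nneg d x \<le> nneg d (Suc x)" "nneg d (Suc x) \<le> nneg d x + 1" for d x
    unfolding npos_Suc nneg_Suc by auto
  have "(npos e (Suc a) = npos e a + 1 \<or> npos e (Suc a) = npos e (Suc (Suc a))) \<and>
      (nneg e (Suc a) = nneg e a \<or> nneg e (Suc a) = nneg e (Suc (Suc a)) - 1)"
    if "e (Suc a) - e (Suc (Suc a)) \<ge> 0"
    using that v(1)[of "Suc a"] v(1)[of "Suc (Suc a)"] unfolding npos_Suc nneg_Suc by auto
  moreover have "(npos e' (Suc a) = npos e' a \<or> npos e' (Suc a) = npos e' (Suc (Suc a)) - 1) \<and>
      (nneg e' (Suc a) = nneg e' a + 1 \<or> nneg e' (Suc a) = nneg e' (Suc (Suc a)))"
    if "e' (Suc a) - e' (Suc (Suc a)) \<le> 0"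
    using that v(2)[of "Suc a"] v(2)[of "Suc (Suc a)"] unfolding npos_Suc nneg_Suc by auto
  ultimately show "l' + npos e' (Suc a) \<le> l + npos e (Suc a)"
    "h' - nneg e' (Suc a) \<le> h - nneg e (Suc a)"
    using w u n le[of e a] le[of e' a] le[of e "Suc a"] le[of e' "Suc a"] by linarith+
qed

text \<open>
  A difference \<open>1\<close> or \<open>-1\<close> means that the pair uses exactly one of the letters \<open>a + 1\<close> and
  \<open>a + 2\<close>. The differences of the two halves are then equal, or they are \<open>-1\<close> and \<open>1\<close>; the counts
  at \<open>a\<close> and \<open>a + 2\<close>, which the reflection does not change, decide which case occurs.
\<close>

lemma swap_pair:
  assumes p: "split_pair m e f" and m: "Suc (Suc a) \<le> m"
    and v: "\<And>x. e x \<in> {-1, 0, 1}" "\<And>x. f x \<in> {-1, 0, 1}"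
  defines "d \<equiv> e (Suc a) - e (Suc (Suc a))" and "d' \<equiv> f (Suc a) - f (Suc (Suc a))"
  shows "\<bar>d\<bar> = 1 \<longleftrightarrow> \<bar>d'\<bar> = 1"
    and "\<bar>d\<bar> = 1 \<Longrightarrow> d = d' \<or> d = -1 \<and> d' = 1"
    and "\<bar>d\<bar> = 1 \<Longrightarrow> d = d' \<longleftrightarrow>
      npos e a - npos f a = npos e (Suc (Suc a)) - npos f (Suc (Suc a))"
    and "\<bar>d\<bar> = 1 \<Longrightarrow> d = d' \<Longrightarrow> npos e a = npos f a \<and> 
      npos e (Suc (Suc a)) = npos f (Suc (Suc a))"
proof -
  have *: "e (Suc a) = 0 \<longleftrightarrow> f (Suc a) = 0" "e (Suc (Suc a)) = 0 \<longleftrightarrow> f (Suc (Suc a)) = 0"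
    "npos f a \<le> npos e a" "npos f (Suc a) \<le> npos e (Suc a)" 
    "npos f (Suc (Suc a)) \<le> npos e (Suc (Suc a))"
    "e (Suc a) = 0 \<Longrightarrow> npos e (Suc a) = npos f (Suc a)"
    "e (Suc (Suc a)) = 0 \<Longrightarrow> npos e (Suc (Suc a)) = npos f (Suc (Suc a))"
    using p m unfolding split_pair_def by auto
  have one: "\<bar>x - y\<bar> = 1 \<longleftrightarrow> (x = 0) \<noteq> (y = 0)" if "x \<in> {-1, 0, 1}" "y \<in> {-1, 0, 1}" for x y :: int
    using that by auto
  have de: "\<bar>d\<bar> = 1 \<longleftrightarrow> (e (Suc a) = 0) \<noteq> (e (Suc (Suc a)) = 0)"
    and df: "\<bar>d'\<bar> = 1 \<longleftrightarrow> (f (Suc a) = 0) \<noteq> (f (Suc (Suc a)) = 0)"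
    unfolding d_def d'_def using one v by blast+
  show "\<bar>d\<bar> = 1 \<longleftrightarrow> \<bar>d'\<bar> = 1"
    unfolding de df using *(1,2) by simp
  assume "\<bar>d\<bar> = 1"
  then consider
      "e (Suc a) = 0" "f (Suc a) = 0" "e (Suc (Suc a)) \<in> {-1, 1}" "f (Suc (Suc a)) \<in> {-1, 1}"
    | "e (Suc (Suc a)) = 0" "f (Suc (Suc a)) = 0" "e (Suc a) \<in> {-1, 1}" "f (Suc a) \<in> {-1, 1}"
    using de *(1,2) v(1)[of "Suc a"] v(2)[of "Suc a"] v(1)[of "Suc (Suc a)"] v(2)[of "Suc (Suc a)"]
    by blast
  then have "(d = d' \<or> d = -1 \<and> d' = 1) \<and>
      (d = d' \<longleftrightarrow> npos e a - npos f a = npos e (Suc (Suc a)) - npos f (Suc (Suc a))) \<and>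
      (d = d' \<longrightarrow> npos e a = npos f a \<and> npos e (Suc (Suc a)) = npos f (Suc (Suc a)))"
  proof cases
    case 1
    then show ?thesis using *(3-6) unfolding d_def d'_def npos_Suc by auto
  next
    case 2
    then show ?thesis using *(3-5,7) unfolding d_def d'_def npos_Suc by auto
  qed
  then show "d = d' \<or> d = -1 \<and> d' = 1"
    and "d = d' \<longleftrightarrow> npos e a - npos f a = npos e (Suc (Suc a)) - npos f (Suc (Suc a))"
    and "d = d' \<Longrightarrow> npos e a = npos f a \<and> npos e (Suc (Suc a)) = npos f (Suc (Suc a))"
    by blast+
qed

lemma split_pair_swap:
  assumes p: "split_pair m e f" and m: "Suc (Suc a) \<le> m"
    and v: "\<And>x. e x \<in> {-1, 0, 1}" "\<And>x. f x \<in> {-1, 0, 1}"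
    and e': "e' = e \<or> e' = swap_signs (Suc a) e" and f': "f' = f \<or> f' = swap_signs (Suc a) f"
    and le: "\<And>x. x \<le> m \<Longrightarrow> npos f' x \<le> npos e' x"
    and tied: "\<bar>e (Suc a) - e (Suc (Suc a))\<bar> = 1 \<Longrightarrow>
      if e (Suc a) - e (Suc (Suc a)) = f (Suc a) - f (Suc (Suc a))
      then e' (Suc a) - e' (Suc (Suc a)) = f' (Suc a) - f' (Suc (Suc a))
      else e' = e \<and> f' = f"
  shows "split_pair m e' f'"
proof -
  note sp = swap_pair[OF p m v]
  have S: "e (Suc a) = 0 \<longleftrightarrow> f (Suc a) = 0" "e (Suc (Suc a)) = 0 \<longleftrightarrow> f (Suc (Suc a)) = 0"
    using p m unfolding split_pair_def by auto
  note vv = v(1)[of "Suc a"] v(1)[of "Suc (Suc a)"] v(2)[of "Suc a"] v(2)[of "Suc (Suc a)"]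
  have np: "npos e' x = npos e x" "npos f' x = npos f x" if "x \<noteq> Suc a" for x
    using e' f' that by (auto simp: npos_swap)
  have out: "e' x = e x" "f' x = f x" if "x \<noteq> Suc a" "x \<noteq> Suc (Suc a)" for x
    using e' f' that by (auto simp: swap_signs_def)
  show ?thesis
  proof (cases "\<bar>e (Suc a) - e (Suc (Suc a))\<bar> = 1")
    case t: True
    show ?thesis
    proof (cases "e (Suc a) - e (Suc (Suc a)) = f (Suc a) - f (Suc (Suc a))")
      case False
      then show ?thesis using tied t p by auto
    next
      case True
      note eqs = sp(4)[OF t True]
      have ef: "e (Suc a) = f (Suc a)" "e (Suc (Suc a)) = f (Suc (Suc a))"
        using t True S vv by auto
      have w': "e' (Suc a) - e' (Suc (Suc a)) = f' (Suc a) - f' (Suc (Suc a))"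
        using tied t True by auto
      have ef': "e' (Suc a) = f' (Suc a)" "e' (Suc (Suc a)) = f' (Suc (Suc a))"
        using t w' ef e' f' by (auto simp: swap_signs_def)
      have "npos e' (Suc a) = npos f' (Suc a)"
        using eqs ef' np[of a] unfolding npos_Suc by simp
      then have eqx: "npos e' x = npos f' x" if "e' x = 0" "x \<in> {1..m}" for x
        using that np[of x] out[of x] p eqs unfolding split_pair_def
        by (cases "x = Suc a"; cases "x = Suc (Suc a)") auto
      have supp: "e' x = 0 \<longleftrightarrow> f' x = 0" if "x \<in> {1..m}" for x
        using that ef' out[of x] p unfolding split_pair_def
        by (cases "x = Suc a"; cases "x = Suc (Suc a)") auto
      show ?thesis
        unfolding split_pair_def using supp eqx le np[of m] p m unfolding split_pair_def by auto
    qed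
  next
    case nt: False
    then have full: "(e (Suc a) = 0 \<longleftrightarrow> e (Suc (Suc a)) = 0)" using vv by auto
    have supp: "e' x = 0 \<longleftrightarrow> e x = 0" "f' x = 0 \<longleftrightarrow> f x = 0" for x
      using full S e' f' unfolding swap_signs_def by (auto simp: fun_upd_apply split: if_splits)
    have eqx: "npos e' x = npos f' x" if "e' x = 0" "x \<in> {1..m}" for x
    proof (cases "x = Suc a")
      case True
      then have "e (Suc a) = 0" "e (Suc (Suc a)) = 0" using that supp full by auto
      then have "e' = e" "f' = f" using S e' f' unfolding swap_signs_def by (auto simp: fun_eq_iff)
      then show ?thesis using that p unfolding split_pair_def by auto
    next
      case False
      then show ?thesis using that np[of x] supp[of x] p unfolding split_pair_def by auto
    qed
    show ?thesis
      unfolding split_pair_def using supp eqx le np[of m] p m unfolding split_pair_def by auto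
  qed
qed

text \<open>
  The inequalities at \<open>i\<close> between the states \<open>e\<close> and \<open>e'\<close> at the positions \<open>k\<close> and \<open>k + 1\<close>.
\<close>

definition col_ok :: "nat \<Rightarrow> (nat \<Rightarrow> int) \<Rightarrow> (nat \<Rightarrow> int) \<Rightarrow> nat \<Rightarrow> (nat \<Rightarrow> int) \<Rightarrow> (nat \<Rightarrow> int) \<Rightarrow> bool" where
  "col_ok i lo hi k e e' \<longleftrightarrow>
     lo (Suc k div 2) + npos e' i \<le> lo (k div 2) + npos e i \<and>
     hi (Suc k div 2) - nneg e' i \<le> hi (k div 2) - nneg e i"

lemma swap_valid:
  assumes i: "Suc (Suc a) \<le> m" and c: "c \<in> sign_tableaux m lo hi"
    and c': "\<And>k. c' k = c k \<or> c' k = swap_signs (Suc a) (c k)"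
    and tied: "\<And>j. \<bar>c (2 * j) (Suc a) - c (2 * j) (Suc (Suc a))\<bar> = 1 \<Longrightarrow>
      if c (2 * j) (Suc a) - c (2 * j) (Suc (Suc a)) = c (2 * j + 1) (Suc a) - c (2 * j + 1) (Suc (Suc a))
      then c' (2 * j) (Suc a) - c' (2 * j) (Suc (Suc a)) = c' (2 * j + 1) (Suc a) - c' (2 * j + 1) (Suc (Suc a))
      else c' (2 * j) = c (2 * j) \<and> c' (2 * j + 1) = c (2 * j + 1)"
    and ok: "\<And>k. c' k (Suc a) - c' k (Suc (Suc a)) < 0 \<Longrightarrow>
      c' (Suc k) (Suc a) - c' (Suc k) (Suc (Suc a)) > 0 \<Longrightarrow> col_ok (Suc a) lo hi k (c' k) (c' (Suc k))"
  shows "c' \<in> sign_tableaux m lo hi"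
proof -
  note D = sign_tableauxD[OF c]
  have v: "c' k x \<in> {-1, 0, 1}" for k x
    using c'[of k] D(1)[of k] unfolding swap_signs_def by (metis fun_upd_apply)
  have z: "c' k x = 0" if "x \<notin> {1..m}" for k x
    using c'[of k] D(2)[of _ k] i that by (auto simp: swap_signs_def)
  have np: "npos (c' k) x = npos (c k) x" "nneg (c' k) x = nneg (c k) x" if "x \<noteq> Suc a" for k x
    using c'[of k] that by (auto simp: npos_swap nneg_swap)
  have ineq: "lo (Suc k div 2) + npos (c' (Suc k)) x \<le> lo (k div 2) + npos (c' k) x \<and>
    hi (Suc k div 2) - nneg (c' (Suc k)) x \<le> hi (k div 2) - nneg (c' k) x" if x: "x \<le> m" for k x
  proof (cases "x = Suc a")
    case False
    then show ?thesis using D(4,5)[OF x, of k] np by simp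
  next
    case True
    show ?thesis
    proof (cases "c' k (Suc a) - c' k (Suc (Suc a)) < 0 \<and> c' (Suc k) (Suc a) - c' (Suc k) (Suc (Suc a)) > 0")
      case True
      then show ?thesis using ok[of k] \<open>x = Suc a\<close> unfolding col_ok_def by simp
    next
      case False
      show ?thesis unfolding \<open>x = Suc a\<close>
        using ineq_at_swap[of "c' k" "c' (Suc k)" "lo (Suc k div 2)" a "lo (k div 2)"
            "hi (Suc k div 2)" "hi (k div 2)", OF v v] np[of a] np[of "Suc (Suc a)"]
          D(4,5)[of a k] D(4,5)[of "Suc (Suc a)" k] i False by auto
    qed
  qed
  have "split_pair m (c' (2 * j)) (c' (2 * j + 1))" for j
  proof (rule split_pair_swap[OF D(6) i D(1) D(1) c' c' _ tied])
    fix x assume "x \<le> m"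
    from ineq[OF this, of "2 * j"] show "npos (c' (2 * j + 1)) x \<le> npos (c' (2 * j)) x" by simp
  qed
  then show ?thesis
    unfolding sign_tableaux_def is_sign_vector_def using v z ineq D(3) np[of m] i by auto
qed

lemma swap_flip_system:
  assumes i: "Suc (Suc a) \<le> m" and fin: "finite (sign_tableaux m lo hi)"
    and W: "\<And>j. W \<le> j \<Longrightarrow> hi j = lo j"
  shows "flip_system W (sign_tableaux m lo hi) (\<lambda>e. e (Suc a) - e (Suc (Suc a)))
    (swap_signs (Suc a)) (col_ok (Suc a) lo hi)"
proof
  fix c assume c: "c \<in> sign_tableaux m lo hi"
  note D = sign_tableauxD[OF c]
  note sp = swap_pair[OF D(6) i D(1) D(1)]
  show "\<bar>c k (Suc a) - c k (Suc (Suc a))\<bar> \<le> 2" for k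
    using D(1)[of k "Suc a"] D(1)[of k "Suc (Suc a)"] by auto
  show "c k (Suc a) - c k (Suc (Suc a)) = 0" if "2 * W \<le> k" for k
    using sign_tableaux_zero[OF c, of k] W[of "k div 2"] that by auto
  show "\<bar>c (2 * j) (Suc a) - c (2 * j) (Suc (Suc a))\<bar> = 1 \<longleftrightarrow>
     \<bar>c (2 * j + 1) (Suc a) - c (2 * j + 1) (Suc (Suc a))\<bar> = 1" for j
    by (rule sp(1))
  show "\<bar>c (2 * j) (Suc a) - c (2 * j) (Suc (Suc a))\<bar> = 1 \<Longrightarrow>
    c (2 * j) (Suc a) - c (2 * j) (Suc (Suc a)) = c (2 * j + 1) (Suc a) - c (2 * j + 1) (Suc (Suc a)) \<or>
    c (2 * j) (Suc a) - c (2 * j) (Suc (Suc a)) = -1 \<and>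
    c (2 * j + 1) (Suc a) - c (2 * j + 1) (Suc (Suc a)) = 1" for j
    by (rule sp(2))
  show "col_ok (Suc a) lo hi k (c k) (c (Suc k))" for k
    unfolding col_ok_def using D(4,5)[of "Suc a" k] i by auto
  fix c' assume c': "\<And>k. c' k = c k \<or> c' k = swap_signs (Suc a) (c k)"
  have np: "npos (c' k) x = npos (c k) x" if "x \<noteq> Suc a" for k x
    using c'[of k] that by (auto simp: npos_swap)
  have abs: "\<bar>c' k (Suc a) - c' k (Suc (Suc a))\<bar> = \<bar>c k (Suc a) - c k (Suc (Suc a))\<bar>" for k
    using c'[of k] by (auto simp: swap_signs_def)
  show "c (2 * j) (Suc a) - c (2 * j) (Suc (Suc a)) = c (2 * j + 1) (Suc a) - c (2 * j + 1) (Suc (Suc a)) \<longleftrightarrow>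
    c' (2 * j) (Suc a) - c' (2 * j) (Suc (Suc a)) = c' (2 * j + 1) (Suc a) - c' (2 * j + 1) (Suc (Suc a))"
    if "c' \<in> sign_tableaux m lo hi" and t: "\<bar>c (2 * j) (Suc a) - c (2 * j) (Suc (Suc a))\<bar> = 1" for j
  proof -
    note D' = sign_tableauxD[OF that(1)]
    note sp' = swap_pair[OF D'(6) i D'(1) D'(1)]
    show ?thesis using sp(3)[OF t] sp'(3)[of j] t abs[of "2 * j"] np[of a] np[of "Suc (Suc a)"] by simp
  qed
  show "c' \<in> sign_tableaux m lo hi"
    if "\<And>j. \<bar>c (2 * j) (Suc a) - c (2 * j) (Suc (Suc a))\<bar> = 1 \<Longrightarrow>
      if c (2 * j) (Suc a) - c (2 * j) (Suc (Suc a)) = c (2 * j + 1) (Suc a) - c (2 * j + 1) (Suc (Suc a))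
      then c' (2 * j) (Suc a) - c' (2 * j) (Suc (Suc a)) = c' (2 * j + 1) (Suc a) - c' (2 * j + 1) (Suc (Suc a))
      else c' (2 * j) = c (2 * j) \<and> c' (2 * j + 1) = c (2 * j + 1)"
    and "\<And>k. c' k (Suc a) - c' k (Suc (Suc a)) < 0 \<Longrightarrow>
      0 < c' (Suc k) (Suc a) - c' (Suc k) (Suc (Suc a)) \<Longrightarrow> col_ok (Suc a) lo hi k (c' k) (c' (Suc k))"
    using swap_valid[OF i c c'] that by blast
next
  fix e :: "nat \<Rightarrow> int"
  show "swap_signs (Suc a) (swap_signs (Suc a) e) = e"
    by (auto simp: swap_signs_def fun_eq_iff)
  show "swap_signs (Suc a) e (Suc a) - swap_signs (Suc a) e (Suc (Suc a)) =
      - (e (Suc a) - e (Suc (Suc a)))" by (simp add: swap_signs_def)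
  show "swap_signs (Suc a) e = e" if "e (Suc a) - e (Suc (Suc a)) = 0"
    using that by (auto simp: swap_signs_def fun_eq_iff)
qed (fact fin)

text \<open>
  Within a flip class the weight is determined by the total: only its values at \<open>a + 1\<close> and
  \<open>a + 2\<close> vary, their sum is constant, and their difference is half the total.
\<close>

theorem sum_sign_weight_swap:
  fixes f :: "(nat \<Rightarrow> int) \<Rightarrow> complex"
  assumes i: "Suc (Suc a) \<le> m" and fin: "finite (sign_tableaux m lo hi)"
    and W: "\<And>j. W \<le> j \<Longrightarrow> hi j = lo j"
  shows "(\<Sum>c\<in>sign_tableaux m lo hi. f (sign_weight W c))
    = (\<Sum>c\<in>sign_tableaux m lo hi. f (swap_signs (Suc a) (sign_weight W c)))"
proof -
  interpret flip_system W "sign_tableaux m lo hi" "\<lambda>e. e (Suc a) - e (Suc (Suc a))"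
    "swap_signs (Suc a)" "col_ok (Suc a) lo hi"
    by (rule swap_flip_system[OF assms])
  show ?thesis
  proof (rule sum_via_classes)
    fix c0 assume c0: "c0 \<in> sign_tableaux m lo hi"
    define v where "v = sign_weight W c0"
    define s where "s = v (Suc a) + v (Suc (Suc a))"
    define G where "G t = f (v(Suc a := (s + t div 2) div 2, Suc (Suc a) := (s - t div 2) div 2))" for t
    have "f (sign_weight W c) = G (total c) \<and> f (swap_signs (Suc a) (sign_weight W c)) = G (- total c)"
      if "c \<in> flip_class c0" for c
    proof -
      define u where "u = sign_weight W c"
      have c: "c \<in> sign_tableaux m lo hi" and cc: "\<And>k. c k = c0 k \<or> c k = swap_signs (Suc a) (c0 k)"
        using that unfolding flip_class_def by auto
      have t2: "total c = 2 * (u (Suc a) - u (Suc (Suc a)))"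
        unfolding u_def right_diff_distrib two_sign_weight[OF c] total_def sum_subtractf[symmetric]
        by (intro sum.cong) auto
      have cs: "c k (Suc a) + c k (Suc (Suc a)) = c0 k (Suc a) + c0 k (Suc (Suc a))" for k
        using cc[of k] by (auto simp: swap_signs_def)
      have "2 * (u (Suc a) + u (Suc (Suc a))) = 2 * s"
        unfolding u_def v_def s_def distrib_left two_sign_weight[OF c] two_sign_weight[OF c0]
          sum.distrib[symmetric]
        using cs by (intro sum.cong) (auto simp: algebra_simps)
      then have s: "u (Suc a) + u (Suc (Suc a)) = s" by simp
      have eqx: "u x = v x" if "x \<noteq> Suc a" "x \<noteq> Suc (Suc a)" for x
      proof -
        have "c k x = c0 k x" for k using cc[of k] that by (auto simp: swap_signs_def)
        then show ?thesis unfolding u_def v_def sign_weight_def by simp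
      qed
      have h1: "(s + total c div 2) div 2 = u (Suc a)" "(s - total c div 2) div 2 = u (Suc (Suc a))"
        using t2 s by auto
      have h2: "(s + (- total c) div 2) div 2 = u (Suc (Suc a))"
        "(s - (- total c) div 2) div 2 = u (Suc a)"
        using t2 s by auto
      have "v(Suc a := u (Suc a), Suc (Suc a) := u (Suc (Suc a))) = u"
        "v(Suc a := u (Suc (Suc a)), Suc (Suc a) := u (Suc a)) = swap_signs (Suc a) u"
        using eqx unfolding swap_signs_def by (auto simp: fun_eq_iff)
      then show ?thesis unfolding G_def h1 h2 u_def[symmetric] by simp
    qed
    then show "(\<Sum>c\<in>flip_class c0. f (sign_weight W c)) =
        (\<Sum>c\<in>flip_class c0. f (swap_signs (Suc a) (sign_weight W c)))"
      using sum_flip_class[OF c0, of G] by simp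
  qed
qed

section \<open>Exchanging the middle letters\<close>

text \<open>
  For \<open>i = m\<close> this is the reflection that exchanges the letters \<open>m\<close> and \<open>Bar m\<close>, which are
  adjacent in the alphabet.
\<close>

definition negate_sign :: "nat \<Rightarrow> (nat \<Rightarrow> int) \<Rightarrow> nat \<Rightarrow> int" where
  "negate_sign i e = e(i := - e i)"

lemma npos_negate: "x < i \<Longrightarrow> npos (negate_sign i e) x = npos e x"
  and nneg_negate: "x < i \<Longrightarrow> nneg (negate_sign i e) x = nneg e x"
  by (induction x) (auto simp: npos_Suc nneg_Suc negate_sign_def)

lemma height_negate: "npos (negate_sign i e) i + nneg (negate_sign i e) i = npos e i + nneg e i"
  by (cases i) (auto simp: npos_Suc nneg_Suc npos_negate nneg_negate, auto simp: negate_sign_def)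

text \<open>
  At the last letter the two inequalities are equivalent, since \<open>lo + npos e m = hi - nneg e m\<close>;
  this replaces the inequalities beyond it.
\<close>

lemma ineq_at_negate:
  fixes e e' :: "nat \<Rightarrow> int"
  assumes v: "\<And>x. e x \<in> {-1, 0, 1}" "\<And>x. e' x \<in> {-1, 0, 1}"
    and u: "l' + npos e' a \<le> l + npos e a"
    and n: "h' - nneg e' a \<le> h - nneg e a"
    and eq: "npos e (Suc a) + nneg e (Suc a) = h - l" "npos e' (Suc a) + nneg e' (Suc a) = h' - l'"
    and w: "e (Suc a) \<ge> 0 \<or> e' (Suc a) \<le> 0"
  shows "l' + npos e' (Suc a) \<le> l + npos e (Suc a)" "h' - nneg e' (Suc a) \<le> h - nneg e (Suc a)"
  using u n w eq v(1)[of "Suc a"] v(2)[of "Suc a"] 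
  unfolding npos_Suc nneg_Suc of_bool_def by (auto split: if_splits)

lemma negate_pair:
  assumes p: "split_pair (Suc a) e f"
    and v: "\<And>x. e x \<in> {-1, 0, 1}" "\<And>x. f x \<in> {-1, 0, 1}"
  shows "\<bar>e (Suc a)\<bar> = 1 \<longleftrightarrow> \<bar>f (Suc a)\<bar> = 1"
    and "\<bar>e (Suc a)\<bar> = 1 \<Longrightarrow> e (Suc a) = f (Suc a) \<or> e (Suc a) = -1 \<and> f (Suc a) = 1"
    and "\<bar>e (Suc a)\<bar> = 1 \<Longrightarrow> e (Suc a) = f (Suc a) \<longleftrightarrow> npos e a = npos f a"
proof -
  have *: "e (Suc a) = 0 \<longleftrightarrow> f (Suc a) = 0" "npos f a \<le> npos e a" "npos f (Suc a) = npos e (Suc a)" 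
    using p unfolding split_pair_def by auto
  note vv = v(1)[of "Suc a"] v(2)[of "Suc a"]
  show "\<bar>e (Suc a)\<bar> = 1 \<longleftrightarrow> \<bar>f (Suc a)\<bar> = 1"
    using *(1) vv by auto
  show "\<bar>e (Suc a)\<bar> = 1 \<Longrightarrow> e (Suc a) = f (Suc a) \<or> e (Suc a) = -1 \<and> f (Suc a) = 1"
    using * vv unfolding npos_Suc by auto
  show "\<bar>e (Suc a)\<bar> = 1 \<Longrightarrow> e (Suc a) = f (Suc a) \<longleftrightarrow> npos e a = npos f a"
    using * vv unfolding npos_Suc by auto
qed

lemma split_pair_negate:
  assumes p: "split_pair (Suc a) e f"
    and v: "\<And>x. e x \<in> {-1, 0, 1}" "\<And>x. f x \<in> {-1, 0, 1}"
    and e': "e' = e \<or> e' = negate_sign (Suc a) e" and f': "f' = f \<or> f' = negate_sign (Suc a) f"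
    and le: "\<And>x. x \<le> Suc a \<Longrightarrow> npos f' x \<le> npos e' x"
    and tied: "\<bar>e (Suc a)\<bar> = 1 \<Longrightarrow>
      if e (Suc a) = f (Suc a) then e' (Suc a) = f' (Suc a) else e' = e \<and> f' = f"
  shows "split_pair (Suc a) e' f'"
proof -
  have S: "e (Suc a) = 0 \<longleftrightarrow> f (Suc a) = 0" using p unfolding split_pair_def by auto
  note vv = v(1)[of "Suc a"] v(2)[of "Suc a"]
  have np: "npos e' x = npos e x" "npos f' x = npos f x" if "x < Suc a" for x
    using e' f' that by (auto simp: npos_negate)
  have out: "e' x = e x" "f' x = f x" if "x \<noteq> Suc a" for x
    using e' f' that by (auto simp: negate_sign_def)
  have supp: "e' x = 0 \<longleftrightarrow> e x = 0" "f' x = 0 \<longleftrightarrow> f x = 0" for x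
    using e' f' unfolding negate_sign_def by (auto split: if_splits)
  have top: "npos e' (Suc a) = npos f' (Suc a)"
  proof (cases "e (Suc a) = 0")
    case True
    then have "e' = e" "f' = f" using S e' f' unfolding negate_sign_def by (auto simp: fun_eq_iff)
    then show ?thesis using p unfolding split_pair_def by auto
  next
    case False
    then have t: "\<bar>e (Suc a)\<bar> = 1" using vv by auto
    show ?thesis
    proof (cases "e (Suc a) = f (Suc a)")
      case True
      then have "npos e a = npos f a" using negate_pair(3)[OF p v t] by simp
      then show ?thesis using True tied[OF t] np[of a] unfolding npos_Suc by simp
    next
      case False
      then show ?thesis using tied[OF t] p unfolding split_pair_def by auto
    qed
  qed
  have "npos e' x = npos f' x" if "e' x = 0" "x \<in> {1..Suc a}" for x
    using that top np[of x] supp[of x] p unfolding split_pair_def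
    by (cases "x = Suc a") auto
  then show ?thesis
    unfolding split_pair_def using supp top le p unfolding split_pair_def by auto
qed

lemma negate_valid:
  assumes c: "c \<in> sign_tableaux (Suc a) lo hi"
    and c': "\<And>k. c' k = c k \<or> c' k = negate_sign (Suc a) (c k)"
    and tied: "\<And>j. \<bar>c (2 * j) (Suc a)\<bar> = 1 \<Longrightarrow>
      if c (2 * j) (Suc a) = c (2 * j + 1) (Suc a)
      then c' (2 * j) (Suc a) = c' (2 * j + 1) (Suc a)
      else c' (2 * j) = c (2 * j) \<and> c' (2 * j + 1) = c (2 * j + 1)"
    and ok: "\<And>k. c' k (Suc a) < 0 \<Longrightarrow> c' (Suc k) (Suc a) > 0 \<Longrightarrow>
      col_ok (Suc a) lo hi k (c' k) (c' (Suc k))"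
  shows "c' \<in> sign_tableaux (Suc a) lo hi"
proof -
  note D = sign_tableauxD[OF c]
  have v: "c' k x \<in> {-1, 0, 1}" for k x
    using c'[of k] D(1)[of k x] by (auto simp: negate_sign_def split: if_splits)
  have z: "c' k x = 0" if "x \<notin> {1..Suc a}" for k x
    using c'[of k] D(2)[of _ k] that by (auto simp: negate_sign_def)
  have np: "npos (c' k) x = npos (c k) x" "nneg (c' k) x = nneg (c k) x" if "x < Suc a" for k x
    using c'[of k] that by (auto simp: npos_negate nneg_negate)
  have ht: "npos (c' k) (Suc a) + nneg (c' k) (Suc a) = hi (k div 2) - lo (k div 2)" for k
    using c'[of k] D(3)[of k] height_negate by auto
  have ineq: "lo (Suc k div 2) + npos (c' (Suc k)) x \<le> lo (k div 2) + npos (c' k) x \<and>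
    hi (Suc k div 2) - nneg (c' (Suc k)) x \<le> hi (k div 2) - nneg (c' k) x" if x: "x \<le> Suc a" for k x
  proof (cases "x = Suc a")
    case False
    then show ?thesis using D(4,5)[OF x, of k] np[of x] x by simp
  next
    case True
    show ?thesis
    proof (cases "c' k (Suc a) < 0 \<and> c' (Suc k) (Suc a) > 0")
      case True
      then show ?thesis using ok[of k] \<open>x = Suc a\<close> unfolding col_ok_def by simp
    next
      case False
      show ?thesis unfolding \<open>x = Suc a\<close>
        using ineq_at_negate[of "c' k" "c' (Suc k)" "lo (Suc k div 2)" a "lo (k div 2)"
            "hi (Suc k div 2)" "hi (k div 2)", OF v v _ _ ht ht] np[of a] 
          D(4,5)[of a k] False by auto
    qed
  qed
  have "split_pair (Suc a) (c' (2 * j)) (c' (2 * j + 1))" for j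
  proof (rule split_pair_negate[OF D(6) D(1) D(1) c' c' _ tied])
    fix x assume "x \<le> Suc a"
    from ineq[OF this, of "2 * j"] show "npos (c' (2 * j + 1)) x \<le> npos (c' (2 * j)) x" by simp
  qed
  then show ?thesis
    unfolding sign_tableaux_def is_sign_vector_def using v z ineq ht by auto
qed

lemma negate_flip_system:
  assumes fin: "finite (sign_tableaux (Suc a) lo hi)" and W: "\<And>j. W \<le> j \<Longrightarrow> hi j = lo j"
  shows "flip_system W (sign_tableaux (Suc a) lo hi) (\<lambda>e. e (Suc a))
    (negate_sign (Suc a)) (col_ok (Suc a) lo hi)"
proof
  fix c assume c: "c \<in> sign_tableaux (Suc a) lo hi"
  note D = sign_tableauxD[OF c]
  note sp = negate_pair[OF D(6) D(1) D(1)]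
  show "\<bar>c k (Suc a)\<bar> \<le> 2" for k
    using D(1)[of k "Suc a"] by auto
  show "c k (Suc a) = 0" if "2 * W \<le> k" for k
    using sign_tableaux_zero[OF c, of k] W[of "k div 2"] that by auto
  show "\<bar>c (2 * j) (Suc a)\<bar> = 1 \<longleftrightarrow> \<bar>c (2 * j + 1) (Suc a)\<bar> = 1" for j
    by (rule sp(1))
  show "\<bar>c (2 * j) (Suc a)\<bar> = 1 \<Longrightarrow> c (2 * j) (Suc a) = c (2 * j + 1) (Suc a) \<or>
    c (2 * j) (Suc a) = -1 \<and> c (2 * j + 1) (Suc a) = 1" for j
    by (rule sp(2))
  show "col_ok (Suc a) lo hi k (c k) (c (Suc k))" for k
    unfolding col_ok_def using D(4,5)[of "Suc a" k] by auto
  fix c' assume c': "\<And>k. c' k = c k \<or> c' k = negate_sign (Suc a) (c k)"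
  have np: "npos (c' k) a = npos (c k) a" for k
    using c'[of k] by (auto simp: npos_negate)
  have abs: "\<bar>c' k (Suc a)\<bar> = \<bar>c k (Suc a)\<bar>" for k
    using c'[of k] by (auto simp: negate_sign_def)
  show "c (2 * j) (Suc a) = c (2 * j + 1) (Suc a) \<longleftrightarrow> c' (2 * j) (Suc a) = c' (2 * j + 1) (Suc a)"
    if "c' \<in> sign_tableaux (Suc a) lo hi" and t: "\<bar>c (2 * j) (Suc a)\<bar> = 1" for j
  proof -
    note D' = sign_tableauxD[OF that(1)]
    note sp' = negate_pair[OF D'(6) D'(1) D'(1)]
    show ?thesis using sp(3)[OF t] sp'(3)[of j] t abs[of "2 * j"] np by simp
  qed
  show "c' \<in> sign_tableaux (Suc a) lo hi"
    if "\<And>j. \<bar>c (2 * j) (Suc a)\<bar> = 1 \<Longrightarrow>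
      if c (2 * j) (Suc a) = c (2 * j + 1) (Suc a)
      then c' (2 * j) (Suc a) = c' (2 * j + 1) (Suc a)
      else c' (2 * j) = c (2 * j) \<and> c' (2 * j + 1) = c (2 * j + 1)"
    and "\<And>k. c' k (Suc a) < 0 \<Longrightarrow> 0 < c' (Suc k) (Suc a) \<Longrightarrow>
      col_ok (Suc a) lo hi k (c' k) (c' (Suc k))"
    using negate_valid[OF c c'] that by blast
next
  fix e :: "nat \<Rightarrow> int"
  show "negate_sign (Suc a) (negate_sign (Suc a) e) = e"
    by (auto simp: negate_sign_def fun_eq_iff)
  show "negate_sign (Suc a) e (Suc a) = - e (Suc a)" by (simp add: negate_sign_def)
  show "negate_sign (Suc a) e = e" if "e (Suc a) = 0"
    using that by (auto simp: negate_sign_def fun_eq_iff)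
qed (fact fin)

theorem sum_sign_weight_negate:
  fixes f :: "(nat \<Rightarrow> int) \<Rightarrow> complex"
  assumes fin: "finite (sign_tableaux (Suc a) lo hi)" and W: "\<And>j. W \<le> j \<Longrightarrow> hi j = lo j"
  shows "(\<Sum>c\<in>sign_tableaux (Suc a) lo hi. f (sign_weight W c))
    = (\<Sum>c\<in>sign_tableaux (Suc a) lo hi. f (negate_sign (Suc a) (sign_weight W c)))"
proof -
  interpret flip_system W "sign_tableaux (Suc a) lo hi" "\<lambda>e. e (Suc a)"
    "negate_sign (Suc a)" "col_ok (Suc a) lo hi"
    by (rule negate_flip_system[OF assms])
  show ?thesis
  proof (rule sum_via_classes)
    fix c0 assume c0: "c0 \<in> sign_tableaux (Suc a) lo hi"
    define v where "v = sign_weight W c0"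
    define G where "G t = f (v(Suc a := t div 2))" for t
    have "f (sign_weight W c) = G (total c) \<and> f (negate_sign (Suc a) (sign_weight W c)) = G (- total c)"
      if "c \<in> flip_class c0" for c
    proof -
      define u where "u = sign_weight W c"
      have c: "c \<in> sign_tableaux (Suc a) lo hi"
        and cc: "\<And>k. c k = c0 k \<or> c k = negate_sign (Suc a) (c0 k)"
        using that unfolding flip_class_def by auto
      have t2: "total c = 2 * u (Suc a)"
        unfolding u_def two_sign_weight[OF c] total_def ..
      have eqx: "u x = v x" if "x \<noteq> Suc a" for x
      proof -
        have "c k x = c0 k x" for k using cc[of k] that by (auto simp: negate_sign_def)
        then show ?thesis unfolding u_def v_def sign_weight_def by simp
      qed
      have h: "total c div 2 = u (Suc a)" "(- total c) div 2 = - u (Suc a)"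
        using t2 by auto
      have "v(Suc a := u (Suc a)) = u" "v(Suc a := - u (Suc a)) = negate_sign (Suc a) u"
        using eqx unfolding negate_sign_def by (auto simp: fun_eq_iff)
      then show ?thesis unfolding G_def h u_def[symmetric] by simp
    qed
    then show "(\<Sum>c\<in>flip_class c0. f (sign_weight W c)) =
        (\<Sum>c\<in>flip_class c0. f (negate_sign (Suc a) (sign_weight W c)))"
      using sum_flip_class[OF c0, of G] by simp
  qed
qed

section \<open>Sums over injective choices of variables\<close>

text \<open>
  Lists of \<open>r\<close> distinct elements of \<open>I\<close>.
\<close>

definition distinct_lists :: "nat set \<Rightarrow> nat \<Rightarrow> nat list set" where
  "distinct_lists I r = {xs. length xs = r \<and> distinct xs \<and> set xs \<subseteq> I}"

text \<open>
  The sum of \<open>b (x\<^sub>0) (v\<^sub>0) * b (x\<^sub>1) (v\<^sub>1) * \<dots>\<close> over all choices of \<open>r\<close> distinct variables \<open>x\<^sub>s\<close>.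
  With \<open>b x k = y\<^sub>x\<^sup>k + y\<^sub>x\<^sup>-\<^sup>k\<close> and \<open>r = m\<close> it is the sum of the monomial with exponents \<open>v\<close> over
  all signed permutations of the \<open>m\<close> variables.
\<close>

definition injective_sum :: "nat set \<Rightarrow> (nat \<Rightarrow> int \<Rightarrow> complex) \<Rightarrow> nat \<Rightarrow> (nat \<Rightarrow> int) \<Rightarrow> complex" where
  "injective_sum I b r v = (\<Sum>xs\<in>distinct_lists I r. \<Prod>s<r. b (xs ! s) (v s))"

lemma finite_distinct_lists: "finite I \<Longrightarrow> finite (distinct_lists I r)"
  unfolding distinct_lists_def
  by (rule finite_subset[OF _ finite_lists_length_eq[of I r]]) auto

lemma sum_distinct_lists_Suc:
  fixes F :: "nat list \<Rightarrow> complex"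
  assumes "finite I"
  shows "(\<Sum>zs\<in>distinct_lists I (Suc r). F zs)
    = (\<Sum>xs\<in>distinct_lists I r. \<Sum>x\<in>I - set xs. F (xs @ [x]))"
proof -
  have "bij_betw (\<lambda>(xs, x). xs @ [x]) (SIGMA xs:distinct_lists I r. I - set xs)
      (distinct_lists I (Suc r))"
  proof (rule bij_betw_byWitness[where f' = "\<lambda>zs. (butlast zs, last zs)"])
    show "\<forall>zs\<in>distinct_lists I (Suc r). (\<lambda>(xs, x). xs @ [x]) (butlast zs, last zs) = zs"
      unfolding distinct_lists_def by (auto intro!: append_butlast_last_id)
    have "butlast zs \<in> distinct_lists I r \<and> last zs \<in> I - set (butlast zs)"
      if "zs \<in> distinct_lists I (Suc r)" for zs
      using that unfolding distinct_lists_def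
      by (cases zs rule: rev_cases) auto
    then show "(\<lambda>zs. (butlast zs, last zs)) ` distinct_lists I (Suc r)
        \<subseteq> (SIGMA xs:distinct_lists I r. I - set xs)" by auto
  qed (auto simp: distinct_lists_def)
  from sum.reindex_bij_betw[OF this, of F, symmetric] show ?thesis
    using assms finite_distinct_lists[OF assms] by (subst sum.Sigma) (auto simp: case_prod_unfold)
qed

text \<open>
  The last variable may first be chosen freely, giving a power sum; the choices that coincide with
  the variable number \<open>t\<close> are then subtracted, and for them the two factors merge.
\<close>

lemma injective_sum_Suc:
  assumes fin: "finite I"
    and b: "\<And>x k l. x \<in> I \<Longrightarrow> b x k * b x l = b x (k + l) + b x (k - l)"
  shows "injective_sum I b (Suc r) v = injective_sum I b r v * (\<Sum>x\<in>I. b x (v r))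
    - (\<Sum>t<r. injective_sum I b r (v(t := v t + v r)) + injective_sum I b r (v(t := v t - v r)))"
proof -
  let ?k = "v r"
  have prodt: "(\<Prod>s<r. b (xs ! s) (v s)) * b (xs ! t) ?k
      = (\<Prod>s<r. b (xs ! s) ((v(t := v t + ?k)) s)) + (\<Prod>s<r. b (xs ! s) ((v(t := v t - ?k)) s))"
    if xs: "xs \<in> distinct_lists I r" and t: "t < r" for xs t
  proof -
    have I: "xs ! t \<in> I" using xs t unfolding distinct_lists_def by auto
    have *: "(\<Prod>s<r. b (xs ! s) ((v(t := a)) s)) = b (xs ! t) a * (\<Prod>s\<in>{..<r} - {t}. b (xs ! s) (v s))" for a
      using t by (subst prod.remove[of _ t]) (auto intro!: prod.cong)
    define R where "R = (\<Prod>s\<in>{..<r} - {t}. b (xs ! s) (v s))"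
    have "(\<Prod>s<r. b (xs ! s) (v s)) * b (xs ! t) ?k = (b (xs ! t) (v t) * b (xs ! t) ?k) * R"
      using *[of "v t"] unfolding R_def by (simp add: mult_ac)
    then show ?thesis unfolding * b[OF I] R_def[symmetric] by (simp add: distrib_right)
  qed
  have step: "(\<Sum>x\<in>I - set xs. \<Prod>s<Suc r. b ((xs @ [x]) ! s) (v s))
      = (\<Prod>s<r. b (xs ! s) (v s)) * (\<Sum>x\<in>I. b x ?k)
        - (\<Sum>t<r. (\<Prod>s<r. b (xs ! s) ((v(t := v t + ?k)) s)) + (\<Prod>s<r. b (xs ! s) ((v(t := v t - ?k)) s)))"
    if xs: "xs \<in> distinct_lists I r" for xs
  proof -
    have X: "length xs = r" "distinct xs" "set xs \<subseteq> I" using xs unfolding distinct_lists_def by auto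
    have "(\<Prod>s<Suc r. b ((xs @ [x]) ! s) (v s)) = (\<Prod>s<r. b (xs ! s) (v s)) * b x ?k" for x
      using X(1) by (auto simp: nth_append intro!: prod.cong)
    then have "(\<Sum>x\<in>I - set xs. \<Prod>s<Suc r. b ((xs @ [x]) ! s) (v s))
        = (\<Prod>s<r. b (xs ! s) (v s)) * (\<Sum>x\<in>I - set xs. b x ?k)"
      by (simp add: sum_distrib_left)
    also have "(\<Sum>x\<in>I - set xs. b x ?k) = (\<Sum>x\<in>I. b x ?k) - (\<Sum>x\<in>set xs. b x ?k)"
      using X(3) fin by (simp add: sum_diff)
    also have "(\<Sum>x\<in>set xs. b x ?k) = (\<Sum>t<r. b (xs ! t) ?k)"
      using sum.reindex_bij_betw[OF bij_betw_nth[OF X(2) _ refl], of "{..<r}" "\<lambda>x. b x ?k"] X(1) by simp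
    finally show ?thesis
      using prodt[OF xs] by (simp add: right_diff_distrib sum_distrib_left)
  qed
  have "injective_sum I b (Suc r) v = (\<Sum>xs\<in>distinct_lists I r.
      (\<Prod>s<r. b (xs ! s) (v s)) * (\<Sum>x\<in>I. b x ?k)
        - (\<Sum>t<r. (\<Prod>s<r. b (xs ! s) ((v(t := v t + ?k)) s)) + (\<Prod>s<r. b (xs ! s) ((v(t := v t - ?k)) s))))"
    unfolding injective_sum_def sum_distinct_lists_Suc[OF fin] using step by (intro sum.cong) auto
  also have "\<dots> = injective_sum I b r v * (\<Sum>x\<in>I. b x ?k)
    - (\<Sum>t<r. injective_sum I b r (v(t := v t + ?k)) + injective_sum I b r (v(t := v t - ?k)))"
    unfolding injective_sum_def sum_subtractf sum_distrib_right
    by (subst sum.swap) (simp add: sum.distrib)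
  finally show ?thesis .
qed

text \<open>
  In the recurrence, the correction terms have one exponent less, with the same parity of the sum
  and no larger sum of absolute values. In the main term the power sum vanishes if the last
  exponent is odd, and the remaining exponents have odd sum otherwise.
\<close>

lemma injective_sum_zero:
  assumes fin: "finite I"
    and b: "\<And>x k l. x \<in> I \<Longrightarrow> b x k * b x l = b x (k + l) + b x (k - l)"
    and zero: "\<And>k. odd k \<Longrightarrow> \<bar>k\<bar> \<le> n \<Longrightarrow> (\<Sum>x\<in>I. b x k) = 0"
    and "odd (\<Sum>s<r. v s)" "(\<Sum>s<r. \<bar>v s\<bar>) \<le> n"
  shows "injective_sum I b r v = 0"
  using assms(4,5)
proof (induction r arbitrary: v)
  case (Suc r)
  let ?k = "v r"
  have upd: "injective_sum I b r (v(t := v t + e * ?k)) = 0" if t: "t < r" and e: "e = 1 \<or> e = -1" for t e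
  proof (rule Suc.IH)
    have s: "(\<Sum>s<r. g ((v(t := a)) s)) = (\<Sum>s<r. g (v s)) - g (v t) + g a" for g :: "int \<Rightarrow> int" and a
      using t by (simp add: sum.remove[of "{..<r}" t])
    show "odd (\<Sum>s<r. (v(t := v t + e * ?k)) s)"
      using s[of "\<lambda>x. x"] Suc.prems(1) e by auto
    have "\<bar>v t + e * ?k\<bar> \<le> \<bar>v t\<bar> + \<bar>?k\<bar>" using e by auto
    then show "(\<Sum>s<r. \<bar>(v(t := v t + e * ?k)) s\<bar>) \<le> n"
      using s[of "\<lambda>x. \<bar>x\<bar>"] Suc.prems(2) by auto
  qed
  have "injective_sum I b r v * (\<Sum>x\<in>I. b x ?k) = 0"
  proof (cases "odd ?k")
    case True
    have "0 \<le> (\<Sum>s<r. \<bar>v s\<bar>)" by (rule sum_nonneg) simp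
    then have "\<bar>?k\<bar> \<le> n" using Suc.prems(2)[unfolded sum.lessThan_Suc] by linarith
    then show ?thesis using zero[OF True] by simp
  next
    case False
    then have "injective_sum I b r v = 0"
      using Suc.prems by (intro Suc.IH) auto
    then show ?thesis by simp
  qed
  then show ?case
    using injective_sum_Suc[of I b r v, OF fin b] upd[of _ 1] upd[of _ "-1"] by simp
qed simp

lemma sum_permutations_as_injective_sum:
  "(\<Sum>p | p permutes {1..m}. \<Prod>x=1..m. b x (v (p x))) = injective_sum {1..m} b m (\<lambda>s. v (Suc s))"
proof -
  have prodS: "(\<Prod>x=1..m. g x) = (\<Prod>s<m. g (Suc s))" for g :: "nat \<Rightarrow> complex"
    by (rule prod.reindex_bij_witness[of _ Suc "\<lambda>x. x - 1"]) auto
  have "(\<Sum>p | p permutes {1..m}. \<Prod>x=1..m. b x (v (p x)))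
      = (\<Sum>p | p permutes {1..m}. \<Prod>x=1..m. b x (v (inv p x)))"
    by (rule sum.reindex_bij_witness[of _ inv inv]) (auto simp: permutes_inv inv_inv_eq permutes_bij)
  also have "\<dots> = (\<Sum>p | p permutes {1..m}. \<Prod>s=1..m. b (p s) (v s))"
  proof (rule sum.cong[OF refl])
    fix p assume p: "p \<in> {p. p permutes {1..m}}"
    then have "bij_betw p {1..m} {1..m}" by (simp add: permutes_imp_bij)
    from prod.reindex_bij_betw[OF this, of "\<lambda>x. b x (v (inv p x))"]
    show "(\<Prod>x=1..m. b x (v (inv p x))) = (\<Prod>s=1..m. b (p s) (v s))"
      using p by (simp add: permutes_inverses)
  qed
  also have "\<dots> = (\<Sum>xs\<in>distinct_lists {1..m} m. \<Prod>s<m. b (xs ! s) (v (Suc s)))"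
  proof (rule sum.reindex_bij_witness[of _
        "\<lambda>xs x. if x \<in> {1..m} then xs ! (x - 1) else x" "\<lambda>p. map p [1..<Suc m]"])
    fix p assume p: "p \<in> {p. p permutes {1..m}}"
    have "[1..<Suc m] ! (x - 1) = x" if "x \<in> {1..m}" for x
      using that by (auto simp del: upt_Suc)
    then show "(\<lambda>x. if x \<in> {1..m} then map p [1..<Suc m] ! (x - 1) else x) = p"
      using p permutes_not_in[of p "{1..m}"] by (auto simp: fun_eq_iff simp del: upt_Suc)
    show "map p [1..<Suc m] \<in> distinct_lists {1..m} m"
      using p permutes_image[of p "{1..m}"] permutes_inj_on[of p]
      unfolding distinct_lists_def
      by (auto simp: distinct_map permutes_in_image simp del: upt_Suc)
    show "(\<Prod>s<m. b (map p [1..<Suc m] ! s) (v (Suc s))) = (\<Prod>s=1..m. b (p s) (v s))"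
      unfolding prodS by (intro prod.cong) (auto simp del: upt_Suc)
  next
    fix xs assume "xs \<in> distinct_lists {1..m} m"
    then have xs: "length xs = m" "distinct xs" "set xs \<subseteq> {1..m}" unfolding distinct_lists_def by auto
    then have "card (set xs) = m" by (simp add: distinct_card)
    then have set: "set xs = {1..m}" using xs(3) by (intro card_subset_eq) auto
    let ?p = "\<lambda>x. if x \<in> {1..m} then xs ! (x - 1) else x"
    have "bij_betw (\<lambda>x. xs ! (x - 1)) {1..m} {1..m}"
    proof -
      have "bij_betw (\<lambda>x. x - 1) {1..m} {..<m}"
        by (rule bij_betw_byWitness[where f' = Suc]) auto
      from bij_betw_trans[OF this bij_betw_nth[OF xs(2), of "{..<m}" "{1..m}"]] show ?thesis
        using xs(1) set by (simp add: comp_def)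
    qed
    then have "bij_betw ?p {1..m} {1..m}" by (subst bij_betw_cong[where g = "\<lambda>x. xs ! (x - 1)"]) auto
    then show "?p \<in> {p. p permutes {1..m}}" by (auto intro: bij_imp_permutes)
    show "map ?p [1..<Suc m] = xs"
      using xs(1) by (intro nth_equalityI) (auto simp del: upt_Suc)
  qed
  finally show ?thesis unfolding injective_sum_def .
qed

section \<open>Averaging over signed permutations\<close>

text \<open>
  The multiset of the weights \<open>wt c\<close>, \<open>c \<in> C\<close>, is invariant under \<open>g\<close>. This is expressed by sums
  of arbitrary complex functions of the weight.
\<close>

definition weight_symmetry :: "'c set \<Rightarrow> ('c \<Rightarrow> nat \<Rightarrow> int) \<Rightarrow> ((nat \<Rightarrow> int) \<Rightarrow> nat \<Rightarrow> int) \<Rightarrow> bool" where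
  "weight_symmetry C wt g \<longleftrightarrow>
     (\<forall>f :: (nat \<Rightarrow> int) \<Rightarrow> complex. (\<Sum>c\<in>C. f (g (wt c))) = (\<Sum>c\<in>C. f (wt c)))"

lemma weight_symmetry_comp:
  assumes "weight_symmetry C wt g" "weight_symmetry C wt h"
  shows "weight_symmetry C wt (g \<circ> h)"
  unfolding weight_symmetry_def
proof
  fix f :: "(nat \<Rightarrow> int) \<Rightarrow> complex"
  have "(\<Sum>c\<in>C. f ((g \<circ> h) (wt c))) = (\<Sum>c\<in>C. (f \<circ> g) (h (wt c)))" by simp
  also have "\<dots> = (\<Sum>c\<in>C. f (g (wt c)))"
    using assms(2)[unfolded weight_symmetry_def, rule_format, of "f \<circ> g"] by simp
  also have "\<dots> = (\<Sum>c\<in>C. f (wt c))" using assms(1) unfolding weight_symmetry_def by blast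
  finally show "(\<Sum>c\<in>C. f ((g \<circ> h) (wt c))) = (\<Sum>c\<in>C. f (wt c))" .
qed

text \<open>
  The sign changes at all coordinates in \<open>A\<close>.
\<close>

definition negate_signs :: "nat set \<Rightarrow> (nat \<Rightarrow> int) \<Rightarrow> nat \<Rightarrow> int" where
  "negate_signs A v x = (if x \<in> A then - v x else v x)"

context
  fixes C :: "'c set" and wt :: "'c \<Rightarrow> nat \<Rightarrow> int" and m :: nat
  assumes m: "m \<ge> 1"
    and swap: "\<And>a. Suc (Suc a) \<le> m \<Longrightarrow> weight_symmetry C wt (swap_signs (Suc a))"
    and negate: "weight_symmetry C wt (negate_sign m)"
begin

lemma symmetry_id: "weight_symmetry C wt (\<lambda>v. v)"
  unfolding weight_symmetry_def by simp

lemma symmetry_transpose_less: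
  assumes "1 \<le> x" "x + d < m"
  shows "weight_symmetry C wt (\<lambda>v. v \<circ> transpose x (x + Suc d))"
  using assms
proof (induction d)
  case 0
  then obtain a where a: "x = Suc a" by (cases x) auto
  have "swap_signs x = (\<lambda>v. v \<circ> transpose x (x + Suc 0))"
    by (auto simp: swap_signs_def transpose_def fun_eq_iff)
  then show ?case using swap[of a] 0 a by (simp add: comp_def)
next
  case (Suc d)
  let ?y = "x + Suc d"
  obtain b where b: "?y = Suc b" by auto
  have "swap_signs ?y = (\<lambda>v. v \<circ> transpose ?y (Suc ?y))"
    by (auto simp: swap_signs_def transpose_def fun_eq_iff)
  then have s: "weight_symmetry C wt (\<lambda>v. v \<circ> transpose ?y (Suc ?y))"
    using swap[of b] Suc.prems b by simp
  have "weight_symmetry C wt ((\<lambda>v. v \<circ> transpose ?y (Suc ?y)) \<circ>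
      ((\<lambda>v. v \<circ> transpose x ?y) \<circ> (\<lambda>v. v \<circ> transpose ?y (Suc ?y))))"
    by (intro weight_symmetry_comp s Suc.IH) (use Suc.prems in auto)
  also have "((\<lambda>v. v \<circ> transpose ?y (Suc ?y)) \<circ>
      ((\<lambda>v. v \<circ> transpose x ?y) \<circ> (\<lambda>v. v \<circ> transpose ?y (Suc ?y))))
      = (\<lambda>v :: nat \<Rightarrow> int. v \<circ> transpose x (x + Suc (Suc d)))"
    by (auto simp: transpose_def fun_eq_iff)
  finally show ?case .
qed

lemma symmetry_transpose:
  assumes "x \<in> {1..m}" "y \<in> {1..m}"
  shows "weight_symmetry C wt (\<lambda>v. v \<circ> transpose x y)"
proof -
  have *: "weight_symmetry C wt (\<lambda>v. v \<circ> transpose x y)" if "x < y" "x \<in> {1..m}" "y \<in> {1..m}" for x y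
    using that symmetry_transpose_less[of x "y - x - 1"] by auto
  consider "x < y" | "x = y" | "y < x" by linarith
  then show ?thesis
  proof cases
    case 3
    then show ?thesis using *[of y x] assms by (simp add: transpose_commute)
  qed (use assms * symmetry_id in \<open>auto simp: comp_def\<close>)
qed

lemma symmetry_permutation:
  assumes "p permutes {1..m}"
  shows "weight_symmetry C wt (\<lambda>v. v \<circ> p)"
  using assms finite_atLeastAtMost
proof (induction p rule: permutes_induct)
  case id
  then show ?case using symmetry_id by simp
next
  case (swap a b p)
  have "weight_symmetry C wt ((\<lambda>v. v \<circ> p) \<circ> (\<lambda>v. v \<circ> transpose a b))"
    by (rule weight_symmetry_comp[OF swap.IH symmetry_transpose[OF swap.hyps(1,2)]])
  then show ?case by (simp add: comp_def)
qed

lemma symmetry_negate_signs: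
  assumes "A \<subseteq> {1..m}"
  shows "weight_symmetry C wt (negate_signs A)"
proof -
  have "finite A" using assms finite_subset by auto
  then show ?thesis using assms
  proof (induction A)
    case empty
    have "negate_signs {} = (\<lambda>v. v)" by (auto simp: negate_signs_def fun_eq_iff)
    then show ?case using symmetry_id by simp
  next
    case (insert x A)
    have t: "weight_symmetry C wt (\<lambda>v. v \<circ> transpose x m)"
      using insert.prems m by (intro symmetry_transpose) auto
    have "weight_symmetry C wt (((\<lambda>v. v \<circ> transpose x m) \<circ> (negate_sign m \<circ> (\<lambda>v. v \<circ> transpose x m)))
        \<circ> negate_signs A)"
      using insert by (intro weight_symmetry_comp t negate) auto
    also have "((\<lambda>v. v \<circ> transpose x m) \<circ> (negate_sign m \<circ> (\<lambda>v. v \<circ> transpose x m)))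
        \<circ> negate_signs A = negate_signs (insert x A)"
      using insert.hyps(2) by (auto simp: negate_signs_def negate_sign_def transpose_def fun_eq_iff)
    finally show ?case .
  qed
qed

text \<open>
  By symmetry, every weight may be replaced by the average over its orbit under signed
  permutations, and the sum of a monomial over such an orbit is an \<open>injective_sum\<close>.
\<close>

lemma sum_weights_zero:
  assumes y: "\<And>x. x \<in> {1..m} \<Longrightarrow> y x \<noteq> (0 :: complex)"
    and zero: "\<And>k. odd k \<Longrightarrow> \<bar>k\<bar> \<le> n \<Longrightarrow> (\<Sum>x=1..m. y x powi k + y x powi (- k)) = 0"
    and wt: "\<And>c. c \<in> C \<Longrightarrow> odd (\<Sum>x=1..m. wt c x)" "\<And>c. c \<in> C \<Longrightarrow> (\<Sum>x=1..m. \<bar>wt c x\<bar>) \<le> n"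
  shows "(\<Sum>c\<in>C. \<Prod>x=1..m. y x powi wt c x) = 0"
proof -
  define Y where "Y v = (\<Prod>x=1..m. y x powi v x)" for v :: "nat \<Rightarrow> int"
  define b where "b x k = y x powi k + y x powi (- k)" for x k
  let ?P = "{p. p permutes {1..m}}" and ?A = "Pow {1..m}"
  have orbit: "(\<Sum>p\<in>?P. \<Sum>A\<in>?A. Y (negate_signs A (v \<circ> p))) = injective_sum {1..m} b m (\<lambda>s. v (Suc s))" for v
  proof -
    have "(\<Sum>A\<in>?A. Y (negate_signs A u)) = (\<Prod>x=1..m. b x (u x))" for u
    proof -
      have "(\<Prod>x=1..m. b x (u x)) = (\<Prod>x=1..m. y x powi (- u x) + y x powi u x)"
        unfolding b_def by (simp add: add.commute)
      also have "\<dots> = (\<Sum>A\<in>?A. (\<Prod>x\<in>A. y x powi (- u x)) * (\<Prod>x\<in>{1..m} - A. y x powi u x))"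
        by (rule prod_add) simp
      also have "\<dots> = (\<Sum>A\<in>?A. Y (negate_signs A u))"
      proof (rule sum.cong[OF refl])
        fix A assume A: "A \<in> ?A"
        have "Y (negate_signs A u) = (\<Prod>x\<in>{1..m} - A. y x powi negate_signs A u x)
            * (\<Prod>x\<in>A. y x powi negate_signs A u x)"
          unfolding Y_def using A by (intro prod.subset_diff) auto
        also have "\<dots> = (\<Prod>x\<in>{1..m} - A. y x powi u x) * (\<Prod>x\<in>A. y x powi (- u x))"
          by (intro arg_cong2[where f = "(*)"] prod.cong) (auto simp: negate_signs_def)
        finally show "(\<Prod>x\<in>A. y x powi (- u x)) * (\<Prod>x\<in>{1..m} - A. y x powi u x) = Y (negate_signs A u)"
          by simp
      qed
      finally show ?thesis ..
    qed
    then have "(\<Sum>p\<in>?P. \<Sum>A\<in>?A. Y (negate_signs A (v \<circ> p))) = (\<Sum>p\<in>?P. \<Prod>x=1..m. b x (v (p x)))"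
      by (simp add: comp_def)
    then show ?thesis using sum_permutations_as_injective_sum by simp
  qed
  have inv: "(\<Sum>c\<in>C. Y (negate_signs A (wt c \<circ> p))) = (\<Sum>c\<in>C. Y (wt c))"
    if "p \<in> ?P" "A \<in> ?A" for p A
    using weight_symmetry_comp[OF symmetry_negate_signs[of A] symmetry_permutation[of p]] that
    unfolding weight_symmetry_def by auto
  have "of_nat (card ?P * card ?A) * (\<Sum>c\<in>C. Y (wt c)) = (\<Sum>p\<in>?P. \<Sum>A\<in>?A. \<Sum>c\<in>C. Y (wt c))"
    by simp
  also have "\<dots> = (\<Sum>p\<in>?P. \<Sum>A\<in>?A. \<Sum>c\<in>C. Y (negate_signs A (wt c \<circ> p)))"
    by (rule sum.cong[OF refl], rule sum.cong[OF refl]) (rule inv[symmetric])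
  also have "\<dots> = (\<Sum>p\<in>?P. \<Sum>c\<in>C. \<Sum>A\<in>?A. Y (negate_signs A (wt c \<circ> p)))"
    by (intro sum.cong refl sum.swap)
  also have "\<dots> = (\<Sum>c\<in>C. \<Sum>p\<in>?P. \<Sum>A\<in>?A. Y (negate_signs A (wt c \<circ> p)))"
    by (rule sum.swap)
  also have "\<dots> = (\<Sum>c\<in>C. 0)"
  proof (rule sum.cong[OF refl])
    fix c assume c: "c \<in> C"
    have S: "(\<Sum>s<m. g (wt c (Suc s))) = (\<Sum>x=1..m. g (wt c x))" for g :: "int \<Rightarrow> int"
      by (rule sum.reindex_bij_witness[of _ "\<lambda>x. x - 1" Suc]) auto
    have "injective_sum {1..m} b m (\<lambda>s. wt c (Suc s)) = 0"
    proof (rule injective_sum_zero)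
      fix x k l assume "x \<in> {1..m}"
      then show "b x k * b x l = b x (k + l) + b x (k - l)"
        using y unfolding b_def
        by (simp add: power_int_add power_int_diff power_int_minus field_simps)
    qed (use zero wt[OF c] S[of "\<lambda>x. x"] S[of abs] in \<open>auto simp: b_def\<close>)
    then show "(\<Sum>p\<in>?P. \<Sum>A\<in>?A. Y (negate_signs A (wt c \<circ> p))) = 0"
      using orbit[of "wt c"] by simp
  qed
  finally have "of_nat (card ?P * card ?A) * (\<Sum>c\<in>C. Y (wt c)) = 0" by simp
  moreover have "card ?P \<noteq> 0" "card ?A \<noteq> 0"
    by (auto simp: card_eq_0_iff finite_permutations intro!: exI[of _ id] permutes_id)
  ultimately show ?thesis unfolding Y_def by simp
qed

end

section \<open>Roots of unity\<close>

text \<open>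
  The geometric sum of the odd powers of \<open>\<theta>\<close> with exponents from \<open>1 - 2 * m\<close> to \<open>2 * m - 1\<close>,
  cleared of denominators.
\<close>

lemma odd_power_sum:
  fixes \<theta> :: complex
  assumes "\<theta> \<noteq> 0"
  shows "(\<Sum>x=1..m. \<theta> ^ (2 * x - 1) + inverse \<theta> ^ (2 * x - 1)) * (\<theta>\<^sup>2 - 1) * \<theta> ^ (2 * m)
    = \<theta> * (\<theta> ^ (4 * m) - 1)"
proof (induction m)
  case (Suc m)
  define a where "a = \<theta> ^ (2 * m)"
  define S where "S = (\<Sum>x=1..m. \<theta> ^ (2 * x - 1) + inverse \<theta> ^ (2 * x - 1))"
  define i where "i = inverse \<theta> ^ (2 * m + 1)"
  have i: "i * (\<theta> * a) = 1"
    unfolding i_def a_def using assms by (simp add: power_inverse field_simps)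
  have "4 * m = 2 * m + 2 * m" by simp
  then have a4: "\<theta> ^ (4 * m) = a * a" unfolding a_def by (simp only: power_add)
  have IH: "S * (\<theta>\<^sup>2 - 1) * a = \<theta> * (a * a - 1)" using Suc a4 unfolding S_def a_def by simp
  have "(\<Sum>x=1..Suc m. \<theta> ^ (2 * x - 1) + inverse \<theta> ^ (2 * x - 1)) = S + (\<theta> * a + i)"
    unfolding S_def i_def a_def by simp
  moreover have "\<theta> ^ (2 * Suc m) = \<theta>\<^sup>2 * a" "\<theta> ^ (4 * Suc m) = \<theta> ^ 4 * (a * a)"
    unfolding a4[symmetric] by (simp_all add: a_def power_add[symmetric] add.commute)
  moreover have "(S + (\<theta> * a + i)) * (\<theta>\<^sup>2 - 1) * (\<theta>\<^sup>2 * a) = \<theta> * (\<theta> ^ 4 * (a * a) - 1)"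
    using IH i by algebra
  ultimately show ?case by simp
qed simp

lemma roots_of_unity_power_sum_zero:
  fixes \<eta> :: complex and k :: int
  assumes \<eta>: "\<eta> ^ (4 * m) = 1" "\<eta>\<^sup>2 \<noteq> 1" and m: "m \<ge> 1" and k: "coprime k (2 * int m)"
  shows "(\<Sum>x=1..m. (\<eta> ^ (2 * x - 1)) powi k + (\<eta> ^ (2 * x - 1)) powi (- k)) = 0"
proof -
  define \<theta> where "\<theta> = \<eta> powi k"
  have \<eta>0: "\<eta> \<noteq> 0" using \<eta>(1) m by (auto simp: power_0_left)
  then have \<theta>0: "\<theta> \<noteq> 0" unfolding \<theta>_def by simp
  have term_eq: "(\<eta> ^ j) powi k = \<theta> ^ j" "(\<eta> ^ j) powi (- k) = inverse \<theta> ^ j" for j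
    unfolding \<theta>_def using \<eta>0
    by (simp_all add: power_int_power power_int_power' power_int_minus mult.commute power_inverse)
  have \<theta>1: "\<theta> ^ (4 * m) = 1"
  proof -
    have "\<theta> ^ (4 * m) = (\<eta> ^ (4 * m)) powi k"
      unfolding \<theta>_def by (simp add: power_int_power power_int_power' mult.commute)
    then show ?thesis using \<eta>(1) by simp
  qed
  have \<theta>2: "\<theta>\<^sup>2 \<noteq> 1"
  proof
    assume t: "\<theta>\<^sup>2 = 1"
    obtain u w where uw: "u * k + w * (2 * int m) = 1"
      using k by (metis bezout_int coprime_imp_gcd_eq_1)
    have z1: "(\<eta>\<^sup>2) powi k = 1"
      using t unfolding \<theta>_def by (simp add: power_int_power power_int_power' mult.commute)
    have "(\<eta>\<^sup>2) powi int (2 * m) = \<eta> ^ (4 * m)"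
      unfolding power_int_of_nat by (simp add: power_mult[symmetric])
    then have z2: "(\<eta>\<^sup>2) powi (2 * int m) = 1" using \<eta>(1) by simp
    have "\<eta>\<^sup>2 = (\<eta>\<^sup>2) powi (u * k + w * (2 * int m))" using uw by simp
    also have "\<dots> = (\<eta>\<^sup>2) powi (k * u) * (\<eta>\<^sup>2) powi ((2 * int m) * w)"
      using \<eta>0 by (simp add: power_int_add mult.commute)
    also have "\<dots> = 1"
      unfolding power_int_mult[of _ k] power_int_mult[of _ "2 * int m"] z1 z2 by simp
    finally show False using \<eta>(2) by simp
  qed
  show ?thesis
    using odd_power_sum[OF \<theta>0, of m] \<theta>0 \<theta>1 \<theta>2 unfolding term_eq by simp
qed

text \<open>
  Fourier inversion on the residues modulo \<open>M\<close>.
\<close>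

lemma equidistribution:
  fixes w :: "'c \<Rightarrow> nat"
  assumes S: "finite S" and M: "M > 0"
    and zero: "\<And>\<zeta> :: complex. \<zeta> ^ M = 1 \<Longrightarrow> \<zeta> \<noteq> 1 \<Longrightarrow> (\<Sum>T\<in>S. \<zeta> ^ w T) = 0"
    and k: "k < M"
  shows "M * card {T \<in> S. w T mod M = k} = card S"
proof -
  define \<omega> where "\<omega> = cis (2 * pi / real M)"
  have \<omega>p: "\<omega> ^ j = cis (2 * pi * real j / real M)" for j
    unfolding \<omega>_def by (simp add: DeMoivre mult.commute)
  have inj: "inj_on (\<lambda>j. \<omega> ^ j) {..<M}" and \<omega>M: "\<omega> ^ M = 1"
    using bij_betw_roots_unity[OF M] M unfolding \<omega>p bij_betw_def by auto
  have one: "\<omega> ^ j = 1 \<longleftrightarrow> M dvd j" for j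
  proof -
    have "\<omega> ^ j = \<omega> ^ (M * (j div M) + j mod M)" by simp
    also have "\<dots> = \<omega> ^ (j mod M)" by (simp only: power_add power_mult \<omega>M) simp
    finally have "\<omega> ^ j = 1 \<longleftrightarrow> \<omega> ^ (j mod M) = \<omega> ^ 0" by simp
    also have "\<dots> \<longleftrightarrow> j mod M = 0" using inj_on_eq_iff[OF inj, of "j mod M" 0] M by simp
    finally show ?thesis by (simp add: dvd_eq_mod_eq_0)
  qed
  \<comment> \<open>The exponent \<open>M - k\<close> stands for \<open>- k\<close>, since \<open>\<omega> ^ M = 1\<close>.\<close>
  have inner: "(\<Sum>j<M. (\<omega> ^ j) ^ (w T + (M - k))) = (if w T mod M = k then of_nat M else 0)" for T
  proof -
    let ?e = "w T + (M - k)"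
    have iff: "M dvd ?e \<longleftrightarrow> w T mod M = k"
    proof -
      have "[w T + (M - k) + k = w T + M] (mod M)" using k by simp
      then have "[w T + (M - k) + k = w T] (mod M)" by (simp add: cong_def)
      then show ?thesis using k
        by (metis (no_types, lifting) add_0 cong_def cong_add_rcancel_nat cong_0_iff mod_less)
    qed
    have sw: "(\<omega> ^ j) ^ ?e = (\<omega> ^ ?e) ^ j" for j by (simp only: power_mult[symmetric] mult.commute)
    show ?thesis
    proof (cases "w T mod M = k")
      case True
      then have "\<omega> ^ ?e = 1" using iff one by blast
      then show ?thesis using True unfolding sw by simp
    next
      case False
      then have "\<omega> ^ ?e \<noteq> 1" using iff one by blast
      moreover have "(\<omega> ^ ?e) ^ M = 1" by (metis \<omega>M power_mult mult.commute power_one)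
      ultimately show ?thesis using False unfolding sw by (simp add: geometric_sum)
    qed
  qed
  have "of_nat (M * card {T \<in> S. w T mod M = k}) = (\<Sum>T\<in>S. if w T mod M = k then of_nat M else (0 :: complex))"
    using S by (simp add: sum.If_cases Int_def mult.commute)
  also have "\<dots> = (\<Sum>j<M. \<Sum>T\<in>S. (\<omega> ^ j) ^ (w T + (M - k)))"
    unfolding inner[symmetric] by (rule sum.swap)
  also have "\<dots> = (\<Sum>j<M. if j = 0 then of_nat (card S) else 0)"
  proof (rule sum.cong[OF refl])
    fix j assume j: "j \<in> {..<M}"
    show "(\<Sum>T\<in>S. (\<omega> ^ j) ^ (w T + (M - k))) = (if j = 0 then of_nat (card S) else 0)"
    proof (cases "j = 0")
      case False
      have "\<not> M dvd j" using j False by (auto dest: dvd_imp_le)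
      then have ne: "\<omega> ^ j \<noteq> 1" using one by blast
      have "(\<omega> ^ j) ^ M = 1" by (metis \<omega>M power_mult mult.commute power_one)
      from zero[OF this ne] show ?thesis
        using False by (simp add: power_add sum_distrib_right[symmetric])
    qed simp
  qed
  also have "\<dots> = of_nat (card S)" using M by simp
  finally show ?thesis using of_nat_eq_iff by blast
qed

lemma cong_monom_mod:
  "[monom (1 :: rat) p = monom 1 (p mod M)] (mod (monom 1 M - 1))"
proof -
  have "[monom (1 :: rat) M = 1] (mod (monom 1 M - 1))"
    by (simp add: cong_iff_dvd_diff)
  from cong_mult[OF cong_pow[OF this, of "p div M"] cong_refl[of "monom 1 (p mod M)"]]
  show ?thesis by (simp add: monom_power mult_monom)
qed

lemma smult_sum_right: "smult c (\<Sum>k\<in>A. f k) = (\<Sum>k\<in>A. smult c (f k))"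
  by (induction A rule: infinite_finite_induct) (simp_all add: smult_add_right)

lemma uniform_polynomial_cong:
  fixes w :: "'c \<Rightarrow> nat"
  assumes S: "finite S" and M: "M > 0"
    and zero: "\<And>\<zeta> :: complex. \<zeta> ^ M = 1 \<Longrightarrow> \<zeta> \<noteq> 1 \<Longrightarrow> (\<Sum>T\<in>S. \<zeta> ^ w T) = 0"
  shows "[(\<Sum>T\<in>S. monom 1 (w T)) =
      smult (of_nat (card S) / of_nat M) (\<Sum>k = 0..M - 1. monom (1 :: rat) k)] (mod (monom 1 M - 1))"
proof -
  have "[(\<Sum>T\<in>S. monom (1 :: rat) (w T)) = (\<Sum>T\<in>S. monom 1 (w T mod M))] (mod (monom 1 M - 1))"
    by (intro cong_sum cong_monom_mod)
  also have "(\<Sum>T\<in>S. monom (1 :: rat) (w T mod M))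
      = (\<Sum>k\<in>{0..M - 1}. \<Sum>T\<in>{T \<in> S. w T mod M = k}. monom 1 (w T mod M))"
    using S M by (intro sum.group[symmetric]) (auto simp: less_Suc_eq_le[symmetric])
  also have "\<dots> = (\<Sum>k\<in>{0..M - 1}. smult (of_nat (card S) / of_nat M) (monom 1 k))"
  proof (rule sum.cong[OF refl])
    fix k assume "k \<in> {0..M - 1}"
    then have "k < M" using M by auto
    from arg_cong[OF equidistribution[OF S M zero this], of "of_nat :: nat \<Rightarrow> rat"]
    have "(of_nat (card {T \<in> S. w T mod M = k}) :: rat) = of_nat (card S) / of_nat M"
      using M by (simp add: field_simps)
    then show "(\<Sum>T\<in>{T \<in> S. w T mod M = k}. monom 1 (w T mod M))
        = smult (of_nat (card S) / of_nat M) (monom (1 :: rat) k)"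
      by (simp add: smult_monom of_nat_monom mult_monom)
  qed
  also have "\<dots> = smult (of_nat (card S) / of_nat M) (\<Sum>k = 0..M - 1. monom 1 k)"
    by (rule smult_sum_right[symmetric])
  finally show ?thesis .
qed

section \<open>Comparing neighbouring columns\<close>

text \<open>
  The number of elements of \<open>A\<close> that are at most \<open>a\<close>.
\<close>

definition count_le :: "'a::linorder set \<Rightarrow> 'a \<Rightarrow> nat" where
  "count_le A a = card {b \<in> A. b \<le> a}"

lemma nth_le_iff_count_le:
  assumes xs: "sorted_wrt (<) xs" and p: "p < length xs"
  shows "xs ! p \<le> a \<longleftrightarrow> p < count_le (set xs) a"
proof -
  have d: "distinct xs" using xs strict_sorted_iff by auto
  have mono: "xs ! i \<le> xs ! j" if "i \<le> j" "j < length xs" for i j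
    using that xs strict_sorted_iff sorted_nth_mono by blast
  have "{b \<in> set xs. b \<le> a} = (!) xs ` {i. i < length xs \<and> xs ! i \<le> a}"
    by (auto simp: in_set_conv_nth)
  moreover have "inj_on ((!) xs) {i. i < length xs \<and> xs ! i \<le> a}"
    using d by (auto simp: inj_on_def nth_eq_iff_index_eq)
  ultimately have c: "count_le (set xs) a = card {i. i < length xs \<and> xs ! i \<le> a}"
    unfolding count_le_def by (simp add: card_image)
  show ?thesis
  proof
    assume "xs ! p \<le> a"
    then have "{..p} \<subseteq> {i. i < length xs \<and> xs ! i \<le> a}"
      using mono[of _ p] p by (auto intro: order_trans)
    from card_mono[OF _ this] show "p < count_le (set xs) a" unfolding c by simp
  next
    assume *: "p < count_le (set xs) a"
    show "xs ! p \<le> a"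
    proof (rule ccontr)
      assume "\<not> xs ! p \<le> a"
      then have "{i. i < length xs \<and> xs ! i \<le> a} \<subseteq> {..<p}"
        using mono[of p] by (auto simp: not_le) (metis linorder_not_le order_less_le_trans leD)
      from card_mono[OF _ this] show False using * unfolding c by simp
    qed
  qed
qed

lemma count_le_bound: "sorted_wrt (<) xs \<Longrightarrow> count_le (set xs) a \<le> length xs"
  unfolding count_le_def
  by (metis (no_types, lifting) List.finite_set card_length card_mono le_trans mem_Collect_eq subsetI)

text \<open>
  Two adjacent strictly increasing columns \<open>xs\<close> (rows \<open>lo\<close> to \<open>hi - 1\<close>) and \<open>ys\<close> (rows \<open>lo'\<close> to
  \<open>hi' - 1\<close>) of a skew shape increase weakly along their common rows if and only if, for every
  \<open>a\<close>, the entries that are at most \<open>a\<close> end no lower in \<open>ys\<close> than in \<open>xs\<close>.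
\<close>

lemma rowwise_le_iff:
  fixes xs ys :: "'a::linorder list"
  assumes xs: "sorted_wrt (<) xs" "lo + length xs = hi" and ys: "sorted_wrt (<) ys" "lo' + length ys = hi'"
    and le: "lo' \<le> lo" "hi' \<le> hi"
  shows "(\<forall>i. lo \<le> i \<and> i < hi' \<longrightarrow> xs ! (i - lo) \<le> ys ! (i - lo')) \<longleftrightarrow>
    (\<forall>a. lo' + count_le (set ys) a \<le> lo + count_le (set xs) a)"
proof (intro iffI allI impI)
  fix a assume rows: "\<forall>i. lo \<le> i \<and> i < hi' \<longrightarrow> xs ! (i - lo) \<le> ys ! (i - lo')"
  show "lo' + count_le (set ys) a \<le> lo + count_le (set xs) a"
  proof (rule ccontr)
    assume c: "\<not> ?thesis"
    define i where "i = lo' + count_le (set ys) a - 1"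
    have i: "lo \<le> i" "i < hi'" "i - lo' < count_le (set ys) a" "i - lo' < length ys"
      using c count_le_bound[OF ys(1), of a] ys(2) le unfolding i_def by auto
    have "ys ! (i - lo') \<le> a" using nth_le_iff_count_le[OF ys(1) i(4)] i(3) by simp
    then have "xs ! (i - lo) \<le> a" using rows i order_trans by blast
    then have "i - lo < count_le (set xs) a"
      using nth_le_iff_count_le[OF xs(1), of "i - lo"] i le xs(2) by auto
    then show False using c i unfolding i_def by linarith
  qed
next
  fix i assume cnt: "\<forall>a. lo' + count_le (set ys) a \<le> lo + count_le (set xs) a"
    and i: "lo \<le> i \<and> i < hi'"
  have "i - lo' < count_le (set ys) (ys ! (i - lo'))"
    using nth_le_iff_count_le[OF ys(1), of "i - lo'" "ys ! (i - lo')"] i le ys(2) by auto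
  then have "i - lo < count_le (set xs) (ys ! (i - lo'))"
    using cnt[rule_format, of "ys ! (i - lo')"] i le by linarith
  then show "xs ! (i - lo) \<le> ys ! (i - lo')"
    using nth_le_iff_count_le[OF xs(1), of "i - lo"] i le xs(2) by auto
qed

text \<open>
  The set of letters of the column that a sign vector encodes.
\<close>

definition signed_letters :: "nat \<Rightarrow> (nat \<Rightarrow> int) \<Rightarrow> letter set" where
  "signed_letters m e = Unb ` {x \<in> {1..m}. e x = 1} \<union> Bar ` {x \<in> {1..m}. e x = -1}"

lemma npos_card: "npos e x = int (card {y \<in> {1..x}. e y = 1})"
  and nneg_card: "nneg e x = int (card {y \<in> {1..x}. e y = -1})"
  unfolding npos_def nneg_def by (simp_all add: of_bool_def sum.If_cases Int_def)

lemma inj_letters [simp]: "inj_on Unb A" "inj_on Bar A"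
  by (auto simp: inj_on_def)

lemma le_letter [simp]:
  "Unb i \<le> Unb j \<longleftrightarrow> i \<le> j" "Unb i \<le> Bar j" "\<not> Bar i \<le> Unb j" "Bar i \<le> Bar j \<longleftrightarrow> j \<le> i"
  by (auto simp: less_eq_letter_def)

lemma count_le_Unb: "int (count_le (signed_letters m e) (Unb x)) = npos e (min x m)"
proof -
  have "{b \<in> signed_letters m e. b \<le> Unb x} = Unb ` {y \<in> {1..min x m}. e y = 1}"
    unfolding signed_letters_def by auto
  then show ?thesis unfolding count_le_def npos_card by (simp add: card_image)
qed

lemma card_signed_letters: "int (card (signed_letters m e)) = npos e m + nneg e m"
  unfolding signed_letters_def npos_card nneg_card
  by (subst card_Un_disjoint) (auto simp: card_image)

text \<open>
  As natural subtraction truncates, \<open>Bar 0\<close>, which exceeds all letters of the alphabet, is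
  covered.
\<close>

lemma count_le_Bar:
  "int (count_le (signed_letters m e) (Bar x)) = npos e m + nneg e m - nneg e (min (x - 1) m)"
proof -
  let ?N = "{y \<in> {1..min (x - 1) m}. e y = -1}"
  have "{b \<in> signed_letters m e. b \<le> Bar x} = signed_letters m e - Bar ` ?N"
    unfolding signed_letters_def by auto
  moreover have "Bar ` ?N \<subseteq> signed_letters m e" unfolding signed_letters_def by auto
  moreover from this have "card (Bar ` ?N) \<le> card (signed_letters m e)"
    by (rule card_mono[rotated]) (auto simp: signed_letters_def)
  ultimately have "int (count_le (signed_letters m e) (Bar x)) =
      int (card (signed_letters m e)) - int (card (Bar ` ?N))"
    unfolding count_le_def by (simp add: card_Diff_subset of_nat_diff)
  then show ?thesis unfolding card_signed_letters nneg_card by (simp add: card_image)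
qed

lemma count_le_iff_heights:
  assumes "npos e m + nneg e m = hi - lo" "npos e' m + nneg e' m = hi' - lo'"
  shows "(\<forall>a. lo' + int (count_le (signed_letters m e') a) \<le> lo + int (count_le (signed_letters m e) a)) \<longleftrightarrow>
    (\<forall>x\<le>m. lo' + npos e' x \<le> lo + npos e x \<and> hi' - nneg e' x \<le> hi - nneg e x)"
    (is "?L \<longleftrightarrow> ?R")
proof
  assume L: ?L
  show ?R
  proof (intro allI impI)
    fix x assume "x \<le> m"
    then show "lo' + npos e' x \<le> lo + npos e x \<and> hi' - nneg e' x \<le> hi - nneg e x"
      using L[rule_format, of "Unb x"] L[rule_format, of "Bar (Suc x)"] assms
      unfolding count_le_Unb count_le_Bar by (simp add: min_absorb1)
  qed
next
  assume R: ?R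
  show ?L
  proof
    fix a
    show "lo' + int (count_le (signed_letters m e') a) \<le> lo + int (count_le (signed_letters m e) a)"
    proof (cases a)
      case (Unb x)
      then show ?thesis using R[rule_format, of "min x m"] unfolding Unb count_le_Unb by simp
    next
      case (Bar x)
      then show ?thesis using R[rule_format, of "min (x - 1) m"] assms unfolding Bar count_le_Bar by simp
    qed
  qed
qed

section \<open>The splitting of an admissible column\<close>

lemma decreasing_rev_sorted_list:
  assumes "finite A"
  defines "l \<equiv> rev (sorted_list_of_set A)"
  shows "set l = A" "distinct l" "length l = card A"
    and "i < j \<Longrightarrow> j < length l \<Longrightarrow> l ! j < l ! i"
proof -
  show "set l = A" "distinct l" "length l = card A" using assms by auto
  assume "i < j" "j < length l"
  moreover have "sorted_wrt (>) l" unfolding l_def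
    using strict_sorted_list_of_set[of A] by (simp add: sorted_wrt_rev)
  ultimately show "l ! j < l ! i" using sorted_wrt_nth_less by blast
qed

lemma sum_of_bool_set_nth:
  fixes l :: "nat list"
  assumes "distinct l" "set l \<subseteq> {1..}"
  shows "(\<Sum>y=1..x. of_bool (y \<in> set l)) = int (card {i. i < length l \<and> l ! i \<le> x})"
proof -
  have "(\<Sum>y=1..x. of_bool (y \<in> set l)) = int (card {y \<in> set l. y \<le> x})"
  proof -
    have "{1..x} \<inter> set l = {y \<in> set l. y \<le> x}" using assms by auto
    then show ?thesis by (simp add: of_bool_def sum.If_cases)
  qed
  moreover have "{y \<in> set l. y \<le> x} = (!) l ` {i. i < length l \<and> l ! i \<le> x}"
    by (auto simp: in_set_conv_nth)
  moreover have "inj_on ((!) l) {i. i < length l \<and> l ! i \<le> x}"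
    using assms by (auto simp: inj_on_def nth_eq_iff_index_eq)
  ultimately show ?thesis by (simp add: card_image)
qed

text \<open>
  The indices of the unbarred and of the barred letters in a column.
\<close>

definition unb_part :: "letter list \<Rightarrow> nat set" where "unb_part C = {x. Unb x \<in> set C}"
definition bar_part :: "letter list \<Rightarrow> nat set" where "bar_part C = {x. Bar x \<in> set C}"

lemma parts_subset:
  assumes "is_column m C"
  shows "unb_part C \<subseteq> {1..m}" "bar_part C \<subseteq> {1..m}"
  using assms unfolding is_column_def alphabet_def unb_part_def bar_part_def by auto

lemma set_column_parts: "set C = Unb ` unb_part C \<union> Bar ` bar_part C"
proof -
  have "x \<in> set C \<longleftrightarrow> x \<in> Unb ` unb_part C \<union> Bar ` bar_part C" for x
    by (cases x) (auto simp: unb_part_def bar_part_def)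
  then show ?thesis by blast
qed

lemma paired_letters_parts:
  assumes "is_column m C"
  shows "set (paired_letters C) = unb_part C \<inter> bar_part C" "distinct (paired_letters C)"
    "i < j \<Longrightarrow> j < length (paired_letters C) \<Longrightarrow> paired_letters C ! j < paired_letters C ! i"
proof -
  have eq: "{z. Unb z \<in> set C \<and> Bar z \<in> set C} = unb_part C \<inter> bar_part C"
    unfolding unb_part_def bar_part_def by auto
  have fin: "finite (unb_part C \<inter> bar_part C)" using parts_subset[OF assms] by (auto intro: finite_subset)
  note d = decreasing_rev_sorted_list[OF fin]
  show "set (paired_letters C) = unb_part C \<inter> bar_part C" "distinct (paired_letters C)"
    "i < j \<Longrightarrow> j < length (paired_letters C) \<Longrightarrow> paired_letters C ! j < paired_letters C ! i"
    unfolding paired_letters_def eq using d by blast+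
qed

lemma is_splittingD:
  assumes "is_splitting m C ts"
  shows "length ts = length (paired_letters C)"
    and "i < length ts \<Longrightarrow> ts ! i < paired_letters C ! i \<and> ts ! i \<in> {1..m} \<and>
      ts ! i \<notin> unb_part C \<and> ts ! i \<notin> bar_part C"
    and "Suc i < length ts \<Longrightarrow> ts ! Suc i < ts ! i"
    and "i < length ts \<Longrightarrow> x \<in> {1..m} \<Longrightarrow> x \<notin> unb_part C \<Longrightarrow> x \<notin> bar_part C \<Longrightarrow>
      x < paired_letters C ! i \<Longrightarrow> (i = 0 \<or> x < ts ! (i - 1)) \<Longrightarrow> x \<le> ts ! i"
proof -
  let ?b = "\<lambda>i. if i = 0 then paired_letters C ! 0 else min (ts ! (i - 1)) (paired_letters C ! i)"
  show l: "length ts = length (paired_letters C)"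
    using assms unfolding is_splitting_def Let_def by simp
  have g: "is_greatest_in (ts ! i) (unused_below m C (?b i))" if "i < length ts" for i
    using assms that l unfolding is_splitting_def Let_def by metis
  show "i < length ts \<Longrightarrow> ts ! i < paired_letters C ! i \<and> ts ! i \<in> {1..m} \<and>
      ts ! i \<notin> unb_part C \<and> ts ! i \<notin> bar_part C"
    using g[of i] unfolding is_greatest_in_def unused_below_def unb_part_def bar_part_def
    by (auto split: if_splits)
  show "Suc i < length ts \<Longrightarrow> ts ! Suc i < ts ! i"
    using g[of "Suc i"] unfolding is_greatest_in_def unused_below_def by auto
  show "i < length ts \<Longrightarrow> x \<in> {1..m} \<Longrightarrow> x \<notin> unb_part C \<Longrightarrow> x \<notin> bar_part C \<Longrightarrow>
      x < paired_letters C ! i \<Longrightarrow> (i = 0 \<or> x < ts ! (i - 1)) \<Longrightarrow> x \<le> ts ! i"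
    using g[of i] unfolding is_greatest_in_def unused_below_def unb_part_def bar_part_def
    by (auto split: if_splits)
qed

lemma is_greatest_in_unique: "is_greatest_in t A \<Longrightarrow> is_greatest_in s A \<Longrightarrow> t = s"
  unfolding is_greatest_in_def by (auto intro: order_antisym)

lemma is_splitting_unique:
  assumes "is_splitting m C ts" "is_splitting m C ts'"
  shows "ts = ts'"
proof (rule nth_equalityI)
  let ?b = "\<lambda>ts i. if i = 0 then paired_letters C ! 0 else min (ts ! (i - 1)) (paired_letters C ! i)"
  show l: "length ts = length ts'" using assms[THEN is_splittingD(1)] by simp
  have g: "is_greatest_in (ts ! i) (unused_below m C (?b ts i))"
      "is_greatest_in (ts' ! i) (unused_below m C (?b ts' i))" if "i < length ts" for i
    using assms that l is_splittingD(1)[OF assms(1)] unfolding is_splitting_def Let_def by metis+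
  show "ts ! i = ts' ! i" if "i < length ts" for i
    using that
  proof (induction i)
    case 0
    then show ?case using is_greatest_in_unique g[of 0] by simp
  next
    case (Suc i)
    then have eq: "?b ts (Suc i) = ?b ts' (Suc i)" by simp
    show ?case
      by (rule is_greatest_in_unique[OF g(1)[OF Suc.prems]]) (subst eq, rule g(2)[OF Suc.prems])
  qed
qed

lemma splitting_eq: "is_splitting m C ts \<Longrightarrow> splitting m C = ts"
  unfolding splitting_def using is_splitting_unique by blast

context
  fixes m :: nat and C :: "letter list" and ts :: "nat list"
  assumes C: "is_column m C" and ts: "is_splitting m C ts"
begin

lemma ts_decreasing: "i < j \<Longrightarrow> j < length ts \<Longrightarrow> ts ! j < ts ! i"
proof (induction j)
  case (Suc j)
  then show ?case using is_splittingD(3)[OF ts, of j] by (cases "i = j") auto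
qed simp

lemma ts_props:
  "distinct ts" "set ts \<subseteq> {1..m}" "set ts \<inter> unb_part C = {}" "set ts \<inter> bar_part C = {}"
proof -
  show "distinct ts" unfolding distinct_conv_nth
    using ts_decreasing by (metis less_irrefl nat_neq_iff)
  show "set ts \<subseteq> {1..m}" "set ts \<inter> unb_part C = {}" "set ts \<inter> bar_part C = {}"
    using is_splittingD(2)[OF ts] by (auto simp: in_set_conv_nth)
qed

lemma replacement_outside:
  "x \<notin> unb_part C \<inter> bar_part C \<Longrightarrow> replacement m C x = x"
  unfolding replacement_def splitting_eq[OF ts] using paired_letters_parts(1)[OF C]
  by (auto split: option.split dest!: map_of_SomeD set_zip_leftD)

lemma replacement_nth:
  "i < length ts \<Longrightarrow> replacement m C (paired_letters C ! i) = ts ! i"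
  unfolding replacement_def splitting_eq[OF ts]
  using map_of_zip_nth[of "paired_letters C" ts i] paired_letters_parts(2)[OF C] is_splittingD(1)[OF ts]
  by simp

lemma replacement_paired: "replacement m C ` (unb_part C \<inter> bar_part C) = set ts"
proof -
  have "unb_part C \<inter> bar_part C = (!) (paired_letters C) ` {..<length ts}"
    unfolding paired_letters_parts(1)[OF C, symmetric] is_splittingD(1)[OF ts]
    by (auto simp: in_set_conv_nth)
  moreover have "set ts = (!) ts ` {..<length ts}" by (auto simp: in_set_conv_nth)
  ultimately show ?thesis using replacement_nth by (auto simp: image_image)
qed

lemma replacement_image:
  assumes "unb_part C \<inter> bar_part C \<subseteq> A"
  shows "replacement m C ` A = (A - (unb_part C \<inter> bar_part C)) \<union> set ts"
proof -
  let ?Z = "unb_part C \<inter> bar_part C"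
  have "replacement m C ` A = replacement m C ` (A - ?Z) \<union> replacement m C ` ?Z"
    using assms by (metis Un_Diff_cancel2 image_Un sup.absorb_iff1 sup_commute)
  moreover have "replacement m C ` (A - ?Z) = id ` (A - ?Z)"
    using replacement_outside by (intro image_cong) auto
  ultimately show ?thesis unfolding replacement_paired by simp
qed

lemma replacement_inj:
  assumes "A = unb_part C \<or> A = bar_part C"
  shows "inj_on (replacement m C) A"
proof (rule eq_card_imp_inj_on)
  let ?Z = "unb_part C \<inter> bar_part C"
  show fin: "finite A" using assms parts_subset[OF C] by (auto intro: finite_subset)
  have sub: "?Z \<subseteq> A" using assms by auto
  have "card (set ts) = card ?Z"
    unfolding paired_letters_parts(1)[OF C, symmetric]
    using ts_props(1) paired_letters_parts(2)[OF C] is_splittingD(1)[OF ts] by (simp add: distinct_card)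
  moreover have "(A - ?Z) \<inter> set ts = {}" using assms ts_props(3,4) by auto
  ultimately show "card (replacement m C ` A) = card A"
    unfolding replacement_image[OF sub] using fin sub finite_subset[OF sub fin]
    by (simp add: card_Un_disjoint card_Diff_subset card_mono)
qed

lemma C_distinct: "distinct C"
  using C unfolding is_column_def strict_sorted_iff by auto

lemma left_column_props:
  "set (left_column m C) = Unb ` ((unb_part C - bar_part C) \<union> set ts) \<union> Bar ` bar_part C"
  "sorted_wrt (<) (left_column m C)" "length (left_column m C) = length C"
proof -
  let ?g = "\<lambda>a. case a of Unb x \<Rightarrow> Unb (replacement m C x) | Bar x \<Rightarrow> Bar x"
  have "?g ` set C = Unb ` (replacement m C ` unb_part C) \<union> Bar ` bar_part C"
    unfolding set_column_parts[of C] by (auto simp: image_Un image_image)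
  also have "replacement m C ` unb_part C = (unb_part C - bar_part C) \<union> set ts"
    using replacement_image[of "unb_part C"] by auto
  finally show "set (left_column m C) = Unb ` ((unb_part C - bar_part C) \<union> set ts) \<union> Bar ` bar_part C"
    unfolding left_column_def by simp
  have inj: "inj_on (replacement m C) (unb_part C)" by (rule replacement_inj) simp
  have "inj_on ?g (set C)"
  proof (rule inj_onI)
    fix a b assume ab: "a \<in> set C" "b \<in> set C" "?g a = ?g b"
    show "a = b"
    proof (cases a; cases b)
    qed (use ab in \<open>auto simp: unb_part_def dest: inj_onD[OF inj]\<close>)
  qed
  then have "distinct (map ?g C)" using C_distinct by (simp add: distinct_map)
  then show "sorted_wrt (<) (left_column m C)" unfolding strict_sorted_iff left_column_def by simp
  show "length (left_column m C) = length C" unfolding left_column_def by simp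
qed

lemma right_column_props:
  "set (right_column m C) = Unb ` unb_part C \<union> Bar ` ((bar_part C - unb_part C) \<union> set ts)"
  "sorted_wrt (<) (right_column m C)" "length (right_column m C) = length C"
proof -
  let ?g = "\<lambda>a. case a of Unb x \<Rightarrow> Unb x | Bar x \<Rightarrow> Bar (replacement m C x)"
  have "?g ` set C = Unb ` unb_part C \<union> Bar ` (replacement m C ` bar_part C)"
    unfolding set_column_parts[of C] by (auto simp: image_Un image_image)
  also have "replacement m C ` bar_part C = (bar_part C - unb_part C) \<union> set ts"
    using replacement_image[of "bar_part C"] by auto
  finally show "set (right_column m C) = Unb ` unb_part C \<union> Bar ` ((bar_part C - unb_part C) \<union> set ts)"
    unfolding right_column_def by simp
  have inj: "inj_on (replacement m C) (bar_part C)" by (rule replacement_inj) simp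
  have "inj_on ?g (set C)"
  proof (rule inj_onI)
    fix a b assume ab: "a \<in> set C" "b \<in> set C" "?g a = ?g b"
    show "a = b"
    proof (cases a; cases b)
    qed (use ab in \<open>auto simp: bar_part_def dest: inj_onD[OF inj]\<close>)
  qed
  then have "distinct (map ?g C)" using C_distinct by (simp add: distinct_map)
  then show "sorted_wrt (<) (right_column m C)" unfolding strict_sorted_iff right_column_def by simp
  show "length (right_column m C) = length C" unfolding right_column_def by simp
qed

text \<open>
  The greedy choice leaves no unused letter \<open>x\<close> strictly between \<open>t\<^sub>i\<close> and \<open>z\<^sub>i\<close>: such an \<open>x\<close>
  would have been preferred to \<open>t\<^sub>i\<close>, unless \<open>t\<^sub>i\<^sub>-\<^sub>1 < x\<close>, in which case \<open>x\<close> lies between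
  \<open>t\<^sub>i\<^sub>-\<^sub>1\<close> and \<open>z\<^sub>i\<^sub>-\<^sub>1\<close> as well.
\<close>

lemma greedy_gap:
  assumes x: "x \<in> {1..m}" "x \<notin> unb_part C" "x \<notin> bar_part C" "x \<notin> set ts" and i: "i < length ts"
    and "ts ! i < x"
  shows "paired_letters C ! i \<le> x"
  using i assms(6)
proof (induction i)
  case 0
  then show ?case using is_splittingD(4)[OF ts, of 0 x] x by force
next
  case (Suc i)
  show ?case
  proof (rule ccontr)
    assume c: "\<not> ?thesis"
    have "\<not> x < ts ! i"
      using is_splittingD(4)[OF ts Suc.prems(1) x(1-3)] c Suc.prems(2) by auto
    moreover have "x \<noteq> ts ! i" using x(4) Suc.prems(1) by auto
    ultimately have "paired_letters C ! i \<le> x" using Suc.IH Suc.prems(1) by simp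
    moreover have "paired_letters C ! Suc i < paired_letters C ! i"
      using paired_letters_parts(3)[OF C, of i "Suc i"] Suc.prems(1) is_splittingD(1)[OF ts] by simp
    ultimately show False using c by simp
  qed
qed

end

text \<open>
  The sign vector of a set of letters. It determines the set if no letter occurs with its barred
  version.
\<close>

definition sign_vector_of :: "letter set \<Rightarrow> nat \<Rightarrow> int" where
  "sign_vector_of L x = (if Unb x \<in> L then 1 else if Bar x \<in> L then -1 else 0)"

lemma signed_letters_sign_vector_of:
  assumes "A \<subseteq> {1..m}" "B \<subseteq> {1..m}" "A \<inter> B = {}"
  shows "signed_letters m (sign_vector_of (Unb ` A \<union> Bar ` B)) = Unb ` A \<union> Bar ` B"
    "is_sign_vector m (sign_vector_of (Unb ` A \<union> Bar ` B))"
proof -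
  have v: "sign_vector_of (Unb ` A \<union> Bar ` B) = (\<lambda>x. if x \<in> A then 1 else if x \<in> B then -1 else 0)"
    unfolding sign_vector_of_def by auto
  have "{x \<in> {1..m}. (if x \<in> A then 1 else if x \<in> B then -1 else 0) = (1 :: int)} = A"
    "{x \<in> {1..m}. (if x \<in> A then 1 else if x \<in> B then -1 else 0) = (-1 :: int)} = B"
    using assms by auto
  then show "signed_letters m (sign_vector_of (Unb ` A \<union> Bar ` B)) = Unb ` A \<union> Bar ` B"
    unfolding signed_letters_def v by simp
  show "is_sign_vector m (sign_vector_of (Unb ` A \<union> Bar ` B))"
    using assms unfolding is_sign_vector_def v by auto
qed

lemma admissible_split_pair:
  assumes "admissible m C"
  defines "e \<equiv> sign_vector_of (set (left_column m C))"
    and "f \<equiv> sign_vector_of (set (right_column m C))"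
  shows "is_sign_vector m e" "is_sign_vector m f" "split_pair m e f"
    and "signed_letters m e = set (left_column m C)" "signed_letters m f = set (right_column m C)"
    and "\<And>x. f x = 1 \<longleftrightarrow> Unb x \<in> set C" "\<And>x. e x = -1 \<longleftrightarrow> Bar x \<in> set C"
    and "sorted_wrt (<) (left_column m C)" "sorted_wrt (<) (right_column m C)"
    and "length (left_column m C) = length C" "length (right_column m C) = length C"
proof -
  obtain ts where C: "is_column m C" and ts: "is_splitting m C ts"
    using assms(1) unfolding admissible_def by auto
  let ?U = "unb_part C" and ?B = "bar_part C" and ?T = "set ts" and ?zs = "paired_letters C"
  note P = parts_subset[OF C] and T = ts_props[OF C ts]
  note L = left_column_props[OF C ts] and R = right_column_props[OF C ts]
  have A: "(?U - ?B) \<union> ?T \<subseteq> {1..m}" "((?U - ?B) \<union> ?T) \<inter> ?B = {}"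
    "(?B - ?U) \<union> ?T \<subseteq> {1..m}" "?U \<inter> ((?B - ?U) \<union> ?T) = {}"
    using P T by auto
  note sl = signed_letters_sign_vector_of[OF A(1) P(2) A(2)]
    and sr = signed_letters_sign_vector_of[OF P(1) A(3,4)]
  show e: "is_sign_vector m e" and "signed_letters m e = set (left_column m C)"
    unfolding e_def L(1) using sl by auto
  show f: "is_sign_vector m f" and "signed_letters m f = set (right_column m C)"
    unfolding f_def R(1) using sr by auto
  show "sorted_wrt (<) (left_column m C)" "sorted_wrt (<) (right_column m C)"
    "length (left_column m C) = length C" "length (right_column m C) = length C"
    using L R by auto
  have ev: "e x = (if x \<in> (?U - ?B) \<union> ?T then 1 else if x \<in> ?B then -1 else 0)" for x
    unfolding e_def L(1) sign_vector_of_def by auto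
  have fv: "f x = (if x \<in> ?U then 1 else if x \<in> (?B - ?U) \<union> ?T then -1 else 0)" for x
    unfolding f_def R(1) sign_vector_of_def by auto
  show "f x = 1 \<longleftrightarrow> Unb x \<in> set C" for x unfolding fv unb_part_def by auto
  show "e x = -1 \<longleftrightarrow> Bar x \<in> set C" for x
    unfolding ev using T(4) unfolding unb_part_def bar_part_def by auto
  have len: "length ts = length ?zs" using is_splittingD(1)[OF ts] .
  \<comment> \<open>The difference counts the \<open>t\<^sub>i\<close> that are at most \<open>x\<close> minus the \<open>z\<^sub>i\<close> that are at most \<open>x\<close>.\<close>
  have diff: "npos e x - npos f x
      = int (card {i. i < length ts \<and> ts ! i \<le> x}) - int (card {i. i < length ts \<and> ?zs ! i \<le> x})" for x
  proof -
    have "npos e x - npos f x = (\<Sum>y=1..x. of_bool (y \<in> ?T) - of_bool (y \<in> set ?zs))"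
      unfolding npos_def sum_subtractf[symmetric] paired_letters_parts(1)[OF C]
      by (intro sum.cong refl) (use T(3,4) in \<open>auto simp: ev fv\<close>)
    also have "\<dots> = int (card {i. i < length ts \<and> ts ! i \<le> x}) - int (card {i. i < length ?zs \<and> ?zs ! i \<le> x})"
      unfolding sum_subtractf
      using T(1,2) P paired_letters_parts(1,2)[OF C]
      by (subst (1 2) sum_of_bool_set_nth) auto
    finally show ?thesis using len by simp
  qed
  have lt: "ts ! i < ?zs ! i" if "i < length ts" for i using is_splittingD(2)[OF ts that] by simp
  show "split_pair m e f"
    unfolding split_pair_def
  proof (intro conjI ballI allI impI)
    fix x assume "x \<in> {1..m}"
    show "e x = 0 \<longleftrightarrow> f x = 0" unfolding ev fv by auto
  next
    fix x assume "x \<le> m"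
    have "{i. i < length ts \<and> ?zs ! i \<le> x} \<subseteq> {i. i < length ts \<and> ts ! i \<le> x}"
      using lt by force
    then have "card {i. i < length ts \<and> ?zs ! i \<le> x} \<le> card {i. i < length ts \<and> ts ! i \<le> x}"
      by (intro card_mono) auto
    then show "npos f x \<le> npos e x" using diff[of x] by linarith
  next
    have "?zs ! i \<le> m" if "i < length ts" for i
      using paired_letters_parts(1)[OF C] P len that nth_mem[of i ?zs] by auto
    then have "{i. i < length ts \<and> ?zs ! i \<le> m} = {..<length ts}"
      "{i. i < length ts \<and> ts ! i \<le> m} = {..<length ts}"
      using lt by (auto dest: less_imp_le_nat order_trans)
    then show "npos e m = npos f m" using diff[of m] by simp
  next
    fix x assume x: "x \<in> {1..m}" "e x = 0"
    then have x': "x \<notin> ?U" "x \<notin> ?B" "x \<notin> ?T" unfolding ev by (auto split: if_splits)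
    have "{i. i < length ts \<and> ?zs ! i \<le> x} = {i. i < length ts \<and> ts ! i \<le> x}"
    proof (intro equalityI subsetI)
      fix i assume i: "i \<in> {i. i < length ts \<and> ts ! i \<le> x}"
      then have "ts ! i \<noteq> x" using x'(3) by auto
      then show "i \<in> {i. i < length ts \<and> ?zs ! i \<le> x}"
        using greedy_gap[OF C ts x(1) x', of i] i by auto
    qed (use lt in force)
    then show "npos e x = npos f x" using diff[of x] by simp
  qed
qed

text \<open>
  The column that splits into \<open>e\<close> and \<open>f\<close>: its unbarred letters are those of the right half, its
  barred letters those of the left half.
\<close>

definition merged_column :: "nat \<Rightarrow> (nat \<Rightarrow> int) \<Rightarrow> (nat \<Rightarrow> int) \<Rightarrow> letter list" where
  "merged_column m e f =
     sorted_list_of_set (Unb ` {x \<in> {1..m}. f x = 1} \<union> Bar ` {x \<in> {1..m}. e x = -1})"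

text \<open>
  Every split pair comes from an admissible column. The candidates for the \<open>z\<close> and the \<open>t\<close> are the
  letters at which the signs change; comparing the numbers of indices \<open>j\<close> with \<open>t\<^sub>j \<le> x\<close> and with
  \<open>z\<^sub>j \<le> x\<close>, at \<open>x = z\<^sub>i\<close> and at an unused \<open>x\<close>, shows that the \<open>t\<close> are the greedy choice.
\<close>

lemma split_pair_admissible:
  assumes e: "is_sign_vector m e" and f: "is_sign_vector m f" and p: "split_pair m e f"
  defines "C \<equiv> merged_column m e f"
  shows "admissible m C" "sign_vector_of (set (left_column m C)) = e"
    "sign_vector_of (set (right_column m C)) = f"
    and "int (length C) = npos e m + nneg e m"
proof -
  let ?U = "{x \<in> {1..m}. f x = 1}" and ?B = "{x \<in> {1..m}. e x = -1}"
  let ?T = "{x \<in> {1..m}. e x = 1 \<and> f x = -1}" and ?Z = "{x \<in> {1..m}. e x = -1 \<and> f x = 1}"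
  have ev: "e x \<in> {-1, 0, 1}" "x \<notin> {1..m} \<Longrightarrow> e x = 0" for x
    using e unfolding is_sign_vector_def by auto
  have fv: "f x \<in> {-1, 0, 1}" "x \<notin> {1..m} \<Longrightarrow> f x = 0" for x
    using f unfolding is_sign_vector_def by auto
  have supp: "e x = 0 \<longleftrightarrow> f x = 0" for x
    using p ev(2)[of x] fv(2)[of x] unfolding split_pair_def by (cases "x \<in> {1..m}") auto
  have setC: "set C = Unb ` ?U \<union> Bar ` ?B" unfolding C_def merged_column_def by simp
  have col: "is_column m C"
    unfolding is_column_def setC unfolding C_def merged_column_def alphabet_def
    by (auto simp: strict_sorted_list_of_set)
  have parts: "unb_part C = ?U" "bar_part C = ?B"
    unfolding unb_part_def bar_part_def setC by auto
  define zs where "zs = rev (sorted_list_of_set ?Z)"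
  define ts where "ts = rev (sorted_list_of_set ?T)"
  have "{z. Unb z \<in> set C \<and> Bar z \<in> set C} = ?Z" unfolding setC by auto
  then have zs: "paired_letters C = zs" unfolding paired_letters_def zs_def by simp
  have fin: "finite ?Z" "finite ?T" by auto
  note z = decreasing_rev_sorted_list[OF fin(1), folded zs_def]
    and t = decreasing_rev_sorted_list[OF fin(2), folded ts_def]
  have diff: "npos e x - npos f x
      = int (card {i. i < length ts \<and> ts ! i \<le> x}) - int (card {i. i < length zs \<and> zs ! i \<le> x})" 
    if "x \<le> m" for x
  proof -
    have "npos e x - npos f x = (\<Sum>y=1..x. of_bool (y \<in> set ts) - of_bool (y \<in> set zs))"
      unfolding npos_def sum_subtractf[symmetric] z(1) t(1)
    proof (intro sum.cong refl)
      fix y assume y: "y \<in> {1..x}"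
      then have "y \<in> {1..m}" using that by auto
      then show "of_bool (e y = 1) - of_bool (f y = 1)
          = (of_bool (y \<in> ?T) - of_bool (y \<in> ?Z) :: int)"
        using ev(1)[of y] fv(1)[of y] supp[of y] by auto
    qed
    also have "\<dots> = int (card {i. i < length ts \<and> ts ! i \<le> x}) - int (card {i. i < length zs \<and> zs ! i \<le> x})"
      unfolding sum_subtractf using z(1,2) t(1,2) by (subst (1 2) sum_of_bool_set_nth) auto
    finally show ?thesis .
  qed
  have zm: "zs ! i \<in> ?Z" if "i < length zs" for i using z(1) nth_mem[OF that] by blast
  have tm: "ts ! i \<in> ?T" if "i < length ts" for i using t(1) nth_mem[OF that] by blast
  have len: "length ts = length zs"
  proof -
    have "{i. i < length ts \<and> ts ! i \<le> m} = {..<length ts}" "{i. i < length zs \<and> zs ! i \<le> m} = {..<length zs}"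
      using zm tm by auto
    then show ?thesis using diff[of m] p unfolding split_pair_def by simp
  qed
  let ?r = "length zs"
  have zdec: "zs ! j \<le> zs ! i" if "i \<le> j" "j < ?r" for i j
    using z(4)[of i j] that by (cases "i = j") auto
  have tdec: "ts ! j \<le> ts ! i" if "i \<le> j" "j < ?r" for i j
    using t(4)[of i j] that len by (cases "i = j") auto
  have lt: "ts ! i < zs ! i" if i: "i < ?r" for i
  proof (rule ccontr)
    assume c: "\<not> ?thesis"
    have ne: "ts ! i \<noteq> zs ! i" using zm[OF i] tm[of i] i len by auto
    have "{i..<?r} \<subseteq> {j. j < ?r \<and> zs ! j \<le> zs ! i}" using zdec by auto
    from card_mono[OF _ this] have 1: "?r - i \<le> card {j. j < ?r \<and> zs ! j \<le> zs ! i}" by simp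
    have "{j. j < ?r \<and> ts ! j \<le> zs ! i} \<subseteq> {Suc i..<?r}"
    proof
      fix j assume j: "j \<in> {j. j < ?r \<and> ts ! j \<le> zs ! i}"
      then have "\<not> j \<le> i" using tdec[of j i] i c ne by auto
      then show "j \<in> {Suc i..<?r}" using j by auto
    qed
    from card_mono[OF _ this] have 2: "card {j. j < ?r \<and> ts ! j \<le> zs ! i} \<le> ?r - Suc i" by simp
    have "zs ! i \<le> m" using zm[OF i] by auto
    then show False using diff[of "zs ! i"] p 1 2 i unfolding split_pair_def len by auto
  qed
  have split: "is_splitting m C ts"
    unfolding is_splitting_def Let_def zs
  proof (intro conjI allI impI len)
    fix i assume i: "i < ?r"
    let ?b = "if i = 0 then zs ! 0 else min (ts ! (i - 1)) (zs ! i)"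
    have un: "s \<in> unused_below m C b \<longleftrightarrow> s \<in> {1..m} \<and> s < b \<and> f s \<noteq> 1 \<and> e s \<noteq> -1" for s b
      unfolding unused_below_def using parts unfolding unb_part_def bar_part_def by auto
    show "is_greatest_in (ts ! i) (unused_below m C ?b)"
      unfolding is_greatest_in_def
    proof (intro conjI ballI)
      show "ts ! i \<in> unused_below m C ?b"
        unfolding un using tm[of i] lt[OF i] i len t(4)[of "i - 1" i] by auto
      fix s assume "s \<in> unused_below m C ?b"
      then have s: "s \<in> {1..m}" "s < ?b" "f s \<noteq> 1" "e s \<noteq> -1" unfolding un by auto
      have sz: "s < zs ! i" using s(2) by (auto split: if_splits)
      show "s \<le> ts ! i"
      proof (rule ccontr)
        assume c: "\<not> ?thesis"
        have "s \<notin> set ts"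
        proof
          assume "s \<in> set ts"
          then obtain j where j: "j < ?r" "s = ts ! j" using len by (auto simp: in_set_conv_nth)
          show False
          proof (cases "j < i")
            case True
            then have "ts ! (i - 1) \<le> s" using tdec[of j "i - 1"] i j by auto
            then show False using s(2) True by (auto split: if_splits)
          next
            case False
            then show False using tdec[of i j] j c by auto
          qed
        qed
        then have "s \<notin> ?T" using t(1) by blast
        then have es: "e s = 0" using s ev(1)[of s] fv(1)[of s] supp[of s] by auto
        have "{i..<?r} \<subseteq> {j. j < ?r \<and> ts ! j \<le> s}"
        proof
          fix j assume "j \<in> {i..<?r}"
          then show "j \<in> {j. j < ?r \<and> ts ! j \<le> s}" using tdec[of i j] c by auto
        qed
        from card_mono[OF _ this] have 1: "?r - i \<le> card {j. j < ?r \<and> ts ! j \<le> s}" by simp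
        have "{j. j < ?r \<and> zs ! j \<le> s} \<subseteq> {Suc i..<?r}"
        proof
          fix j assume j: "j \<in> {j. j < ?r \<and> zs ! j \<le> s}"
          then have "\<not> j \<le> i" using zdec[of j i] i sz by auto
          then show "j \<in> {Suc i..<?r}" using j by auto
        qed
        from card_mono[OF _ this] have 2: "card {j. j < ?r \<and> zs ! j \<le> s} \<le> ?r - Suc i" by simp
        have "npos e s = npos f s" using p s(1) es unfolding split_pair_def by blast
        then show False using diff[of s] s(1) 1 2 i unfolding len by auto
      qed
    qed
  qed
  show adm: "admissible m C" unfolding admissible_def using col split by blast
  show "sign_vector_of (set (left_column m C)) = e"
  proof
    fix x
    show "sign_vector_of (set (left_column m C)) x = e x"
      unfolding left_column_props(1)[OF col split] sign_vector_of_def parts t(1)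
      using ev[of x] fv[of x] supp[of x] by (cases "x \<in> {1..m}") auto
  qed
  show "sign_vector_of (set (right_column m C)) = f"
  proof
    fix x
    show "sign_vector_of (set (right_column m C)) x = f x"
      unfolding right_column_props(1)[OF col split] sign_vector_of_def parts t(1)
      using ev[of x] fv[of x] supp[of x] by (cases "x \<in> {1..m}") auto
  qed
  have "length C = card (set C)"
    using col unfolding is_column_def strict_sorted_iff by (simp add: distinct_card)
  then have "int (length C) = npos f m + nneg e m"
    unfolding setC npos_card nneg_card by (subst (asm) card_Un_disjoint) (auto simp: card_image)
  then show "int (length C) = npos e m + nneg e m" using p unfolding split_pair_def by simp
qed

lemma merged_column_of_admissible:
  assumes "admissible m C"
  shows "merged_column m (sign_vector_of (set (left_column m C)))
    (sign_vector_of (set (right_column m C))) = C"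
proof -
  have col: "is_column m C" using assms unfolding admissible_def by simp
  have "Unb ` {x \<in> {1..m}. sign_vector_of (set (right_column m C)) x = 1} \<union>
      Bar ` {x \<in> {1..m}. sign_vector_of (set (left_column m C)) x = -1} = set C"
    unfolding admissible_split_pair(6,7)[OF assms] 
    using parts_subset[OF col] unfolding set_column_parts[of C]
    by auto
  then show ?thesis
    unfolding merged_column_def using col unfolding is_column_def
    by (simp add: strict_sorted_iff sorted_list_of_set.idem_if_sorted_distinct)
qed

section \<open>Tableaux as sign tableaux\<close>

text \<open>
  The parts of the conjugate partition: column \<open>j\<close> of the diagram occupies the first
  \<open>column_height lam j\<close> rows.
\<close>

definition column_height :: "(nat \<Rightarrow> nat) \<Rightarrow> nat \<Rightarrow> nat" where
  "column_height lam j = card {i. j < lam i}"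

lemma less_column_height:
  assumes "is_partition lam"
  shows "i < column_height lam j \<longleftrightarrow> j < lam i"
proof -
  have anti: "antimono lam" and fin: "finite {i. lam i \<noteq> 0}" using assms unfolding is_partition_def by auto
  have fj: "finite {i. j < lam i}" using fin by (rule rev_finite_subset) auto
  have down: "j < lam i'" if "i' \<le> i" "j < lam i" for i i'
    using antimonoD[OF anti that(1)] that(2) by simp
  show ?thesis
  proof
    assume "j < lam i"
    then have "{..i} \<subseteq> {i. j < lam i}" using down by auto
    from card_mono[OF fj this] show "i < column_height lam j" unfolding column_height_def by simp
  next
    assume *: "i < column_height lam j"
    show "j < lam i"
    proof (rule ccontr)
      assume "\<not> j < lam i"
      then have "{i. j < lam i} \<subseteq> {..<i}" using down by (auto simp: not_le[symmetric])
      from card_mono[OF _ this] show False using * unfolding column_height_def by simp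
    qed
  qed
qed

lemma column_height_antimono:
  assumes "is_partition lam" "j \<le> j'"
  shows "column_height lam j' \<le> column_height lam j"
proof (rule ccontr)
  assume "\<not> ?thesis"
  then have "j' < lam (column_height lam j)"
    using less_column_height[OF assms(1), of "column_height lam j" j'] by simp
  then have "j < lam (column_height lam j)" using assms(2) by simp
  then show False using less_column_height[OF assms(1), of "column_height lam j" j] by simp
qed

lemma semistandard_from_neighbours:
  fixes S :: "(nat \<times> nat) set"
  assumes S: "\<And>i j. (i, j) \<in> S \<longleftrightarrow> lo j \<le> i \<and> i < hi j"
    and anti: "\<And>j j'. j \<le> j' \<Longrightarrow> lo j' \<le> lo j" "\<And>j j'. j \<le> j' \<Longrightarrow> hi j' \<le> hi j"
    and row: "\<And>i j. (i, j) \<in> S \<Longrightarrow> (i, Suc j) \<in> S \<Longrightarrow> T (i, j) \<le> T (i, Suc j)"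
    and col: "\<And>i i' j. (i, j) \<in> S \<Longrightarrow> (i', j) \<in> S \<Longrightarrow> i < i' \<Longrightarrow> T (i, j) < T (i', j)"
  shows "semistandard S T"
proof -
  have "T (i, j) \<le> T (i, j + d)" if "(i, j) \<in> S" "(i, j + d) \<in> S" for i j d
    using that(2)
  proof (induction d)
    case (Suc d)
    have "(i, j + d) \<in> S"
      using that(1) Suc.prems anti(1)[of j "j + d"] anti(2)[of "j + d" "j + Suc d"] unfolding S by auto
    then show ?case using Suc row[of i "j + d"] by (auto intro: order_trans)
  qed simp
  then have "T (i, j) \<le> T (i, j')" if "(i, j) \<in> S" "(i, j') \<in> S" "j < j'" for i j j'
    using that by (metis less_imp_add_positive)
  then show ?thesis unfolding semistandard_def using col by blast
qed

text \<open>
  A column lies entrywise between its left and its right half.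
\<close>

lemma count_le_merged_column:
  assumes e: "is_sign_vector m e" and f: "is_sign_vector m f" and p: "split_pair m e f"
  shows "count_le (signed_letters m f) a \<le> count_le (set (merged_column m e f)) a"
    and "count_le (set (merged_column m e f)) a \<le> count_le (signed_letters m e) a"
proof -
  have supp: "npos e x + nneg e x = npos f x + nneg f x" if "x \<le> m" for x
  proof -
    have "of_bool (e y = 1) + of_bool (e y = -1) = (of_bool (f y = 1) + of_bool (f y = -1) :: int)"
      if "y \<in> {1..x}" for y
    proof -
      have "e y \<in> {-1, 0, 1}" "f y \<in> {-1, 0, 1}" using e f unfolding is_sign_vector_def by auto
      moreover have "e y = 0 \<longleftrightarrow> f y = 0" using p that \<open>x \<le> m\<close> unfolding split_pair_def by auto
      ultimately show ?thesis by auto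
    qed
    then show ?thesis unfolding npos_def nneg_def sum.distrib[symmetric] by (intro sum.cong) auto
  qed
  have le: "npos f x \<le> npos e x" if "x \<le> m" for x using p that unfolding split_pair_def by blast
  have top: "npos e m = npos f m" using p unfolding split_pair_def by blast
  have nle: "nneg e x \<le> nneg f x" if "x \<le> m" for x using supp[OF that] le[OF that] by linarith
  have "\<forall>a. 0 + int (count_le (signed_letters m f) a) \<le> 0 + int (count_le (signed_letters m e) a)"
    using le nle supp[of m]
    by (subst count_le_iff_heights[of e m "npos e m + nneg e m" 0 f "npos e m + nneg e m" 0]) auto
  then have fe: "count_le (signed_letters m f) a \<le> count_le (signed_letters m e) a" by simp
  have setC: "set (merged_column m e f) = Unb ` {x \<in> {1..m}. f x = 1} \<union> Bar ` {x \<in> {1..m}. e x = -1}"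
    unfolding merged_column_def by simp
  have "count_le (set (merged_column m e f)) a =
      (case a of Unb x \<Rightarrow> count_le (signed_letters m f) a | Bar x \<Rightarrow> count_le (signed_letters m e) a)"
  proof (cases a)
    case (Unb x)
    have "{b \<in> set (merged_column m e f). b \<le> Unb x} = {b \<in> signed_letters m f. b \<le> Unb x}"
      unfolding setC signed_letters_def by auto
    then show ?thesis unfolding count_le_def Unb by simp
  next
    case (Bar x)
    let ?B = "Bar ` {y \<in> {1..m}. e y = -1 \<and> x \<le> y}"
    have "{b \<in> set (merged_column m e f). b \<le> Bar x} = Unb ` {x \<in> {1..m}. f x = 1} \<union> ?B"
      "{b \<in> signed_letters m e. b \<le> Bar x} = Unb ` {x \<in> {1..m}. e x = 1} \<union> ?B"
      unfolding setC signed_letters_def by auto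
    moreover have "card (Unb ` {x \<in> {1..m}. f x = 1} \<union> ?B) = card {x \<in> {1..m}. f x = 1} + card ?B"
      "card (Unb ` {x \<in> {1..m}. e x = 1} \<union> ?B) = card {x \<in> {1..m}. e x = 1} + card ?B"
      by (subst card_Un_disjoint; auto simp: card_image)+
    moreover have "card {x \<in> {1..m}. f x = 1} = card {x \<in> {1..m}. e x = 1}"
      using top unfolding npos_card by simp
    ultimately show ?thesis unfolding count_le_def Bar by simp
  qed
  then show "count_le (signed_letters m f) a \<le> count_le (set (merged_column m e f)) a"
    "count_le (set (merged_column m e f)) a \<le> count_le (signed_letters m e) a"
    using fe by (cases a; simp)+
qed

text \<open>
  Throughout, column \<open>j\<close> of the skew shape consists of the rows from \<open>lo j\<close> to \<open>hi j - 1\<close>.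
\<close>

locale skew_tableaux =
  fixes lam mu :: "nat \<Rightarrow> nat" and m :: nat
  assumes lam: "is_partition lam" and mu: "is_partition mu" and sub: "contained_in mu lam"
begin

abbreviation D where "D \<equiv> skew_shape lam mu"
abbreviation lo where "lo \<equiv> column_height mu"
abbreviation hi where "hi \<equiv> column_height lam"
abbreviation tabs where "tabs \<equiv> sign_tableaux m (\<lambda>j. int (lo j)) (\<lambda>j. int (hi j))"

lemma in_D: "(i, j) \<in> D \<longleftrightarrow> lo j \<le> i \<and> i < hi j"
proof -
  have "(i, j) \<in> D \<longleftrightarrow> j < lam i \<and> \<not> j < mu i"
    unfolding skew_shape_def diagram_def by auto
  then show ?thesis
    unfolding less_column_height[OF lam, symmetric] less_column_height[OF mu, symmetric] by auto
qed

lemma lo_le_hi: "lo j \<le> hi j"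
proof (rule ccontr)
  assume "\<not> ?thesis"
  then have "j < mu (hi j)" using less_column_height[OF mu, of "hi j" j] by simp
  then have "j < lam (hi j)" using sub unfolding contained_in_def using order_less_le_trans by blast
  then show False using less_column_height[OF lam, of "hi j" j] by simp
qed

lemma lo_antimono: "j \<le> j' \<Longrightarrow> lo j' \<le> lo j" and hi_antimono: "j \<le> j' \<Longrightarrow> hi j' \<le> hi j"
  using column_height_antimono lam mu by auto

lemma empty_columns: "lam 0 \<le> j \<Longrightarrow> hi j = 0" "lam 0 \<le> j \<Longrightarrow> lo j = 0"
  using less_column_height[OF lam, of 0 j] lo_le_hi[of j] by auto

lemma finite_D: "finite D"
proof (rule finite_subset)
  show "D \<subseteq> {..<hi 0} \<times> {..<lam 0}"
  proof
    fix c assume "c \<in> D"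
    moreover obtain i j where c: "c = (i, j)" by (cases c)
    ultimately have "i < hi j" unfolding c in_D by simp
    then have "i < hi 0" "j < lam 0"
      using hi_antimono[of 0 j] empty_columns(1)[of j] by (simp, metis not_le not_less0)
    then show "c \<in> {..<hi 0} \<times> {..<lam 0}" unfolding c by simp
  qed
qed simp

lemma finite_SP: "finite (SP lam mu m)"
proof (rule finite_subset)
  show "SP lam mu m \<subseteq> D \<rightarrow>\<^sub>E alphabet m" unfolding SP_def by auto
  show "finite (D \<rightarrow>\<^sub>E alphabet m)" using finite_D by (intro finite_PiE) (auto simp: alphabet_def)
qed

lemma column_of_eq: "column_of D T j = map (\<lambda>i. T (i, j)) [lo j..<hi j]"
proof -
  have "{i. (i, j) \<in> D} = {lo j..<hi j}" unfolding in_D by auto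
  then show ?thesis unfolding column_of_def by simp
qed

lemma column_of_length: "length (column_of D T j) = hi j - lo j"
  unfolding column_of_eq by simp

lemma column_of_nth: "lo j \<le> i \<Longrightarrow> i < hi j \<Longrightarrow> column_of D T j ! (i - lo j) = T (i, j)"
  unfolding column_of_eq using nth_upt[of "lo j" "i - lo j" "hi j"] by simp

lemma in_split_shape: "(i, k) \<in> split_shape D \<longleftrightarrow> lo (k div 2) \<le> i \<and> i < hi (k div 2)"
  unfolding split_shape_def using in_D by simp

text \<open>
  The columns of the split form.
\<close>

definition split_column :: "(nat \<times> nat \<Rightarrow> letter) \<Rightarrow> nat \<Rightarrow> letter list" where
  "split_column T k = (if even k then left_column m (column_of D T (k div 2))
     else right_column m (column_of D T (k div 2)))"

lemma split_form_eq:
  assumes "(i, k) \<in> split_shape D"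
  shows "split_form m D T (i, k) = split_column T k ! (i - lo (k div 2))"
proof -
  have "{i'. i' < i \<and> (i', k div 2) \<in> D} = {lo (k div 2)..<i}"
    using assms unfolding in_split_shape in_D by auto
  then show ?thesis unfolding split_form_def split_column_def by simp
qed

text \<open>
  The sign tableau of a filling.
\<close>

definition signs :: "(nat \<times> nat \<Rightarrow> letter) \<Rightarrow> nat \<Rightarrow> nat \<Rightarrow> int" where
  "signs T k = sign_vector_of (set (split_column T k))"

lemma split_column_props:
  assumes "\<And>j. admissible m (column_of D T j)"
  shows "sorted_wrt (<) (split_column T k)" "length (split_column T k) = hi (k div 2) - lo (k div 2)"
    "set (split_column T k) = signed_letters m (signs T k)" "is_sign_vector m (signs T k)"
    "npos (signs T k) m + nneg (signs T k) m = int (hi (k div 2)) - int (lo (k div 2))"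
proof -
  note A = admissible_split_pair[OF assms[of "k div 2"]]
  show s: "sorted_wrt (<) (split_column T k)" 
    and l: "length (split_column T k) = hi (k div 2) - lo (k div 2)"
    using A unfolding split_column_def column_of_length by auto
  show e: "set (split_column T k) = signed_letters m (signs T k)" "is_sign_vector m (signs T k)"
    using A(1,2,4,5) unfolding signs_def split_column_def by auto
  have "int (length (split_column T k)) = int (card (signed_letters m (signs T k)))"
    using s e(1) unfolding strict_sorted_iff by (metis distinct_card)
  then show "npos (signs T k) m + nneg (signs T k) m = int (hi (k div 2)) - int (lo (k div 2))"
    unfolding card_signed_letters l using lo_le_hi[of "k div 2"] by (simp add: of_nat_diff)
qed

lemma neighbour_rows_iff:
  assumes adm: "\<And>j. admissible m (column_of D T j)"
  shows "(\<forall>i. (i, k) \<in> split_shape D \<and> (i, Suc k) \<in> split_shape D \<longrightarrow>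
        split_form m D T (i, k) \<le> split_form m D T (i, Suc k)) \<longleftrightarrow>
    (\<forall>x\<le>m. int (lo (Suc k div 2)) + npos (signs T (Suc k)) x \<le> int (lo (k div 2)) + npos (signs T k) x \<and>
      int (hi (Suc k div 2)) - nneg (signs T (Suc k)) x \<le> int (hi (k div 2)) - nneg (signs T k) x)"
proof -
  have le: "lo (Suc k div 2) \<le> lo (k div 2)" "hi (Suc k div 2) \<le> hi (k div 2)"
    by (auto intro!: lo_antimono hi_antimono)
  note P = split_column_props[OF adm]
  have "(\<forall>i. (i, k) \<in> split_shape D \<and> (i, Suc k) \<in> split_shape D \<longrightarrow>
        split_form m D T (i, k) \<le> split_form m D T (i, Suc k)) \<longleftrightarrow>
      (\<forall>i. lo (k div 2) \<le> i \<and> i < hi (Suc k div 2) \<longrightarrow>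
        split_column T k ! (i - lo (k div 2)) \<le> split_column T (Suc k) ! (i - lo (Suc k div 2)))"
    (is "(\<forall>i. ?A i) \<longleftrightarrow> (\<forall>i. ?B i)")
  proof -
    have "?A i \<longleftrightarrow> ?B i" for i
    proof (cases "lo (k div 2) \<le> i \<and> i < hi (Suc k div 2)")
      case True
      then have "(i, k) \<in> split_shape D" "(i, Suc k) \<in> split_shape D"
        using le unfolding in_split_shape by auto
      then show ?thesis using True by (simp add: split_form_eq)
    qed (auto simp: in_split_shape)
    then show ?thesis by blast
  qed
  also have "\<dots> \<longleftrightarrow> (\<forall>a. lo (Suc k div 2) + count_le (set (split_column T (Suc k))) a
      \<le> lo (k div 2) + count_le (set (split_column T k)) a)"
    by (rule rowwise_le_iff[OF P(1) _ P(1) _ le]) (use P(2) lo_le_hi in auto)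
  also have "\<dots> \<longleftrightarrow> (\<forall>a. int (lo (Suc k div 2)) + int (count_le (signed_letters m (signs T (Suc k))) a)
      \<le> int (lo (k div 2)) + int (count_le (signed_letters m (signs T k)) a))"
    unfolding P(3) by (simp flip: of_nat_add)
  also have "\<dots> \<longleftrightarrow> (\<forall>x\<le>m. int (lo (Suc k div 2)) + npos (signs T (Suc k)) x \<le> int (lo (k div 2)) + npos (signs T k) x \<and>
      int (hi (Suc k div 2)) - nneg (signs T (Suc k)) x \<le> int (hi (k div 2)) - nneg (signs T k) x)"
    by (rule count_le_iff_heights[OF P(5) P(5)])
  finally show ?thesis .
qed

lemma signs_in_tabs:
  assumes T: "T \<in> SP lam mu m"
  shows "signs T \<in> tabs"
proof -
  have adm: "\<And>j. admissible m (column_of D T j)"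
    and ss: "semistandard (split_shape D) (split_form m D T)"
    using T unfolding SP_def by auto
  note P = split_column_props[OF adm]
  have "\<forall>i. (i, k) \<in> split_shape D \<and> (i, Suc k) \<in> split_shape D \<longrightarrow>
      split_form m D T (i, k) \<le> split_form m D T (i, Suc k)" for k
    using ss unfolding semistandard_def by (metis lessI)
  then have ineq: "\<forall>x\<le>m. int (lo (Suc k div 2)) + npos (signs T (Suc k)) x \<le> int (lo (k div 2)) + npos (signs T k) x \<and>
      int (hi (Suc k div 2)) - nneg (signs T (Suc k)) x \<le> int (hi (k div 2)) - nneg (signs T k) x" for k
    using neighbour_rows_iff[OF adm] by blast
  have "split_pair m (signs T (2 * j)) (signs T (2 * j + 1))" for j
    using admissible_split_pair(3)[OF adm[of j]] unfolding signs_def split_column_def by simp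
  then show ?thesis unfolding sign_tableaux_def using P(4,5) ineq by auto
qed

lemma column_from_signs:
  assumes "T \<in> SP lam mu m"
  shows "column_of D T j = merged_column m (signs T (2 * j)) (signs T (2 * j + 1))"
proof -
  have "admissible m (column_of D T j)" using assms unfolding SP_def by auto
  from merged_column_of_admissible[OF this] show ?thesis
    unfolding signs_def split_column_def by simp
qed

lemma signs_inj: "inj_on signs (SP lam mu m)"
proof (rule inj_onI)
  fix T T' assume T: "T \<in> SP lam mu m" "T' \<in> SP lam mu m" and eq: "signs T = signs T'"
  have "T c = T' c" for c
  proof (cases "c \<in> D")
    case True
    obtain i j where c: "c = (i, j)" by (cases c)
    have ij: "lo j \<le> i" "i < hi j" using True unfolding c in_D by auto
    have "column_of D T j = column_of D T' j" using column_from_signs T eq by simp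
    then show ?thesis unfolding c using column_of_nth[OF ij, of T] column_of_nth[OF ij, of T'] by simp
  next
    case False
    have "T \<in> D \<rightarrow>\<^sub>E alphabet m" "T' \<in> D \<rightarrow>\<^sub>E alphabet m" using T unfolding SP_def by auto
    then show ?thesis using False by (metis PiE_arb)
  qed
  then show "T = T'" by auto
qed

text \<open>
  The filling is obtained by merging the two halves of every column. Its own rows increase weakly
  because each column lies between its two halves.
\<close>

lemma signs_surj:
  assumes c: "c \<in> tabs"
  shows "\<exists>T\<in>SP lam mu m. signs T = c"
proof -
  have sv: "is_sign_vector m (c k)" for k using c unfolding sign_tableaux_def by auto
  note Dc = sign_tableauxD[OF c]
  define K where "K j = merged_column m (c (2 * j)) (c (2 * j + 1))" for j
  note A = split_pair_admissible[OF sv sv Dc(6)]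
  have adm: "admissible m (K j)" for j unfolding K_def by (rule A(1))
  have len: "length (K j) = hi j - lo j" for j
    using A(4)[of j] Dc(3)[of "2 * j"] unfolding K_def by simp
  have col: "is_column m (K j)" for j using adm unfolding admissible_def by blast
  define T where "T = (\<lambda>(i, j). if (i, j) \<in> D then K j ! (i - lo j) else undefined)"
  have colT: "column_of D T j = K j" for j
    unfolding column_of_eq
    by (rule nth_equalityI) (auto simp: len T_def in_D)
  have admT: "admissible m (column_of D T j)" for j unfolding colT by (rule adm)
  note P = split_column_props[OF admT]
  have sg: "signs T k = c k" for k
  proof (cases "even k")
    case True
    then have "2 * (k div 2) = k" by simp
    then show ?thesis using True A(2)[of "k div 2"] unfolding signs_def split_column_def colT K_def by simp
  next
    case False
    then have "2 * (k div 2) + 1 = k" by simp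
    then show ?thesis using False A(3)[of "k div 2"] unfolding signs_def split_column_def colT K_def by simp
  qed
  have rowsplit: "split_form m D T (i, k) \<le> split_form m D T (i, Suc k)"
    if "(i, k) \<in> split_shape D" "(i, Suc k) \<in> split_shape D" for i k
    using neighbour_rows_iff[OF admT, of k] Dc(4,5)[of _ k] that unfolding sg by blast
  have strict: "xs ! (i - l) < xs ! (i' - l)" if "sorted_wrt (<) xs" "l \<le> i" "i < i'" "i' - l < length xs"
    for xs :: "letter list" and i i' l
    using sorted_wrt_nth_less[OF that(1), of "i - l" "i' - l"] that by auto
  have ss: "semistandard (split_shape D) (split_form m D T)"
  proof (rule semistandard_from_neighbours[where lo = "\<lambda>k. lo (k div 2)" and hi = "\<lambda>k. hi (k div 2)"])
    fix i i' k assume ii: "(i, k) \<in> split_shape D" "(i', k) \<in> split_shape D" "i < i'"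
    show "split_form m D T (i, k) < split_form m D T (i', k)"
      unfolding split_form_eq[OF ii(1)] split_form_eq[OF ii(2)]
      by (rule strict[OF P(1)]) (use ii P(2) in \<open>auto simp: in_split_shape\<close>)
  qed (use rowsplit in \<open>auto simp: in_split_shape intro!: lo_antimono hi_antimono div_le_mono\<close>)
  have K_sorted: "sorted_wrt (<) (K j)" for j using col unfolding is_column_def by blast
  have left_le: "split_column T (2 * j) ! (i - lo j) \<le> K j ! (i - lo j)"
    and right_ge: "K j ! (i - lo j) \<le> split_column T (2 * j + 1) ! (i - lo j)"
    if "lo j \<le> i" "i < hi j" for i j
  proof -
    note cm = count_le_merged_column[OF sv sv Dc(6), of j]
    have L: "set (split_column T (2 * j)) = signed_letters m (c (2 * j))"
      "set (split_column T (2 * j + 1)) = signed_letters m (c (2 * j + 1))"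
      using P(3) sg by auto
    have le1: "\<forall>a. lo j + count_le (set (K j)) a \<le> lo j + count_le (set (split_column T (2 * j))) a"
      using cm(2) unfolding L K_def by simp
    have le2: "\<forall>a. lo j + count_le (set (split_column T (2 * j + 1))) a \<le> lo j + count_le (set (K j)) a"
      using cm(1) unfolding L K_def by simp
    have lens: "lo j + length (split_column T (2 * j)) = hi j" "lo j + length (K j) = hi j"
      "lo j + length (split_column T (2 * j + 1)) = hi j"
      using P(2)[of "2 * j"] P(2)[of "2 * j + 1"] len[of j] lo_le_hi[of j] by auto
    show "split_column T (2 * j) ! (i - lo j) \<le> K j ! (i - lo j)"
      using rowwise_le_iff[OF P(1) lens(1) K_sorted lens(2) order_refl order_refl] le1 that by blast
    show "K j ! (i - lo j) \<le> split_column T (2 * j + 1) ! (i - lo j)"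
      using rowwise_le_iff[OF K_sorted lens(2) P(1) lens(3) order_refl order_refl] le2 that by blast
  qed
  have ssT: "semistandard D T"
  proof (rule semistandard_from_neighbours[where lo = lo and hi = hi])
    fix i j assume ij: "(i, j) \<in> D" "(i, Suc j) \<in> D"
    have sh: "(i, 2 * j + 1) \<in> split_shape D" "(i, Suc (2 * j + 1)) \<in> split_shape D"
      using ij unfolding in_split_shape in_D by auto
    have "K j ! (i - lo j) \<le> split_column T (2 * j + 1) ! (i - lo j)"
      using right_ge ij unfolding in_D by blast
    also have "\<dots> = split_form m D T (i, 2 * j + 1)" using split_form_eq[OF sh(1)] by simp
    also have "\<dots> \<le> split_form m D T (i, Suc (2 * j + 1))" using rowsplit[OF sh] .
    also have "\<dots> = split_column T (2 * Suc j) ! (i - lo (Suc j))" using split_form_eq[OF sh(2)] by simp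
    also have "\<dots> \<le> K (Suc j) ! (i - lo (Suc j))" using left_le ij unfolding in_D by blast
    finally show "T (i, j) \<le> T (i, Suc j)" using ij unfolding T_def by simp
  next
    fix i i' j assume ii: "(i, j) \<in> D" "(i', j) \<in> D" "i < i'"
    then have "K j ! (i - lo j) < K j ! (i' - lo j)"
      by (intro strict[OF K_sorted]) (auto simp: in_D len)
    then show "T (i, j) < T (i', j)" using ii unfolding T_def by simp
  qed (auto simp: in_D intro: lo_antimono hi_antimono)
  have "T \<in> D \<rightarrow>\<^sub>E alphabet m"
  proof (rule PiE_I)
    fix d assume d: "d \<in> D"
    obtain i j where ij: "d = (i, j)" by (cases d)
    have "K j ! (i - lo j) \<in> set (K j)" using d unfolding ij in_D by (intro nth_mem) (auto simp: len)
    then show "T d \<in> alphabet m" using d col[of j] unfolding ij T_def is_column_def by auto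
  qed (auto simp: T_def split: prod.splits)
  then have "T \<in> SP lam mu m" unfolding SP_def using ssT admT ss by simp
  then show ?thesis using sg by (auto simp: fun_eq_iff intro!: bexI[of _ T])
qed

lemma bij_signs: "bij_betw signs (SP lam mu m) tabs"
  unfolding bij_betw_def using signs_inj signs_in_tabs signs_surj by force

lemma letter_count_columns:
  assumes T: "T \<in> SP lam mu m"
  shows "letter_count D T a = (\<Sum>j<lam 0. of_bool (a \<in> set (column_of D T j)))"
proof -
  let ?S = "\<lambda>j. {i. (i, j) \<in> D \<and> T (i, j) = a}"
  have "{c \<in> D. T c = a} = prod.swap ` (SIGMA j:{..<lam 0}. ?S j)"
    using empty_columns by (force simp: in_D image_def not_le[symmetric])
  then have "letter_count D T a = card (SIGMA j:{..<lam 0}. ?S j)"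
    unfolding letter_count_def by (simp add: card_image inj_on_def)
  also have "\<dots> = (\<Sum>j<lam 0. card (?S j))"
  proof (rule card_SigmaI)
    have "?S j \<subseteq> {..<hi j}" for j unfolding in_D by auto
    then show "\<forall>j\<in>{..<lam 0}. finite (?S j)" using finite_subset by blast
  qed simp
  also have "\<dots> = (\<Sum>j<lam 0. of_bool (a \<in> set (column_of D T j)))"
  proof (rule sum.cong[OF refl])
    fix j
    have "admissible m (column_of D T j)" using T unfolding SP_def by auto
    then have "distinct (column_of D T j)"
      unfolding admissible_def is_column_def strict_sorted_iff by auto
    then have inj: "inj_on (\<lambda>i. T (i, j)) {lo j..<hi j}" unfolding column_of_eq distinct_map by simp
    have set: "set (column_of D T j) = (\<lambda>i. T (i, j)) ` {lo j..<hi j}" unfolding column_of_eq by simp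
    show "card (?S j) = of_bool (a \<in> set (column_of D T j))"
    proof (cases "a \<in> set (column_of D T j)")
      case True
      then obtain i where i: "i \<in> {lo j..<hi j}" "a = T (i, j)" unfolding set by auto
      then have "?S j = {i}" using inj unfolding inj_on_def in_D by auto
      then show ?thesis using True by simp
    next
      case False
      then have none: "?S j = {}" unfolding set in_D by auto
      show ?thesis unfolding none using False by simp
    qed
  qed
  finally show ?thesis .
qed

lemma sign_weight_signs:
  assumes T: "T \<in> SP lam mu m"
  shows "sign_weight (lam 0) (signs T) x = int (letter_count D T (Unb x)) - int (letter_count D T (Bar x))"
proof -
  have "signs T (2 * j + 1) x = 1 \<longleftrightarrow> Unb x \<in> set (column_of D T j)"
    "signs T (2 * j) x = -1 \<longleftrightarrow> Bar x \<in> set (column_of D T j)" for j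
  proof -
    have "admissible m (column_of D T j)" using T unfolding SP_def by auto
    from admissible_split_pair(6,7)[OF this]
    show "signs T (2 * j + 1) x = 1 \<longleftrightarrow> Unb x \<in> set (column_of D T j)"
      "signs T (2 * j) x = -1 \<longleftrightarrow> Bar x \<in> set (column_of D T j)"
      unfolding signs_def split_column_def by simp_all
  qed
  then show ?thesis
    unfolding sign_weight_def letter_count_columns[OF T] by (simp add: sum_subtractf)
qed

lemma card_D: "card D = skew_size lam mu"
proof -
  have le: "mu i \<le> lam i" for i using sub unfolding contained_in_def by auto
  have fin: "finite {i. lam i \<noteq> 0}" using lam unfolding is_partition_def by auto
  have "D = (SIGMA i:{i. lam i \<noteq> 0}. {mu i..<lam i})"
    unfolding skew_shape_def diagram_def by auto
  then have "card D = (\<Sum>i | lam i \<noteq> 0. lam i - mu i)" using fin by simp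
  also have "\<dots> = (\<Sum>i | lam i \<noteq> 0. lam i) - (\<Sum>i | lam i \<noteq> 0. mu i)"
    using le by (intro sum_subtractf_nat) auto
  also have "(\<Sum>i | lam i \<noteq> 0. mu i) = (\<Sum>i | mu i \<noteq> 0. mu i)"
  proof (rule sum.mono_neutral_right[OF fin])
    show "{i. mu i \<noteq> 0} \<subseteq> {i. lam i \<noteq> 0}"
    proof
      fix i assume "i \<in> {i. mu i \<noteq> 0}"
      then show "i \<in> {i. lam i \<noteq> 0}" using le[of i] by auto
    qed
  qed auto
  finally show ?thesis unfolding skew_size_def partition_size_def .
qed

lemma sum_letter_counts:
  assumes T: "T \<in> SP lam mu m"
  shows "(\<Sum>x=1..m. letter_count D T (Unb x) + letter_count D T (Bar x)) = skew_size lam mu"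
proof -
  have T': "T \<in> D \<rightarrow> alphabet m" using T unfolding SP_def by auto
  have "card D = (\<Sum>a\<in>alphabet m. letter_count D T a)"
  proof -
    have "(\<Sum>a\<in>alphabet m. \<Sum>c\<in>{c \<in> D. T c = a}. 1) = (\<Sum>c\<in>D. 1)"
      using finite_D T' by (intro sum.group) (auto simp: alphabet_def)
    then show ?thesis unfolding letter_count_def card_eq_sum by (rule sym)
  qed
  also have "\<dots> = (\<Sum>a\<in>Unb ` {1..m}. letter_count D T a) + (\<Sum>a\<in>Bar ` {1..m}. letter_count D T a)"
    unfolding alphabet_def by (intro sum.union_disjoint) auto
  also have "\<dots> = (\<Sum>x=1..m. letter_count D T (Unb x) + letter_count D T (Bar x))"
    by (simp add: sum.reindex sum.distrib)
  finally show ?thesis unfolding card_D ..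
qed

text \<open>
  With \<open>y\<^sub>x = \<eta>\<^sup>2\<^sup>x\<^sup>-\<^sup>1\<close>, the letters \<open>x\<close> and \<open>Bar x\<close> of a tableau contribute \<open>\<eta>\<^sup>-\<^sup>1 * y\<^sub>x\<close> and
  \<open>\<eta>\<^sup>-\<^sup>1 * y\<^sub>x\<^sup>-\<^sup>1\<close> to \<open>\<zeta> ^ pwr\<close>, where \<open>\<zeta> = \<eta>\<^sup>2\<close>. So up to a constant factor, \<open>\<zeta> ^ pwr\<close> is a
  monomial in the \<open>y\<^sub>x\<close> that depends on the weight only.
\<close>

lemma pwr_monomial:
  fixes \<eta> :: complex
  assumes T: "T \<in> SP lam mu m" and \<eta>: "\<eta> ^ (4 * m) = 1" "\<eta> \<noteq> 0"
  shows "(\<eta>\<^sup>2) ^ pwr m D T * \<eta> ^ skew_size lam mu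
    = (\<Prod>x=1..m. (\<eta> ^ (2 * x - 1)) powi sign_weight (lam 0) (signs T) x)"
proof -
  let ?a = "\<lambda>x. letter_count D T (Unb x)" and ?b = "\<lambda>x. letter_count D T (Bar x)"
  have "(\<eta>\<^sup>2) ^ pwr m D T * \<eta> ^ skew_size lam mu = \<eta> ^ (2 * pwr m D T + skew_size lam mu)"
    by (simp add: power_add power_mult)
  also have "2 * pwr m D T + skew_size lam mu
      = (\<Sum>x=1..m. (2 * x - 1) * ?a x + (4 * m - (2 * x - 1)) * ?b x)"
    unfolding pwr_def sum_letter_counts[OF T, symmetric] sum_distrib_left sum.distrib[symmetric]
  proof (rule sum.cong[OF refl])
    fix x assume x: "x \<in> {1..m}"
    then have "2 * x - 1 = 2 * (x - 1) + 1" "4 * m - (2 * x - 1) = 2 * (2 * m - x) + 1" by auto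
    then show "2 * ((x - 1) * ?a x + (2 * m - x) * ?b x) + (?a x + ?b x)
        = (2 * x - 1) * ?a x + (4 * m - (2 * x - 1)) * ?b x"
      by (simp only: distrib_left distrib_right mult_1 mult.assoc add_ac)
  qed
  also have "\<eta> ^ \<dots> = (\<Prod>x=1..m. \<eta> ^ ((2 * x - 1) * ?a x + (4 * m - (2 * x - 1)) * ?b x))"
    by (simp add: power_sum)
  also have "\<dots> = (\<Prod>x=1..m. (\<eta> ^ (2 * x - 1)) powi sign_weight (lam 0) (signs T) x)"
  proof (rule prod.cong[OF refl])
    fix x assume x: "x \<in> {1..m}"
    have "\<eta> ^ (4 * m - (2 * x - 1)) * \<eta> ^ (2 * x - 1) = \<eta> ^ (4 * m)"
      using x by (simp add: power_add[symmetric])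
    then have inv: "\<eta> ^ (4 * m - (2 * x - 1)) = inverse (\<eta> ^ (2 * x - 1))"
      using \<eta> by (simp add: field_simps)
    have "\<eta> ^ ((2 * x - 1) * ?a x + (4 * m - (2 * x - 1)) * ?b x)
        = (\<eta> ^ (2 * x - 1)) ^ ?a x * (\<eta> ^ (4 * m - (2 * x - 1))) ^ ?b x"
      by (simp only: power_add power_mult)
    also have "\<dots> = (\<eta> ^ (2 * x - 1)) powi (int (?a x) - int (?b x))"
      unfolding inv using \<eta>(2) by (simp add: power_int_diff power_inverse divide_inverse)
    finally show "\<eta> ^ ((2 * x - 1) * ?a x + (4 * m - (2 * x - 1)) * ?b x)
        = (\<eta> ^ (2 * x - 1)) powi sign_weight (lam 0) (signs T) x"
      unfolding sign_weight_signs[OF T] .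
  qed
  finally show ?thesis .
qed

lemma coprime_2m:
  fixes k :: int
  assumes hyp: "\<And>p :: nat. prime p \<Longrightarrow> odd p \<Longrightarrow> p \<le> n \<Longrightarrow> gcd m p = 1"
    and k: "odd k" "\<bar>k\<bar> \<le> int n"
  shows "coprime k (2 * int m)"
proof -
  have "coprime (nat \<bar>k\<bar>) (2 * m)"
  proof (rule ccontr)
    assume "\<not> ?thesis"
    then have "gcd (nat \<bar>k\<bar>) (2 * m) \<noteq> 1" by (simp only: coprime_iff_gcd_eq_1 not_False_eq_True)
    then obtain p where "prime p" and "p dvd gcd (nat \<bar>k\<bar>) (2 * m)"
      using prime_factor_nat by blast
    then have p: "prime p" "p dvd nat \<bar>k\<bar>" "p dvd 2 * m"
      by (simp_all only: gcd_greatest_iff)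
    have ok: "odd (nat \<bar>k\<bar>)" using k(1) by (simp add: even_nat_iff)
    then have "odd p" using p(2) dvd_trans by blast
    moreover have "nat \<bar>k\<bar> > 0" using k(1) by auto
    then have "p \<le> n" using dvd_imp_le[OF p(2)] k(2) by linarith
    ultimately have "gcd m p = 1" using hyp p(1) by blast
    moreover have "p dvd m" using p(1,3) \<open>odd p\<close> prime_dvd_mult_iff[OF p(1)]
      by (metis dvd_refl primes_dvd_imp_eq two_is_prime_nat)
    ultimately show False using p(1) by (metis gcd_nat.absorb2 not_prime_1)
  qed
  then have "coprime (int (nat \<bar>k\<bar>)) (int (2 * m))" by (simp only: coprime_int_iff)
  then show ?thesis by simp
qed

theorem sum_pwr_zero:
  fixes \<zeta> :: complex
  assumes m: "m \<ge> 1" and odd: "odd (skew_size lam mu)"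
    and hyp: "\<And>p :: nat. prime p \<Longrightarrow> odd p \<Longrightarrow> p \<le> skew_size lam mu \<Longrightarrow> gcd m p = 1"
    and \<zeta>: "\<zeta> ^ (2 * m) = 1" "\<zeta> \<noteq> 1"
  shows "(\<Sum>T\<in>SP lam mu m. \<zeta> ^ pwr m D T) = 0"
proof -
  let ?n = "skew_size lam mu"
  define \<eta> where "\<eta> = csqrt \<zeta>"
  have \<eta>2: "\<eta>\<^sup>2 = \<zeta>" unfolding \<eta>_def by simp
  have "\<eta> ^ (4 * m) = (\<eta>\<^sup>2) ^ (2 * m)" by (simp add: power_mult[symmetric])
  then have \<eta>4: "\<eta> ^ (4 * m) = 1" unfolding \<eta>2 using \<zeta> by simp
  have \<eta>0: "\<eta> \<noteq> 0" using \<eta>4 m by (auto simp: power_0_left)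
  obtain a where a: "m = Suc a" using m by (cases m) auto
  have fin: "finite tabs" using bij_betw_finite[OF bij_signs] finite_SP by simp
  have W: "\<And>j. lam 0 \<le> j \<Longrightarrow> int (hi j) = int (lo j)" using empty_columns by simp
  have "(\<Sum>c\<in>tabs. \<Prod>x=1..m. (\<eta> ^ (2 * x - 1)) powi sign_weight (lam 0) c x) = 0"
  proof (rule sum_weights_zero[OF m])
    fix b assume "Suc (Suc b) \<le> m"
    from sum_sign_weight_swap[OF this fin W]
    show "weight_symmetry tabs (sign_weight (lam 0)) (swap_signs (Suc b))"
      unfolding weight_symmetry_def by simp
  next
    show "weight_symmetry tabs (sign_weight (lam 0)) (negate_sign m)"
      using sum_sign_weight_negate[of a, OF fin[unfolded a] W] unfolding weight_symmetry_def a by simp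
  next
    fix k :: int assume "odd k" "\<bar>k\<bar> \<le> int ?n"
    from coprime_2m[OF hyp this]
    show "(\<Sum>x=1..m. (\<eta> ^ (2 * x - 1)) powi k + (\<eta> ^ (2 * x - 1)) powi - k) = 0"
      using roots_of_unity_power_sum_zero[OF \<eta>4 _ m] \<eta>2 \<zeta>(2) by simp
  next
    fix c assume "c \<in> tabs"
    then obtain T where T: "T \<in> SP lam mu m" "c = signs T" using signs_surj by blast
    let ?a = "\<lambda>x. letter_count D T (Unb x)" and ?b = "\<lambda>x. letter_count D T (Bar x)"
    have n: "int ?n = (\<Sum>x=1..m. int (?a x) + int (?b x))"
      unfolding sum_letter_counts[OF T(1), symmetric] by simp
    have w: "sign_weight (lam 0) c x = int (?a x) - int (?b x)" for x
      unfolding T(2) by (rule sign_weight_signs[OF T(1)])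
    have "(\<Sum>x=1..m. sign_weight (lam 0) c x) = int ?n - 2 * (\<Sum>x=1..m. int (?b x))"
      unfolding n w sum_distrib_left sum_subtractf[symmetric] by (intro sum.cong) auto
    then show "odd (\<Sum>x=1..m. sign_weight (lam 0) c x)" using odd by simp
    show "(\<Sum>x=1..m. \<bar>sign_weight (lam 0) c x\<bar>) \<le> int ?n"
      unfolding n w by (intro sum_mono) auto
  qed (use \<eta>0 in simp)
  then have "(\<Sum>T\<in>SP lam mu m. \<Prod>x=1..m. (\<eta> ^ (2 * x - 1)) powi sign_weight (lam 0) (signs T) x) = 0"
    using sum.reindex_bij_betw[OF bij_signs, of "\<lambda>c. \<Prod>x=1..m. (\<eta> ^ (2 * x - 1)) powi sign_weight (lam 0) c x"]
    by simp
  then have "(\<Sum>T\<in>SP lam mu m. (\<eta>\<^sup>2) ^ pwr m D T * \<eta> ^ ?n) = 0"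
    using pwr_monomial[OF _ \<eta>4 \<eta>0] by simp
  then show ?thesis using \<eta>0 unfolding sum_distrib_right[symmetric] \<eta>2 by simp
qed

end

theorem theorem5p2:
  fixes m n :: nat and lam mu :: "nat \<Rightarrow> nat"
  assumes "m \<ge> 1"
    and "is_partition lam" and "is_partition mu"
    and "contained_in mu lam"
    and "partition_length lam \<le> m"
    and "skew_size lam mu = n" and "odd n"
    and "\<And>p :: nat. prime p \<Longrightarrow> odd p \<Longrightarrow> p \<le> n \<Longrightarrow> gcd m p = 1"
  shows "[SP_poly lam mu m
          = smult (of_nat (card (SP lam mu m)) / of_nat (2 * m)) (\<Sum>k = 0..2 * m - 1. monom 1 k)]
         (mod (monom 1 (2 * m) - 1))"
proof -
  interpret skew_tableaux lam mu m using assms(2-4) by unfold_locales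
  have "(\<Sum>T\<in>SP lam mu m. \<zeta> ^ pwr m (skew_shape lam mu) T) = 0"
    if "\<zeta> ^ (2 * m) = 1" "\<zeta> \<noteq> 1" for \<zeta> :: complex
    using sum_pwr_zero[OF assms(1) _ _ that] assms(6-8) by simp
  then show ?thesis
    unfolding SP_poly_def using finite_SP assms(1) by (intro uniform_polynomial_cong) auto
qed

end
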